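(* Let $1\le r\le n$ and let $F$ be a germ of biholomorphism of $\mathbb{C}^n$ fixing the origin $O$, with diagonalizable differential at $O$ having eigenvalues $\lambda_1,\dots,\lambda_n$. Suppose that $F$ is $2$-resonant with respect to the eigenvalues $\{\lambda_1,\dots,\lambda_r\}$, and that $|\lambda_j|=1$ for $j=1,\dots,r$ and $|\lambda_j|<1$ for $j=r+1,\dots,n$. If $F$ is irregular-nondegenerate and parabolically-attracting, then there exists a basin of attraction for $F$ having $O$ at the boundary.
   Context: Here $\mathbb{N}$ contains $0$; for a multi-index $L=(l_1,\dots,l_n)$ write $|L|=\sum l_h$, $z^L=z_1^{l_1}\cdots z_n^{l_n}$, $\lambda^L=\lambda_1^{l_1}\cdots\lambda_n^{l_n}$; $e_j$ is the $j$-th standard basis vector (also viewed as a multi-index). Basin of attraction: a nonempty open set $V\subset\mathbb{C}^n$, contained in a neighbourhood of $O$ where $F$ is defined, with $O\in\partial V$, $F(V)\subseteq V$ and $F^{\circ\ell}(z)\to O$ as $\ell\to\infty$ for every $z\in V$. Resonances. A resonance is a pair $(j,L)$ with $1\le j\le n$, $L\in\mathbb{N}^n$, $|L|\ge2$ and $\lambda_j=\lambda^L$. The germ $F$ is $2$-resonant with respect to the first $r$ eigenvalues $\lambda_1,\dots,\lambda_r$ if there are two multi-indices $P,Q\in\mathbb{N}^r\times\{0\}^{n-r}$, linearly independent over $\mathbb{Q}$, such that the resonances $(j,L)$ with $1\le j\le r$ are precisely those with $L=e_j+k_1P+k_2Q$, where $k_1,k_2\in\mathbb{N}$ and $k_1+k_2\ge1$.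 The multi-indices $P,Q$, taken in a fixed order, are the ordered generators over $\mathbb{N}$ of the resonances; write $P=(p_1,\dots,p_r,0,\dots,0)$, $Q=(q_1,\dots,q_r,0,\dots,0)$. Weighted order. By the Poincaré–Dulac theorem, for every large $l$, $F$ is holomorphically conjugate (fixing $O$) to a germ $$\widetilde F(z)=Dz+\sum_{s=1}^r\ \sum_{(k_1,k_2)\in\mathbb{N}^2,\ k_1+k_2\ge1}a_{(k_1,k_2),s}\,z^{k_1P+k_2Q}z_s\,e_s+\sum_{s=r+1}^nR_s(z)e_s+O(\|z\|^l),$$ with $D=\mathrm{Diag}(\lambda_1,\dots,\lambda_n)$ and $R_s(z)=O(\|z\|^2)$ for $s>r$ (only terms of degree $<l$ in the double sum matter). The weighted order of $F$ is the minimal $k_0=k_1+k_2\ge1$ such that $a_{(k_1,k_2),s}\ne0$ for some $1\le s\le r$ (taking $l$ large enough); this is well defined, and it is $+\infty$ if no such coefficient exists. The notions below require $k_0<+\infty$. Parabolic shadow. A parabolic shadow of $F$ is the germ $f(u)=u+H_{k_0+1}(u)$ of $(\mathbb{C}^2,O)$ obtained from such a normalization (with $l$ large enough that all terms with $k_1+k_2\le k_0$ have degree $<l$), where $$H_{k_0+1}(u)=\left(u_1\sum_{k_1+k_2=k_0}\Big(\sum_{j=1}^rp_j\frac{a_{(k_1,k_2),j}}{\lambda_j}\Big)u_1^{k_1}u_2^{k_2},\ \ u_2\sum_{k_1+k_2=k_0}\Big(\sum_{j=1}^rq_j\frac{a_{(k_1,k_2),j}}{\lambda_j}\Big)u_1^{k_1}u_2^{k_2}\right).$$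 Characteristic directions. A characteristic direction for $f$ is a nonzero $v\in\mathbb{C}^2$ (or its class $[v]\in\mathbb{P}^1$) with $H_{k_0+1}(v)=\lambda v$ for some $\lambda\in\mathbb{C}$; it is non-degenerate if $\lambda\ne0$ and degenerate if $\lambda=0$. It is normalized if $H_{k_0+1}(v)=-\frac1{k_0}v$. Write $H_{k_0+1}=(Q_1,Q_2)$, $g_1(u)=Q_1(1,u)$, $g_2(u)=Q_2(1,u)-uQ_1(1,u)$, and let $\mu_j(u_0)\in\mathbb{N}$ be the order of vanishing of $g_j$ at $u_0$ (in particular $g_2\not\equiv0$). A characteristic direction $[1:u_0]$ is irregular if $\mu_2(u_0)>\mu_1(u_0)+1$; for the direction $[0:1]$ one uses the same definition after exchanging the two coordinates. $F$ is $(f,v)$-irregular-nondegenerate if $v$ is a normalized non-degenerate characteristic direction of $f$ such that $[v]$ is irregular. $F$ is irregular-nondegenerate if it is $(f,v)$-irregular-nondegenerate with respect to some parabolic shadow $f$ of $F$ and some normalized non-degenerate characteristic direction $v\in\mathbb{C}^2$ of $f$. $F$ is $(f,v)$-parabolically-attracting with respect to $\{\lambda_1,\dots,\lambda_r\}$ if $v=(v_1,v_2)$ is a normalized non-degenerate characteristic direction of $f$ and $$\mathrm{Re}\left(\sum_{k_1+k_2=k_0,\ (k_1,k_2)\in\mathbb{N}^2}\frac{a_{(k_1,k_2),j}}{\lambda_j}v_1^{k_1}v_2^{k_2}\right)<0,\qquad j=1,\dots,r,$$ where the $a_{(k_1,k_2),j}$ are the coefficients of the normalization defining $f$. $F$ is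 parabolically-attracting if it is $(f,v)$-parabolically-attracting with respect to some parabolic shadow $f$ of $F$ and some normalized non-degenerate characteristic direction $v\in\mathbb{C}^2$ of $f$.
   Formalization: "Irregular-nondegenerate" and "parabolically-attracting" are required for one and the same parabolic shadow f and normalized direction v; with separately chosen pairs (f,v), as the definitions literally read, the claim is false. *)

theory Defs
  imports
    "HOL-Complex_Analysis.Complex_Analysis"
    "HOL-Library.Landau_Symbols"
    "HOL-Library.Extended_Nat"
begin

text \<open>
  Points of $\mathbb{C}^n$ are vectors \<open>complex ^ 'n\<close> and multi-indices are functions
  \<open>'n \<Rightarrow> nat\<close>. As \<open>'n\<close> carries no order, the distinguished coordinates $1,\dots,r$ are
  given by a set \<open>R :: 'n set\<close>.
\<close>

definition mdeg :: "('n::finite \<Rightarrow> nat) \<Rightarrow> nat" where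
  "mdeg L = (\<Sum>h\<in>UNIV. L h)"

definition mpow :: "complex ^ 'n \<Rightarrow> ('n::finite \<Rightarrow> nat) \<Rightarrow> complex" where
  "mpow z L = (\<Prod>h\<in>UNIV. (z $ h) ^ L h)"

definition unit_index :: "'n \<Rightarrow> 'n \<Rightarrow> nat" where
  "unit_index j = (\<lambda>h. if h = j then 1 else 0)"

definition comb :: "('n \<Rightarrow> nat) \<Rightarrow> ('n \<Rightarrow> nat) \<Rightarrow> nat \<Rightarrow> nat \<Rightarrow> 'n \<Rightarrow> nat" where
  "comb P Q k1 k2 = (\<lambda>h. k1 * P h + k2 * Q h)"


subsection \<open>Germs of biholomorphisms and basins of attraction\<close>

text \<open>Differentiability with a derivative given by a complex matrix, i.e. complex linear.\<close>

definition holomorphic_map_on ::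
  "(complex ^ 'n \<Rightarrow> complex ^ 'n) \<Rightarrow> (complex ^ 'n::finite) set \<Rightarrow> bool" where
  "holomorphic_map_on F U \<longleftrightarrow>
     open U \<and> (\<forall>z\<in>U. \<exists>A :: complex ^ 'n ^ 'n. (F has_derivative (\<lambda>h. A *v h)) (at z))"

text \<open>\<open>F\<close>, restricted to \<open>U\<close>, represents a germ of biholomorphism fixing the origin; its values
  outside \<open>U\<close> are irrelevant.\<close>

definition biholomorphism_at_origin ::
  "(complex ^ 'n::finite) set \<Rightarrow> (complex ^ 'n \<Rightarrow> complex ^ 'n) \<Rightarrow> bool" where
  "biholomorphism_at_origin U F \<longleftrightarrow>
     0 \<in> U \<and> F 0 = 0 \<and> holomorphic_map_on F U \<and> inj_on F U \<and>
     holomorphic_map_on (inv_into U F) (F ` U)"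

definition basin_of_attraction ::
  "(complex ^ 'n::finite) set \<Rightarrow> (complex ^ 'n \<Rightarrow> complex ^ 'n) \<Rightarrow> (complex ^ 'n) set \<Rightarrow> bool" where
  "basin_of_attraction U F V \<longleftrightarrow>
     V \<noteq> {} \<and> open V \<and> V \<subseteq> U \<and> 0 \<in> frontier V \<and> F ` V \<subseteq> V \<and>
     (\<forall>z\<in>V. (\<lambda>m. (F ^^ m) z) \<longlonglongrightarrow> 0)"

definition diag_matrix :: "complex ^ 'n \<Rightarrow> complex ^ 'n ^ 'n::finite" where
  "diag_matrix lam = (\<chi> i j. if i = j then lam $ i else 0)"

text \<open>The entries of \<open>lam\<close> list the eigenvalues with multiplicity.\<close>

definition diagonalizable_differential ::
  "(complex ^ 'n::finite \<Rightarrow> complex ^ 'n) \<Rightarrow> complex ^ 'n \<Rightarrow> bool" where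
  "diagonalizable_differential F lam \<longleftrightarrow>
     (\<exists>A S :: complex ^ 'n ^ 'n. (F has_derivative (\<lambda>h. A *v h)) (at 0) \<and>
        invertible S \<and> A = S ** diag_matrix lam ** matrix_inv S)"


subsection \<open>Resonances\<close>

definition resonance :: "complex ^ 'n \<Rightarrow> 'n::finite \<Rightarrow> ('n \<Rightarrow> nat) \<Rightarrow> bool" where
  "resonance lam j L \<longleftrightarrow> mdeg L \<ge> 2 \<and> lam $ j = mpow lam L"

text \<open>2-resonance with respect to the eigenvalues \<open>lam $ j\<close>, \<open>j \<in> R\<close>, with ordered generators
  \<open>P\<close>, \<open>Q\<close>.\<close>

definition two_resonant ::
  "complex ^ 'n \<Rightarrow> 'n::finite set \<Rightarrow> ('n \<Rightarrow> nat) \<Rightarrow> ('n \<Rightarrow> nat) \<Rightarrow> bool" where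
  "two_resonant lam R P Q \<longleftrightarrow>
     (\<forall>h. h \<notin> R \<longrightarrow> P h = 0 \<and> Q h = 0) \<and>
     (\<forall>x y :: rat. (\<forall>h. x * of_nat (P h) + y * of_nat (Q h) = 0) \<longrightarrow> x = 0 \<and> y = 0) \<and>
     (\<forall>j\<in>R. \<forall>L. resonance lam j L \<longleftrightarrow>
        (\<exists>k1 k2. k1 + k2 \<ge> 1 \<and> L = (\<lambda>h. unit_index j h + comb P Q k1 k2 h)))"


subsection \<open>Poincare--Dulac normalizations and the weighted order\<close>

text \<open>The monomial attached to \<open>(k1, k2)\<close> has degree \<open>mdeg (comb P Q k1 k2) + 1\<close>; since
  \<open>P\<close> and \<open>Q\<close> are nonzero, the sum below is finite. For \<open>s \<notin> R\<close> the term $R_s(z)$ and the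
  remainder $O(\|z\|^l)$ together are an arbitrary $O(\|z\|^2)$.\<close>

definition normal_form ::
  "complex ^ 'n \<Rightarrow> 'n::finite set \<Rightarrow> ('n \<Rightarrow> nat) \<Rightarrow> ('n \<Rightarrow> nat) \<Rightarrow>
   nat \<Rightarrow> (nat \<Rightarrow> nat \<Rightarrow> 'n \<Rightarrow> complex) \<Rightarrow> (complex ^ 'n \<Rightarrow> complex ^ 'n) \<Rightarrow> bool" where
  "normal_form lam R P Q l a G \<longleftrightarrow>
     (\<forall>s\<in>R. (\<lambda>z. norm (G z $ s - lam $ s * z $ s -
          (\<Sum>(k1, k2)\<in>{(k1, k2). k1 + k2 \<ge> 1 \<and> mdeg (comb P Q k1 k2) + 1 < l}.
             a k1 k2 s * mpow z (comb P Q k1 k2) * z $ s)))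
        \<in> O[nhds 0](\<lambda>z. norm z ^ l)) \<and>
     (\<forall>s. s \<notin> R \<longrightarrow>
        (\<lambda>z. norm (G z $ s - lam $ s * z $ s)) \<in> O[nhds 0](\<lambda>z. norm z ^ 2))"

definition normalization ::
  "(complex ^ 'n \<Rightarrow> complex ^ 'n) \<Rightarrow> complex ^ 'n \<Rightarrow> 'n::finite set \<Rightarrow>
   ('n \<Rightarrow> nat) \<Rightarrow> ('n \<Rightarrow> nat) \<Rightarrow> nat \<Rightarrow> (nat \<Rightarrow> nat \<Rightarrow> 'n \<Rightarrow> complex) \<Rightarrow> bool" where
  "normalization F lam R P Q l a \<longleftrightarrow> l \<ge> 2 \<and>
     (\<exists>\<phi> G. (\<exists>U. biholomorphism_at_origin U \<phi>) \<and> (\<exists>U. biholomorphism_at_origin U G) \<and>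
        (\<forall>\<^sub>F z in nhds 0. \<phi> (F z) = G (\<phi> z)) \<and> normal_form lam R P Q l a G)"

text \<open>The least \<open>k1 + k2\<close> carrying a nonzero coefficient in the normalizations of large order
  \<open>l\<close> does not depend on the normalization, so it can be taken over all of them at once; a
  normalization of order \<open>l\<close> only determines the coefficients of terms of degree less than \<open>l\<close>.
  The infimum of the empty set is $\infty$.\<close>

definition weighted_order ::
  "(complex ^ 'n \<Rightarrow> complex ^ 'n) \<Rightarrow> complex ^ 'n \<Rightarrow> 'n::finite set \<Rightarrow>
   ('n \<Rightarrow> nat) \<Rightarrow> ('n \<Rightarrow> nat) \<Rightarrow> enat" where
  "weighted_order F lam R P Q =
     Inf {enat (k1 + k2) | k1 k2 l a s.
            normalization F lam R P Q l a \<and> k1 + k2 \<ge> 1 \<and>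
            mdeg (comb P Q k1 k2) + 1 < l \<and> s \<in> R \<and> a k1 k2 s \<noteq> 0}"


subsection \<open>Parabolic shadows and their characteristic directions\<close>

definition shadow_term ::
  "complex ^ 'n \<Rightarrow> 'n::finite set \<Rightarrow> ('n \<Rightarrow> nat) \<Rightarrow> ('n \<Rightarrow> nat) \<Rightarrow>
   nat \<Rightarrow> (nat \<Rightarrow> nat \<Rightarrow> 'n \<Rightarrow> complex) \<Rightarrow> complex ^ 2 \<Rightarrow> complex ^ 2" where
  "shadow_term lam R P Q k0 a u = vector
     [u $ 1 * (\<Sum>(k1, k2)\<in>{(k1, k2). k1 + k2 = k0}.
        (\<Sum>j\<in>R. of_nat (P j) * (a k1 k2 j / lam $ j)) * (u $ 1) ^ k1 * (u $ 2) ^ k2),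
      u $ 2 * (\<Sum>(k1, k2)\<in>{(k1, k2). k1 + k2 = k0}.
        (\<Sum>j\<in>R. of_nat (Q j) * (a k1 k2 j / lam $ j)) * (u $ 1) ^ k1 * (u $ 2) ^ k2)]"

text \<open>\<open>f\<close> is the parabolic shadow of \<open>F\<close> obtained from a normalization with coefficients \<open>a\<close>;
  \<open>k0\<close> is the (finite) weighted order of \<open>F\<close>.\<close>

definition parabolic_shadow ::
  "(complex ^ 'n \<Rightarrow> complex ^ 'n) \<Rightarrow> complex ^ 'n \<Rightarrow> 'n::finite set \<Rightarrow>
   ('n \<Rightarrow> nat) \<Rightarrow> ('n \<Rightarrow> nat) \<Rightarrow> nat \<Rightarrow> (nat \<Rightarrow> nat \<Rightarrow> 'n \<Rightarrow> complex) \<Rightarrow>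
   (complex ^ 2 \<Rightarrow> complex ^ 2) \<Rightarrow> bool" where
  "parabolic_shadow F lam R P Q k0 a f \<longleftrightarrow>
     weighted_order F lam R P Q = enat k0 \<and>
     (\<exists>l. normalization F lam R P Q l a \<and>
        (\<forall>k1 k2. k1 + k2 \<le> k0 \<longrightarrow> mdeg (comb P Q k1 k2) + 1 < l)) \<and>
     f = (\<lambda>u. u + shadow_term lam R P Q k0 a u)"

text \<open>For a parabolic shadow \<open>f\<close> this is the homogeneous term $H_{k_0+1}$.\<close>

definition leading_part :: "(complex ^ 2 \<Rightarrow> complex ^ 2) \<Rightarrow> complex ^ 2 \<Rightarrow> complex ^ 2" where
  "leading_part f u = f u - u"

definition nondegenerate_direction :: "(complex ^ 2 \<Rightarrow> complex ^ 2) \<Rightarrow> complex ^ 2 \<Rightarrow> bool" where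
  "nondegenerate_direction f v \<longleftrightarrow> v \<noteq> 0 \<and> (\<exists>c. c \<noteq> 0 \<and> leading_part f v = c *s v)"

definition normalized_direction ::
  "nat \<Rightarrow> (complex ^ 2 \<Rightarrow> complex ^ 2) \<Rightarrow> complex ^ 2 \<Rightarrow> bool" where
  "normalized_direction k0 f v \<longleftrightarrow> leading_part f v = (- 1 / of_nat k0) *s v"

text \<open>\<open>zorder g u0\<close> is the order of vanishing of \<open>g\<close> at \<open>u0\<close>, meaningful only for \<open>g\<close> not
  identically zero.\<close>

definition irregular_at :: "(complex ^ 2 \<Rightarrow> complex ^ 2) \<Rightarrow> complex \<Rightarrow> bool" where
  "irregular_at H u0 \<longleftrightarrow>
     (let g1 = (\<lambda>u. H (vector [1, u]) $ 1);
          g2 = (\<lambda>u. H (vector [1, u]) $ 2 - u * H (vector [1, u]) $ 1)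
      in (\<exists>u. g1 u \<noteq> 0) \<and> (\<exists>u. g2 u \<noteq> 0) \<and> zorder g2 u0 > zorder g1 u0 + 1)"

definition swap2 :: "complex ^ 2 \<Rightarrow> complex ^ 2" where
  "swap2 u = vector [u $ 2, u $ 1]"

definition irregular_direction :: "(complex ^ 2 \<Rightarrow> complex ^ 2) \<Rightarrow> complex ^ 2 \<Rightarrow> bool" where
  "irregular_direction f v \<longleftrightarrow>
     (if v $ 1 \<noteq> 0 then irregular_at (leading_part f) (v $ 2 / v $ 1)
      else irregular_at (swap2 \<circ> leading_part f \<circ> swap2) 0)"

definition irregular_nondegenerate_wrt ::
  "nat \<Rightarrow> (complex ^ 2 \<Rightarrow> complex ^ 2) \<Rightarrow> complex ^ 2 \<Rightarrow> bool" where
  "irregular_nondegenerate_wrt k0 f v \<longleftrightarrow>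
     nondegenerate_direction f v \<and> normalized_direction k0 f v \<and> irregular_direction f v"

text \<open>
  The coefficients \<open>a\<close> are those of the normalization defining \<open>f\<close>. This condition and
  \<open>irregular_nondegenerate_wrt\<close> must be used for the same \<open>f\<close> and \<open>v\<close>: the germ
  $F_j = \lambda_j z_j \exp(\alpha_j z^P + \beta_j z^Q)$ of $\mathbb{C}^3$ with $P = (2,3,0)$, $Q = (0,3,2)$,
  $\alpha = (2,-1,2)$, $\beta = (1/10,1/5,1/5)$, $\lambda = (e^{i t}, e^{-2 i t/3}, -e^{i t})$ and
  $t/\pi$ irrational is irregular-nondegenerate along $(-1,0)$ and parabolically attracting along
  $(0,-1)$, but it has no basin of attraction.
\<close>

definition parabolically_attracting_wrt ::
  "complex ^ 'n \<Rightarrow> 'n::finite set \<Rightarrow> nat \<Rightarrow> (nat \<Rightarrow> nat \<Rightarrow> 'n \<Rightarrow> complex) \<Rightarrow>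
   (complex ^ 2 \<Rightarrow> complex ^ 2) \<Rightarrow> complex ^ 2 \<Rightarrow> bool" where
  "parabolically_attracting_wrt lam R k0 a f v \<longleftrightarrow>
     nondegenerate_direction f v \<and> normalized_direction k0 f v \<and>
     (\<forall>j\<in>R. Re (\<Sum>(k1, k2)\<in>{(k1, k2). k1 + k2 = k0}.
        a k1 k2 j / lam $ j * (v $ 1) ^ k1 * (v $ 2) ^ k2) < 0)"

end

theory Submission imports Defs begin

text \<open>
  In normalized coordinates the germ multiplies a resonant coordinate $z_j$ by
  $\lambda_j(1+A_j(u)+\dots)$, where $u=(z^P,z^Q)$ and $A_j$ is homogeneous of degree $k_0$. Since
  $\lambda^P=\lambda^Q=1$, the pair $u$ moves by a map tangent to the identity whose
  leading part is the parabolic shadow. Let $v$ be the direction, with $v_1\ne0$ (otherwise exchange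
  $P$ and $Q$), and let $y=u_2/u_1$, $y_0=v_2/v_1$.

  The function $U=(v_1/u_1)^{k_0}$ satisfies $U\circ F=U+1+o(1)$, because $v$ is normalized. So $U$
  measures time. An irregular direction has no linear term in the transversal direction: for
  $\eta=y-y_0$ one finds $\eta\circ F=\eta+(c\,\eta^m+\dots)/U$ with $m\ge2$, a parabolic flow in the time
  $\log n$. It has attracting petals, described by a second Fatou coordinate $\zeta=c'/\eta^{m-1}$ with
  $\zeta\circ F=\zeta+(1+o(1))/U$. The conditions that $U$ lies far out in a narrow cone and that
  \<open>Re \<zeta>\<close> is large are therefore preserved. As $\zeta$ grows only logarithmically, the modulus of
  $\zeta$ also stays below a small power of that of $U$, and then $\eta^m$ dominates
  all errors of order $u_1^{k_0+1}$.

  Parabolic attraction, used for the same $v$, says that $z_j$ shrinks by a factor $1-\gamma/|U|$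
  with $\gamma>0$, while coordinates with $|\lambda_j|<1$ shrink geometrically. So
  $|z_j|^M<|u_1/v_1|$ is preserved if $M$ is large. This bounds the remainder of a normal form of order
  $l$ by a power of $u_1$, which is high enough only if $l$ is large compared with $M$.
  A given normalization need not have so high an order and is first continued by the
  Poincare--Dulac method, with multivariate Taylor expansion reduced to one complex
  variable (\<open>taylor_leading_term\<close>, \<open>dulac_coordinates_exist\<close>).

  The one-step estimates are limits along the filter \<open>deep\<close> of the regions \<open>D K\<close>
  (\<open>U_increment\<close>, \<open>zeta_increment\<close>, \<open>coordinate_invariance\<close>); they give the
  invariance of \<open>D K\<close> for large \<open>K\<close> (\<open>D_invariant\<close>). These regions are open, consist of
  points whose orbits tend to the origin, and accumulate at the origin (\<open>D_accumulates\<close>) because an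
  irregular direction contracts $u_1$ and $u_2$ at the same rate.
\<close>

(* Below, the dollar sign denotes components of vectors only. *)
no_notation fps_nth (infixl "$" 75)

section \<open>Taylor expansion of holomorphic functions of several variables\<close>

lemma norm_vector_smult: "norm (c *s x) = norm c * norm (x :: complex ^ 'n)"
proof -
  have "(\<Sum>i\<in>UNIV. (norm (c * x $ i))\<^sup>2) = (norm c)\<^sup>2 * (\<Sum>i\<in>UNIV. (norm (x $ i))\<^sup>2)"
    by (simp add: norm_mult power_mult_distrib sum_distrib_left)
  then show ?thesis
    by (simp add: norm_vec_def L2_set_def real_sqrt_mult)
qed

text \<open>
  The quotient of \<open>\<phi>\<close> by \<open>t ^ k\<close> extends to a function \<open>\<psi>\<close> bounded by \<open>C\<close>, and the Schwarz lemma
  applied to \<open>\<psi> - \<psi> 0\<close> gives the remainder. The constant is explicit because the lemma is applied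
  on all complex lines through the origin at once.
\<close>

lemma leading_coefficient_bound:
  fixes \<phi> :: "complex \<Rightarrow> complex"
  assumes hol: "\<phi> holomorphic_on ball 0 \<rho>" and "\<rho> > 0" "C > 0"
    and bd: "\<And>t. norm t < \<rho> \<Longrightarrow> norm (\<phi> t) \<le> C * norm t ^ k"
  shows "\<exists>a. norm a \<le> C \<and> (\<forall>t. norm t < \<rho> \<longrightarrow> norm (\<phi> t - a * t ^ k) \<le> 3 * C / \<rho> * norm t ^ (k + 1))"
proof -
  have bdq: "norm (\<phi> t / t ^ k) \<le> C" if "norm t < \<rho>" "t \<noteq> 0" for t
    using bd[OF that(1)] that(2) by (simp add: norm_divide norm_power divide_simps)
  have "(\<lambda>t. \<phi> t / t ^ k) holomorphic_on ball 0 \<rho> - {0}"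
    by (intro holomorphic_intros holomorphic_on_subset[OF hol]) auto
  moreover have "(0 :: complex) \<in> interior (ball 0 \<rho>)" using \<open>\<rho> > 0\<close> by simp
  moreover have "eventually (\<lambda>t. norm (\<phi> t / t ^ k) \<le> C) (at 0)"
    unfolding eventually_at using bdq \<open>\<rho> > 0\<close> by (auto intro!: exI[of _ \<rho>])
  ultimately obtain \<psi> where hol\<psi>: "\<psi> holomorphic_on ball 0 \<rho>"
    and \<psi>: "\<And>t. t \<in> ball 0 \<rho> - {0} \<Longrightarrow> \<psi> t = \<phi> t / t ^ k"
    using holomorphic_on_extend_bounded[of "\<lambda>t. \<phi> t / t ^ k" "ball 0 \<rho>" 0] by blast
  have cont: "isCont \<psi> 0"
    using holomorphic_on_imp_continuous_on[OF hol\<psi>] \<open>\<rho> > 0\<close>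
    by (simp add: continuous_on_eq_continuous_at)
  have "eventually (\<lambda>t. norm (\<psi> t) \<le> C) (at 0)"
    unfolding eventually_at using bdq \<psi> \<open>\<rho> > 0\<close> by (auto intro!: exI[of _ \<rho>])
  then have \<psi>0: "norm (\<psi> 0) \<le> C"
    using cont by (intro Lim_norm_ubound[of "at 0" \<psi>]) (auto simp: isCont_def)
  have \<psi>b: "norm (\<psi> t) \<le> C" if "norm t < \<rho>" for t
    using that bdq[of t] \<psi>[of t] \<psi>0 by (cases "t = 0") auto
  have id\<phi>: "\<phi> t = \<psi> t * t ^ k" if "norm t < \<rho>" for t
  proof (cases "t = 0")
    case False
    then show ?thesis using \<psi>[of t] that by auto
  next
    case True
    show ?thesis
    proof (cases k)
      case 0
      have "((\<lambda>t. \<phi> t) \<longlongrightarrow> \<phi> 0) (at 0)"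
        using holomorphic_on_imp_continuous_on[OF hol] \<open>\<rho> > 0\<close>
        by (simp add: continuous_on_eq_continuous_at isCont_def)
      moreover have "eventually (\<lambda>t. \<phi> t = \<psi> t) (at 0)"
        unfolding eventually_at using \<psi> 0 \<open>\<rho> > 0\<close> by (auto intro!: exI[of _ \<rho>])
      ultimately have "(\<psi> \<longlongrightarrow> \<phi> 0) (at 0)" using tendsto_cong by blast
      then have "\<phi> 0 = \<psi> 0" using cont LIM_unique unfolding isCont_def by blast
      then show ?thesis using True 0 by simp
    next
      case (Suc m)
      then show ?thesis using True bd[of 0] \<open>\<rho> > 0\<close> by simp
    qed
  qed
  \<comment> \<open>The factor 3 instead of 2 makes the bound 1 strict, as the Schwarz lemma requires.\<close>
  define S where "S = (\<lambda>s. (\<psi> (of_real \<rho> * s) - \<psi> 0) / of_real (3 * C))"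
  have S_hol: "S holomorphic_on ball 0 1"
  proof -
    have "(\<psi> \<circ> (\<lambda>s. of_real \<rho> * s)) holomorphic_on ball 0 1"
      by (intro holomorphic_on_compose_gen[OF _ hol\<psi>] holomorphic_intros)
        (use \<open>\<rho> > 0\<close> in \<open>auto simp: norm_mult\<close>)
    then show ?thesis unfolding S_def o_def using \<open>C > 0\<close>
      by (intro holomorphic_intros) auto
  qed
  have S_bd: "norm (S s) < 1" if "norm s < 1" for s
  proof -
    have "norm (of_real \<rho> * s) < \<rho>" using that \<open>\<rho> > 0\<close> by (simp add: norm_mult)
    then have "norm (\<psi> (of_real \<rho> * s) - \<psi> 0) \<le> C + C"
      using \<psi>b \<psi>0 by (meson add_mono norm_triangle_ineq4 order_trans)
    also have "\<dots> < 3 * C" using \<open>C > 0\<close> by simp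
    finally show ?thesis using \<open>C > 0\<close> by (simp add: S_def norm_divide)
  qed
  have Schw: "norm (S s) \<le> norm s" if "norm s < 1" for s
    using Schwarz_Lemma(1)[OF S_hol _ S_bd that] by (simp add: S_def)
  have "norm (\<phi> t - \<psi> 0 * t ^ k) \<le> 3 * C / \<rho> * norm t ^ (k + 1)" if t: "norm t < \<rho>" for t
  proof -
    have "norm (S (t / of_real \<rho>)) \<le> norm (t / of_real \<rho>)"
      using t \<open>\<rho> > 0\<close> by (intro Schw) (simp add: norm_divide)
    then have *: "norm (\<psi> t - \<psi> 0) \<le> 3 * C / \<rho> * norm t"
      using \<open>\<rho> > 0\<close> \<open>C > 0\<close> by (simp add: S_def norm_divide divide_simps mult_ac)
    have "\<phi> t - \<psi> 0 * t ^ k = (\<psi> t - \<psi> 0) * t ^ k"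
      using id\<phi>[OF t] by (simp add: algebra_simps)
    then have "norm (\<phi> t - \<psi> 0 * t ^ k) = norm (\<psi> t - \<psi> 0) * norm t ^ k"
      by (simp add: norm_mult norm_power)
    also have "\<dots> \<le> 3 * C / \<rho> * norm t * norm t ^ k"
      using * by (intro mult_right_mono) auto
    finally show ?thesis by (simp add: mult_ac)
  qed
  then show ?thesis using \<psi>0 by blast
qed

text \<open>
  Holomorphy along complex lines is inherited by sums, products and locally uniform limits through the
  theory of one complex variable.
\<close>

definition line_holomorphic :: "real \<Rightarrow> (complex ^ 'n \<Rightarrow> complex) \<Rightarrow> bool" where
  "line_holomorphic r f \<longleftrightarrow>
     (\<forall>a b. (\<lambda>t. f (a + t *s b)) holomorphic_on {t. norm (a + t *s b) < r})"

definition polynomial_map :: "(complex ^ 'n::finite \<Rightarrow> complex) \<Rightarrow> bool" where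
  "polynomial_map p \<longleftrightarrow> (\<exists>A c. finite A \<and> p = (\<lambda>z. \<Sum>L\<in>A. c L * mpow z L))"

lemma polynomial_mapI:
  assumes "finite A" "\<And>z. p z = (\<Sum>L\<in>A. c L * mpow z L)"
  shows "polynomial_map p"
  unfolding polynomial_map_def using assms by (intro exI[of _ A] exI[of _ c]) (simp add: fun_eq_iff)

lemma polynomial_map_add:
  assumes "polynomial_map p" "polynomial_map q"
  shows "polynomial_map (\<lambda>z. p z + q z)"
proof -
  obtain A c B d where A: "finite A" "p = (\<lambda>z. \<Sum>L\<in>A. c L * mpow z L)"
    and B: "finite B" "q = (\<lambda>z. \<Sum>L\<in>B. d L * mpow z L)"
    using assms unfolding polynomial_map_def by blast
  define e where "e = (\<lambda>L. (if L \<in> A then c L else 0) + (if L \<in> B then d L else 0))"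
  have "(\<Sum>L\<in>A. c L * mpow z L) = (\<Sum>L\<in>A \<union> B. (if L \<in> A then c L else 0) * mpow z L)" for z
    using A(1) B(1) by (intro sum.mono_neutral_cong_left) auto
  moreover have "(\<Sum>L\<in>B. d L * mpow z L) = (\<Sum>L\<in>A \<union> B. (if L \<in> B then d L else 0) * mpow z L)" for z
    using A(1) B(1) by (intro sum.mono_neutral_cong_left) auto
  ultimately have "(\<lambda>z. p z + q z) = (\<lambda>z. \<Sum>L\<in>A \<union> B. e L * mpow z L)"
    by (simp add: A(2) B(2) e_def distrib_right sum.distrib)
  then show ?thesis using A(1) B(1) unfolding polynomial_map_def by blast
qed

lemma polynomial_map_const_mult:
  "polynomial_map p \<Longrightarrow> polynomial_map (\<lambda>z. a * p z)"
  unfolding polynomial_map_def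
proof (elim exE conjE)
  fix A c assume "finite A" "p = (\<lambda>z. \<Sum>L\<in>A. c L * mpow z L)"
  then show "\<exists>A c. finite A \<and> (\<lambda>z. a * p z) = (\<lambda>z. \<Sum>L\<in>A. c L * mpow z L)"
    by (intro exI[of _ A] exI[of _ "\<lambda>L. a * c L"]) (auto simp: sum_distrib_left mult_ac)
qed

lemma polynomial_map_const: "polynomial_map (\<lambda>z :: complex ^ 'n::finite. a)"
  unfolding polynomial_map_def
  by (intro exI[of _ "{\<lambda>h. 0}"] exI[of _ "\<lambda>_. a"]) (simp add: mpow_def)

lemma polynomial_map_sum:
  "finite I \<Longrightarrow> (\<And>i. i \<in> I \<Longrightarrow> polynomial_map (p i)) \<Longrightarrow> polynomial_map (\<lambda>z. \<Sum>i\<in>I. p i z)"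
  by (induction I rule: finite_induct) (simp_all add: polynomial_map_add polynomial_map_const)

lemma mpow_Suc: "mpow z (L(i := Suc (L i))) = z $ i * mpow z L"
proof -
  have "mpow z (L(i := Suc (L i))) = z $ i ^ Suc (L i) * (\<Prod>h\<in>UNIV - {i}. z $ h ^ L h)"
    unfolding mpow_def by (subst prod.remove[of _ i]) auto
  also have "\<dots> = z $ i * mpow z L"
    unfolding mpow_def by (subst (2) prod.remove[of _ i]) auto
  finally show ?thesis .
qed

lemma polynomial_map_coord_mult:
  assumes "polynomial_map p"
  shows "polynomial_map (\<lambda>z. z $ i * p z)"
proof -
  obtain A c where A: "finite A" "p = (\<lambda>z. \<Sum>L\<in>A. c L * mpow z L)"
    using assms unfolding polynomial_map_def by blast
  define s where "s = (\<lambda>L. L(i := Suc (L i)))"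
  have inj: "inj s"
  proof (rule injI)
    fix L M assume "s L = s M"
    show "L = M"
    proof
      fix h
      have "s L h = s M h" using \<open>s L = s M\<close> by simp
      then show "L h = M h" by (cases "h = i") (simp_all add: s_def)
    qed
  qed
  have eq: "(\<Sum>L\<in>s ` A. c (inv s L) * mpow z L) = z $ i * p z" for z
  proof -
    have "(\<Sum>L\<in>s ` A. c (inv s L) * mpow z L) = (\<Sum>L\<in>A. c L * mpow z (s L))"
      by (subst sum.reindex[OF inj_on_subset[OF inj subset_UNIV]]) (simp add: inv_f_f[OF inj])
    also have "\<dots> = z $ i * p z"
      by (simp add: A(2) s_def mpow_Suc sum_distrib_left mult_ac)
    finally show ?thesis .
  qed
  show ?thesis
    by (rule polynomial_mapI[of "s ` A" _ "\<lambda>L. c (inv s L)"]) (simp_all add: eq A(1))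
qed

lemma polynomial_map_coord_power_mult:
  "polynomial_map p \<Longrightarrow> polynomial_map (\<lambda>z. z $ i ^ k * p z)"
proof (induction k)
  case (Suc k)
  from polynomial_map_coord_mult[OF Suc.IH[OF Suc.prems], of i] show ?case
    by (simp add: mult.assoc)
qed simp

definition erase_coord :: "'n \<Rightarrow> complex ^ 'n \<Rightarrow> complex ^ 'n" where
  "erase_coord i z = (\<chi> h. if h = i then 0 else z $ h)"

lemma polynomial_map_erase:
  assumes "polynomial_map p"
  shows "polynomial_map (\<lambda>z. p (erase_coord i z))"
proof -
  obtain A c where A: "finite A" "p = (\<lambda>z. \<Sum>L\<in>A. c L * mpow z L)"
    using assms unfolding polynomial_map_def by blast
  have "mpow (erase_coord i z) L = (if L i = 0 then mpow z L else 0)" for z L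
  proof (cases "L i = 0")
    case True
    then show ?thesis unfolding mpow_def erase_coord_def by (auto intro!: prod.cong)
  next
    case False
    then show ?thesis unfolding mpow_def erase_coord_def by (auto intro!: prod_zero bexI[of _ i])
  qed
  then have "p (erase_coord i z) = (\<Sum>L\<in>A. (if L i = 0 then c L else 0) * mpow z L)" for z
    unfolding A(2) by (intro sum.cong) auto
  then show ?thesis by (rule polynomial_mapI[OF A(1)])
qed

definition lagrange_basis :: "nat \<Rightarrow> nat \<Rightarrow> complex poly" where
  "lagrange_basis k m = (\<Prod>j\<in>{..k} - {m}. smult (1 / (of_nat m - of_nat j)) [:- of_nat j, 1:])"

lemma lagrange_interpolation:
  fixes f :: "complex poly"
  assumes "degree f \<le> k"
  shows "f = (\<Sum>m\<le>k. smult (poly f (of_nat m)) (lagrange_basis k m))"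
proof (rule poly_eqI_degree[where A = "of_nat ` {..k}"])
  have card: "card (of_nat ` {..k} :: complex set) = Suc k"
    by (subst card_image) (auto simp: inj_on_def)
  show "card (of_nat ` {..k} :: complex set) > degree f" using card assms by simp
  have "degree (lagrange_basis k m) \<le> k" if "m \<le> k" for m
  proof -
    have "degree (lagrange_basis k m) \<le> (\<Sum>j\<in>{..k} - {m}. 1)"
      unfolding lagrange_basis_def
      by (rule order_trans[OF degree_prod_sum_le]) (auto intro!: sum_mono order_trans[OF degree_smult_le])
    also have "\<dots> = k" using that by simp
    finally show ?thesis .
  qed
  then have "degree (\<Sum>m\<le>k. smult (poly f (of_nat m)) (lagrange_basis k m)) \<le> k"
    by (intro degree_sum_le) (auto intro: order_trans[OF degree_smult_le])
  then show "degree (\<Sum>m\<le>k. smult (poly f (of_nat m)) (lagrange_basis k m)) < card (of_nat ` {..k} :: complex set)"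
    using card by simp
  fix x :: complex assume "x \<in> of_nat ` {..k}"
  then obtain n where n: "n \<le> k" "x = of_nat n" by auto
  have L: "poly (lagrange_basis k m) (of_nat n) = (if m = n then 1 else 0)" if "m \<le> k" for m
  proof (cases "m = n")
    case True
    then show ?thesis
      unfolding lagrange_basis_def poly_prod
      by (intro trans[OF prod.neutral]) (auto simp: divide_simps)
  next
    case False
    then show ?thesis
      unfolding lagrange_basis_def poly_prod using n(1) by (auto intro!: prod_zero bexI[of _ n])
  qed
  have "poly (\<Sum>m\<le>k. smult (poly f (of_nat m)) (lagrange_basis k m)) x
      = (\<Sum>m\<le>k. poly f (of_nat m) * (if m = n then 1 else 0))"
    unfolding poly_sum n(2) by (intro sum.cong) (auto simp: L)
  also have "\<dots> = poly f x" using n by (simp add: if_distrib sum.delta' cong: if_cong)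
  finally show "poly f x = poly (\<Sum>m\<le>k. smult (poly f (of_nat m)) (lagrange_basis k m)) x" by simp
qed

text \<open>
  Induction on the set of coordinates that may be nonzero: Lagrange interpolation at
  \<open>0, \<dots>, k\<close> in one coordinate expresses \<open>g\<close> through its restrictions to hyperplanes
  on which that coordinate is constant, to which the induction hypothesis applies.
\<close>

lemma separately_polynomial_imp_polynomial_map:
  fixes g :: "complex ^ 'n::finite \<Rightarrow> complex"
  assumes "\<And>z i. \<exists>f. degree f \<le> k \<and> (\<forall>s. g (z + s *s axis i 1) = poly f s)"
  shows "polynomial_map g"
proof -
  have "\<exists>p. polynomial_map p \<and> (\<forall>z. (\<forall>h. h \<notin> S \<longrightarrow> z $ h = 0) \<longrightarrow> g z = p z)" if "finite S" for S
    using that assms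
  proof (induction S arbitrary: g rule: finite_induct)
    case empty
    have "z = 0" if "\<forall>h. z $ h = 0" for z :: "complex ^ 'n" using that by (simp add: vec_eq_iff)
    then show ?case by (intro exI[of _ "\<lambda>z. g 0"]) (auto intro: polynomial_map_const)
  next
    case (insert i S)
    define gm where "gm = (\<lambda>m z. g (z + of_nat m *s axis i 1))"
    have "\<exists>f. degree f \<le> k \<and> (\<forall>s. gm m (z + s *s axis j 1) = poly f s)" for m z j
    proof -
      obtain f where "degree f \<le> k" "\<forall>s. g ((z + of_nat m *s axis i 1) + s *s axis j 1) = poly f s"
        using insert.prems by blast
      then show ?thesis unfolding gm_def by (auto simp: ac_simps)
    qed
    then have "\<exists>p. polynomial_map p \<and> (\<forall>z. (\<forall>h. h \<notin> S \<longrightarrow> z $ h = 0) \<longrightarrow> gm m z = p z)" for m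
      by (rule insert.IH)
    then obtain p where p: "\<And>m. polynomial_map (p m)"
      "\<And>m z. (\<forall>h. h \<notin> S \<longrightarrow> z $ h = 0) \<Longrightarrow> gm m z = p m z" by metis
    define q where "q = (\<lambda>z. \<Sum>m\<le>k. \<Sum>j\<le>degree (lagrange_basis k m).
        coeff (lagrange_basis k m) j * (z $ i ^ j * p m (erase_coord i z)))"
    have "polynomial_map q"
      unfolding q_def by (intro polynomial_map_sum polynomial_map_const_mult
          polynomial_map_coord_power_mult polynomial_map_erase p(1)) auto
    moreover have "g z = q z" if z: "\<forall>h. h \<notin> insert i S \<longrightarrow> z $ h = 0" for z
    proof -
      have ez: "\<forall>h. h \<notin> S \<longrightarrow> erase_coord i z $ h = 0" using z by (auto simp: erase_coord_def)
      obtain f where f: "degree f \<le> k" "\<And>s. g (erase_coord i z + s *s axis i 1) = poly f s"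
        using insert.prems by blast
      have "z = erase_coord i z + (z $ i) *s axis i 1"
        by (simp add: vec_eq_iff erase_coord_def axis_def)
      then have "g z = poly f (z $ i)" using f(2)[of "z $ i"] by metis
      also have "\<dots> = (\<Sum>m\<le>k. poly f (of_nat m) * poly (lagrange_basis k m) (z $ i))"
        by (subst lagrange_interpolation[OF f(1)]) (simp add: poly_sum)
      also have "\<dots> = (\<Sum>m\<le>k. p m (erase_coord i z) * poly (lagrange_basis k m) (z $ i))"
        using f(2) p(2)[OF ez] unfolding gm_def by (intro sum.cong) auto
      also have "\<dots> = q z"
        unfolding q_def by (intro sum.cong) (auto simp: poly_altdef sum_distrib_left mult_ac)
      finally show ?thesis .
    qed
    ultimately show ?case by blast
  qed
  from this[of UNIV] obtain p where "polynomial_map p" "\<And>z. g z = p z" by auto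
  then have "g = p" by blast
  then show ?thesis using \<open>polynomial_map p\<close> by simp
qed

lemma mpow_smult: "mpow (t *s z) L = t ^ mdeg L * mpow z L"
  by (simp add: mpow_def mdeg_def power_mult_distrib prod.distrib power_sum)

lemma finite_mdeg_eq: "finite {L :: 'n::finite \<Rightarrow> nat. mdeg L = k}"
proof -
  have "L h \<le> mdeg L" for L :: "'n \<Rightarrow> nat" and h
    unfolding mdeg_def by (intro member_le_sum) auto
  then have "{L :: 'n \<Rightarrow> nat. mdeg L = k} \<subseteq> PiE UNIV (\<lambda>_. {..k})"
    by (auto simp: PiE_def)
  then show ?thesis by (rule finite_subset) (intro finite_PiE; simp)
qed

text \<open>
  Compare the coefficients of \<open>t ^ k\<close> in \<open>g (t *s z)\<close>.
\<close>

lemma homogeneous_polynomial_map: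
  fixes g :: "complex ^ 'n::finite \<Rightarrow> complex"
  assumes "polynomial_map g" and hom: "\<And>t z. g (t *s z) = t ^ k * g z"
  shows "\<exists>c. \<forall>z. g z = (\<Sum>L\<in>{L. mdeg L = k}. c L * mpow z L)"
proof -
  obtain A c where A: "finite A" "g = (\<lambda>z. \<Sum>L\<in>A. c L * mpow z L)"
    using assms unfolding polynomial_map_def by blast
  have "g z = (\<Sum>L\<in>{L. mdeg L = k}. (if L \<in> A then c L else 0) * mpow z L)" for z
  proof -
    let ?p = "\<Sum>L\<in>A. monom (c L * mpow z L) (mdeg L)"
    have "poly ?p t = poly (monom (g z) k) t" for t
    proof -
      have "poly ?p t = g (t *s z)" by (simp add: A(2) poly_sum poly_monom mpow_smult mult_ac)
      then show ?thesis by (simp add: hom poly_monom mult.commute)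
    qed
    then have "?p = monom (g z) k" by (simp add: poly_eq_poly_eq_iff[symmetric] fun_eq_iff)
    then have "g z = coeff ?p k" by simp
    also have "\<dots> = (\<Sum>L\<in>A. if mdeg L = k then c L * mpow z L else 0)"
      by (simp add: coeff_sum)
    also have "\<dots> = (\<Sum>L\<in>A \<inter> {L. mdeg L = k}. c L * mpow z L)"
      using A(1) by (simp add: sum.inter_restrict)
    also have "\<dots> = (\<Sum>L\<in>{L. mdeg L = k}. (if L \<in> A then c L else 0) * mpow z L)"
      using finite_mdeg_eq by (intro sum.mono_neutral_cong_left) auto
    finally show ?thesis .
  qed
  then show ?thesis by (intro exI[of _ "\<lambda>L. if L \<in> A then c L else 0"]) simp
qed

lemma vanishing_if_small:
  fixes x :: "'a::real_normed_vector"
  assumes "\<tau> > 0" "\<And>t. 0 < t \<Longrightarrow> t < \<tau> \<Longrightarrow> norm x \<le> E * t"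
  shows "x = 0"
proof -
  have "((\<lambda>t. E * t) \<longlongrightarrow> E * 0) (at_right (0 :: real))" by (intro tendsto_intros)
  moreover have "eventually (\<lambda>t. norm x \<le> E * t) (at_right 0)"
    unfolding eventually_at_right_field using assms by blast
  ultimately have "norm x \<le> E * 0"
    by (intro tendsto_lowerbound[where F = "at_right 0"]) auto
  then show ?thesis by simp
qed

text \<open>
  The leading term is the limit \<open>g\<close> of \<open>f (t *s z) / t ^ k\<close> as $t\to0$. The convergence is locally
  uniform, so \<open>g\<close> is entire on every complex line; as it grows at most like the \<open>k\<close>-th power
  of the norm, Liouville's theorem makes it a polynomial in each coordinate, hence a homogeneous
  polynomial of degree \<open>k\<close>.
\<close>

lemma taylor_leading_term:
  fixes f :: "complex ^ 'n::finite \<Rightarrow> complex"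
  assumes lh: "line_holomorphic r f" and "r > 0"
    and big: "f \<in> O[nhds 0](\<lambda>z. of_real (norm z) ^ k)"
  shows "\<exists>c. (\<lambda>z. f z - (\<Sum>L\<in>{L. mdeg L = k}. c L * mpow z L)) \<in> O[nhds 0](\<lambda>z. of_real (norm z) ^ (k + 1))"
proof -
  obtain C where "C > 0" and "eventually (\<lambda>z. norm (f z) \<le> C * norm (of_real (norm z) ^ k :: complex)) (nhds 0)"
    using big by (rule landau_o.bigE)
  then obtain s0 where "s0 > 0" and s0: "\<And>z. norm z < s0 \<Longrightarrow> norm (f z) \<le> C * norm z ^ k"
    unfolding eventually_nhds_metric by (auto simp: norm_power)
  define s where "s = min s0 r"
  have s: "s > 0" "s \<le> r" "\<And>z. norm z < s \<Longrightarrow> norm (f z) \<le> C * norm z ^ k"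
    using \<open>s0 > 0\<close> \<open>r > 0\<close> s0 by (auto simp: s_def)
  define B where "B = 3 * C / s"
  have "B > 0" using \<open>C > 0\<close> s(1) by (simp add: B_def)
  \<comment> \<open>The coefficient of the leading power on the complex line through \<open>z\<close>; at \<open>z = 0\<close> it is \<open>f 0\<close>.\<close>
  have "\<exists>a. norm a \<le> C * norm z ^ k \<and>
      (\<forall>t. norm t * norm z < s \<longrightarrow> norm (f (t *s z) - t ^ k * a) \<le> B * (norm t * norm z) ^ (k + 1))" for z
  proof (cases "z = 0")
    case True
    have "k = 0 \<or> f 0 = 0" using s(3)[of 0] s(1) by (cases k) auto
    then show ?thesis using True s(3)[of 0] s(1) by (intro exI[of _ "f 0"]) auto
  next
    case False
    then have z: "norm z > 0" by simp
    have "(\<lambda>t. f (0 + t *s z)) holomorphic_on {t. norm (0 + t *s z) < r}"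
      using lh unfolding line_holomorphic_def by blast
    then have "(\<lambda>t. f (t *s z)) holomorphic_on {t. norm (t *s z) < r}" by simp
    then have "(\<lambda>t. f (t *s z)) holomorphic_on ball 0 (s / norm z)"
      by (rule holomorphic_on_subset) (use z s(2) in \<open>auto simp: norm_vector_smult field_simps\<close>)
    moreover have "norm (f (t *s z)) \<le> C * norm z ^ k * norm t ^ k" if "norm t < s / norm z" for t
      using s(3)[of "t *s z"] that z by (simp add: norm_vector_smult field_simps power_mult_distrib)
    ultimately obtain a where a: "norm a \<le> C * norm z ^ k"
      "\<And>t. norm t < s / norm z \<Longrightarrow>
        norm (f (t *s z) - a * t ^ k) \<le> 3 * (C * norm z ^ k) / (s / norm z) * norm t ^ (k + 1)"
      using leading_coefficient_bound[of "\<lambda>t. f (t *s z)" "s / norm z" "C * norm z ^ k" k]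
        z s(1) \<open>C > 0\<close> by (auto simp del: power_Suc)
    show ?thesis
    proof (intro exI[of _ a] conjI allI impI)
      fix t :: complex assume "norm t * norm z < s"
      then have "norm t < s / norm z" using z by (simp add: field_simps)
      from a(2)[OF this] show "norm (f (t *s z) - t ^ k * a) \<le> B * (norm t * norm z) ^ (k + 1)"
        by (simp add: B_def power_mult_distrib mult_ac)
    qed (fact a(1))
  qed
  then obtain g where g_le: "\<And>z. norm (g z) \<le> C * norm z ^ k"
    and g: "\<And>z t. norm t * norm z < s \<Longrightarrow> norm (f (t *s z) - t ^ k * g z) \<le> B * (norm t * norm z) ^ (k + 1)"
    by metis
  have hom: "g (\<tau> *s z) = \<tau> ^ k * g z" for \<tau> z
  proof -
    let ?W = "norm \<tau> * norm z"
    have "g (\<tau> *s z) - \<tau> ^ k * g z = 0"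
    proof (rule vanishing_if_small)
      show "s / (?W + 1) > 0" using s(1) by (auto intro!: divide_pos_pos add_nonneg_pos)
      fix t :: real assume t: "0 < t" "t < s / (?W + 1)"
      have "?W + 1 > 0" by (intro add_nonneg_pos) auto
      then have "t * (?W + 1) < s" using t(2) by (simp only: pos_less_divide_eq)
      then have tW: "t * ?W < s" using t(1) by (simp add: algebra_simps)
      let ?t = "of_real t :: complex"
      have "norm (f (?t *s (\<tau> *s z)) - ?t ^ k * g (\<tau> *s z)) \<le> B * (t * ?W) ^ (k + 1)"
        using g[of ?t "\<tau> *s z"] tW t(1) by (simp add: norm_vector_smult)
      moreover have "norm (f ((?t * \<tau>) *s z) - (?t * \<tau>) ^ k * g z) \<le> B * (t * ?W) ^ (k + 1)"
        using g[of "?t * \<tau>" z] tW t(1) by (simp add: norm_mult mult_ac)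
      ultimately have "norm ((f ((?t * \<tau>) *s z) - (?t * \<tau>) ^ k * g z) - (f (?t *s (\<tau> *s z)) - ?t ^ k * g (\<tau> *s z)))
          \<le> 2 * (B * (t * ?W) ^ (k + 1))"
        by (intro order_trans[OF norm_triangle_ineq4]) simp
      also have "(f ((?t * \<tau>) *s z) - (?t * \<tau>) ^ k * g z) - (f (?t *s (\<tau> *s z)) - ?t ^ k * g (\<tau> *s z))
          = ?t ^ k * (g (\<tau> *s z) - \<tau> ^ k * g z)"
        by (simp add: vector_smult_assoc algebra_simps power_mult_distrib)
      finally have "t ^ k * norm (g (\<tau> *s z) - \<tau> ^ k * g z) \<le> t ^ k * (2 * B * ?W ^ (k + 1) * t)"
        using t(1) by (simp add: norm_mult norm_power power_mult_distrib mult_ac)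
      then show "norm (g (\<tau> *s z) - \<tau> ^ k * g z) \<le> 2 * B * ?W ^ (k + 1) * t"
        using t(1) by (simp add: mult_le_cancel_left_pos)
    qed
    then show ?thesis by simp
  qed
  have entire: "(\<lambda>\<sigma>. g (a + \<sigma> *s b)) holomorphic_on UNIV" for a b
  proof -
    have "(\<lambda>\<sigma>. g (a + \<sigma> *s b)) holomorphic_on ball 0 N" for N
    proof (rule holomorphic_uniform_sequence[OF open_ball])
      define W where "W = norm a + \<bar>N\<bar> * norm b + 1"
      have "W > 0" unfolding W_def by (intro add_nonneg_pos) auto
      define t where "t = (\<lambda>n. s / W * (1 / real (Suc n)))"
      have t: "t n > 0" "t n * W \<le> s" for n
        using s(1) \<open>W > 0\<close> by (auto simp: t_def divide_simps)
      have ab: "norm (a + \<sigma> *s b) < W" if "\<sigma> \<in> ball 0 N" for \<sigma>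
      proof -
        have "norm (a + \<sigma> *s b) \<le> norm a + norm \<sigma> * norm b"
          by (metis norm_triangle_ineq norm_vector_smult)
        also have "\<dots> \<le> norm a + \<bar>N\<bar> * norm b"
          using that by (intro add_mono mult_right_mono) auto
        finally show ?thesis by (simp add: W_def)
      qed
      have tab: "norm (of_real (t n) :: complex) * norm (a + \<sigma> *s b) < s" if "\<sigma> \<in> ball 0 N" for \<sigma> n
      proof -
        have "t n * norm (a + \<sigma> *s b) < t n * W" using ab[OF that] t(1) by (intro mult_strict_left_mono)
        also have "\<dots> \<le> s" by (rule t(2))
        finally show ?thesis using t(1)[of n] by simp
      qed
      define \<phi> where "\<phi> = (\<lambda>n \<sigma>. f (of_real (t n) *s (a + \<sigma> *s b)) / of_real (t n) ^ k)"
      show "\<phi> n holomorphic_on ball 0 N" for n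
      proof -
        have eq: "of_real (t n) *s (a + \<sigma> *s b) = (of_real (t n) *s a) + \<sigma> *s (of_real (t n) *s b)" for \<sigma>
          by (simp add: vec_eq_iff algebra_simps)
        have "(\<lambda>\<sigma>. f ((of_real (t n) *s a) + \<sigma> *s (of_real (t n) *s b))) holomorphic_on ball 0 N"
        proof (rule holomorphic_on_subset[OF lh[unfolded line_holomorphic_def, rule_format]])
          have "norm ((of_real (t n) *s a) + \<sigma> *s (of_real (t n) *s b)) < r" if "\<sigma> \<in> ball 0 N" for \<sigma>
            unfolding eq[symmetric] norm_vector_smult using tab[OF that, of n] s(2) by linarith
          then show "ball 0 N \<subseteq> {\<sigma>. norm ((of_real (t n) *s a) + \<sigma> *s (of_real (t n) *s b)) < r}" by blast
        qed
        then show ?thesis unfolding \<phi>_def eq using t(1)[of n] by (intro holomorphic_intros) auto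
      qed
      have lim: "uniform_limit (ball 0 N) \<phi> (\<lambda>\<sigma>. g (a + \<sigma> *s b)) sequentially"
      proof (rule uniform_limitI)
        fix e :: real assume "e > 0"
        have "(\<lambda>n. B * W ^ (k + 1) * (s / W * (1 / real (Suc n)))) \<longlonglongrightarrow> B * W ^ (k + 1) * (s / W * 0)"
          by (intro tendsto_mult tendsto_const LIMSEQ_inverse_real_of_nat[unfolded inverse_eq_divide])
        then have "(\<lambda>n. B * W ^ (k + 1) * t n) \<longlonglongrightarrow> 0"
          unfolding t_def mult_zero_right .
        then have "eventually (\<lambda>n. B * W ^ (k + 1) * t n < e) sequentially"
          using \<open>e > 0\<close> by (rule order_tendstoD(2))
        then show "\<forall>\<^sub>F n in sequentially. \<forall>\<sigma>\<in>ball 0 N. dist (\<phi> n \<sigma>) (g (a + \<sigma> *s b)) < e"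
        proof (rule eventually_mono, intro ballI)
          fix n and \<sigma> :: complex assume n: "B * W ^ (k + 1) * t n < e" and \<sigma>: "\<sigma> \<in> ball 0 N"
          let ?t = "of_real (t n) :: complex" and ?z = "a + \<sigma> *s b"
          have "norm (f (?t *s ?z) - ?t ^ k * g ?z) \<le> B * (t n * norm ?z) ^ (k + 1)"
            using g[OF tab[OF \<sigma>, of n]] t(1)[of n] by simp
          also have "\<dots> \<le> B * (t n * W) ^ (k + 1)"
            using ab[OF \<sigma>] t(1)[of n] \<open>B > 0\<close> by (intro mult_left_mono power_mono) auto
          finally have *: "norm (f (?t *s ?z) - ?t ^ k * g ?z) \<le> B * (t n * W) ^ (k + 1)" .
          have "\<phi> n \<sigma> - g ?z = (f (?t *s ?z) - ?t ^ k * g ?z) / ?t ^ k"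
            using t(1)[of n] by (simp add: \<phi>_def diff_divide_distrib)
          then have "dist (\<phi> n \<sigma>) (g ?z) = norm (f (?t *s ?z) - ?t ^ k * g ?z) / t n ^ k"
            using t(1)[of n] by (simp add: dist_norm norm_divide norm_power)
          also have "\<dots> \<le> B * (t n * W) ^ (k + 1) / t n ^ k"
            using * t(1)[of n] by (intro divide_right_mono) auto
          also have "\<dots> = B * W ^ (k + 1) * t n"
            using t(1)[of n] by (simp add: power_mult_distrib)
          finally show "dist (\<phi> n \<sigma>) (g (a + \<sigma> *s b)) < e" using n by simp
        qed
      qed
      show "\<exists>d>0. cball x d \<subseteq> ball 0 N \<and> uniform_limit (cball x d) \<phi> (\<lambda>\<sigma>. g (a + \<sigma> *s b)) sequentially"
        if x: "x \<in> ball 0 N" for x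
      proof -
        obtain d where "d > 0" "cball x d \<subseteq> ball 0 N"
          using x open_contains_cball open_ball by blast
        then show ?thesis using uniform_limit_on_subset[OF lim] by (intro exI[of _ d]) simp
      qed
    qed
    then have "(\<lambda>\<sigma>. g (a + \<sigma> *s b)) field_differentiable at \<sigma>" for \<sigma>
      by (rule holomorphic_on_imp_differentiable_at[of _ "ball 0 (norm \<sigma> + 1)" \<sigma>]) simp_all
    then show ?thesis
      by (simp add: holomorphic_on_open field_differentiable_def)
  qed
  have "polynomial_map g"
  proof (rule separately_polynomial_imp_polynomial_map)
    fix z :: "complex ^ 'n" and i
    let ?h = "\<lambda>s. g (z + s *s axis i 1)"
    let ?f = "\<Sum>j\<le>k. monom ((deriv ^^ j) ?h 0 / fact j) j"
    have bd: "norm (?h s) \<le> (C * 2 ^ k) * norm s ^ k" if "norm z \<le> norm s" for s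
    proof -
      have "norm (z + s *s axis i 1) \<le> norm z + norm s"
        by (rule order_trans[OF norm_triangle_ineq]) (simp add: norm_vector_smult)
      also have "\<dots> \<le> 2 * norm s" using that by simp
      finally have "norm (z + s *s axis i 1) ^ k \<le> (2 * norm s) ^ k" by (intro power_mono) auto
      then have "C * norm (z + s *s axis i 1) ^ k \<le> C * (2 * norm s) ^ k"
        using \<open>C > 0\<close> by (intro mult_left_mono) auto
      with g_le[of "z + s *s axis i 1"] show ?thesis
        by (simp add: power_mult_distrib mult.assoc)
    qed
    have "degree ?f \<le> k"
      by (intro degree_sum_le) (auto intro: order_trans[OF degree_monom_le])
    moreover have "?h s = poly ?f s" for s
      using Liouville_polynomial[OF entire bd] by (simp add: poly_sum poly_monom)
    ultimately show "\<exists>f. degree f \<le> k \<and> (\<forall>s. g (z + s *s axis i 1) = poly f s)" by blast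
  qed
  from homogeneous_polynomial_map[OF this hom] obtain c
    where c: "\<And>z. g z = (\<Sum>L\<in>{L. mdeg L = k}. c L * mpow z L)" by blast
  have "eventually (\<lambda>z. norm (f z - g z) \<le> B * norm (of_real (norm z) ^ (k + 1) :: complex)) (nhds 0)"
    unfolding eventually_nhds_metric
  proof (intro exI[of _ s] conjI allI impI s(1))
    fix z :: "complex ^ 'n" assume "dist z 0 < s"
    then show "norm (f z - g z) \<le> B * norm (of_real (norm z) ^ (k + 1) :: complex)"
      using g[of 1 z] by (simp add: norm_mult norm_power)
  qed
  then show ?thesis unfolding c by (intro exI[of _ c] bigoI) auto
qed

section \<open>Orders of vanishing and monomials\<close>

abbreviation vanishes_to :: "nat \<Rightarrow> (complex ^ 'n::finite \<Rightarrow> complex) \<Rightarrow> bool" where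
  "vanishes_to k f \<equiv> f \<in> O[nhds 0](\<lambda>z. of_real (norm z) ^ k)"

lemma vanishes_to_iff:
  "vanishes_to k f \<longleftrightarrow> (\<exists>C. eventually (\<lambda>z. norm (f z) \<le> C * norm z ^ k) (nhds 0))"
proof
  assume "vanishes_to k f"
  then show "\<exists>C. eventually (\<lambda>z. norm (f z) \<le> C * norm z ^ k) (nhds 0)"
    by (elim landau_o.bigE) (auto simp: norm_power)
next
  assume "\<exists>C. eventually (\<lambda>z. norm (f z) \<le> C * norm z ^ k) (nhds 0)"
  then obtain C where "eventually (\<lambda>z. norm (f z) \<le> C * norm z ^ k) (nhds 0)" by blast
  then show "vanishes_to k f" by (intro bigoI[of _ C]) (simp add: norm_power)
qed

lemma vanishes_to_mono:
  fixes f :: "complex ^ 'n::finite \<Rightarrow> complex"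
  assumes "vanishes_to k f" "j \<le> k" shows "vanishes_to j f"
proof -
  have "eventually (\<lambda>z :: complex ^ 'n. norm z < 1) (nhds 0)"
    unfolding eventually_nhds_metric by (intro exI[of _ 1]) simp
  then have "eventually (\<lambda>z :: complex ^ 'n. norm z ^ k \<le> norm z ^ j) (nhds 0)"
    by eventually_elim (use assms(2) in \<open>simp add: power_decreasing\<close>)
  then have "vanishes_to j (\<lambda>z :: complex ^ 'n. of_real (norm z) ^ k)"
    by (intro bigoI[of _ 1]) (simp add: norm_power)
  with assms(1) show ?thesis by (rule landau_o.big_trans)
qed

lemma vanishes_to_mult:
  "vanishes_to j f \<Longrightarrow> vanishes_to k g \<Longrightarrow> vanishes_to (j + k) (\<lambda>z. f z * g z)"
  using landau_o.big.mult[of f "nhds 0" _ g] by (simp add: power_add)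

lemma vanishes_to_const: "vanishes_to 0 (\<lambda>z. c)"
  by (simp add: bigo_const)

lemma vanishes_to_cmult: "vanishes_to k f \<Longrightarrow> vanishes_to k (\<lambda>z. c * f z)"
  by simp

lemma vanishes_to_coord: "vanishes_to 1 (\<lambda>z. z $ i)"
  by (intro bigoI[of _ 1] always_eventually) (simp add: Finite_Cartesian_Product.norm_nth_le)

text \<open>
  Perturbing both factors by \<open>e\<close> orders more than their own order of vanishing perturbs the
  product by \<open>e\<close> orders more than its order. Iterated, this compares monomials in two
  systems of coordinates.
\<close>

lemma vanishes_to_mult_diff:
  assumes "vanishes_to j f" "vanishes_to k g'"
    and "vanishes_to (j + e) (\<lambda>z. f z - f' z)" "vanishes_to (k + e) (\<lambda>z. g z - g' z)"
  shows "vanishes_to (j + k + e) (\<lambda>z. f z * g z - f' z * g' z)"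
proof -
  have "vanishes_to (j + (k + e)) (\<lambda>z. f z * (g z - g' z))"
    "vanishes_to ((j + e) + k) (\<lambda>z. (f z - f' z) * g' z)"
    using assms by (auto intro!: vanishes_to_mult)
  then have "vanishes_to (j + k + e) (\<lambda>z. f z * (g z - g' z) + (f z - f' z) * g' z)"
    by (intro sum_in_bigo) (simp_all add: ac_simps)
  then show ?thesis by (simp add: algebra_simps)
qed

lemma vanishes_to_power:
  assumes "vanishes_to 1 f" shows "vanishes_to n (\<lambda>z. f z ^ n)"
proof (induction n)
  case (Suc n)
  from vanishes_to_mult[OF assms Suc] show ?case by simp
qed (simp add: vanishes_to_const)

lemma vanishes_to_power_diff:
  assumes f: "vanishes_to 1 f" and g: "vanishes_to 1 g" and fg: "vanishes_to (1 + e) (\<lambda>z. f z - g z)"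
  shows "vanishes_to (n + e) (\<lambda>z. f z ^ n - g z ^ n)"
proof (induction n)
  case (Suc n)
  from vanishes_to_mult_diff[OF f vanishes_to_power[OF g] fg Suc] show ?case by simp
qed simp

lemma vanishes_to_mpow_aux:
  assumes X: "\<And>h. vanishes_to 1 (\<lambda>z. X z $ h)" and Y: "\<And>h. vanishes_to 1 (\<lambda>z. Y z $ h)"
    and XY: "\<And>h. vanishes_to (1 + e) (\<lambda>z. X z $ h - Y z $ h)"
    and "finite S"
  shows "vanishes_to (sum L S) (\<lambda>z. \<Prod>h\<in>S. X z $ h ^ L h) \<and>
    vanishes_to (sum L S) (\<lambda>z. \<Prod>h\<in>S. Y z $ h ^ L h) \<and>
    vanishes_to (sum L S + e) (\<lambda>z. (\<Prod>h\<in>S. X z $ h ^ L h) - (\<Prod>h\<in>S. Y z $ h ^ L h))"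
  using \<open>finite S\<close>
proof (induction S rule: finite_induct)
  case (insert h S)
  have "vanishes_to (L h + sum L S) (\<lambda>z. X z $ h ^ L h * (\<Prod>h\<in>S. X z $ h ^ L h))"
    "vanishes_to (L h + sum L S) (\<lambda>z. Y z $ h ^ L h * (\<Prod>h\<in>S. Y z $ h ^ L h))"
    using insert.IH by (auto intro!: vanishes_to_mult vanishes_to_power X Y)
  moreover have "vanishes_to (L h + sum L S + e) (\<lambda>z. X z $ h ^ L h * (\<Prod>h\<in>S. X z $ h ^ L h)
      - Y z $ h ^ L h * (\<Prod>h\<in>S. Y z $ h ^ L h))"
    using insert.IH by (intro vanishes_to_mult_diff vanishes_to_power vanishes_to_power_diff X Y XY) auto
  ultimately show ?case using insert.hyps by simp
qed (simp add: vanishes_to_const)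

lemma vanishes_to_mpow:
  "(\<And>h. vanishes_to 1 (\<lambda>z. X z $ h)) \<Longrightarrow> vanishes_to (mdeg L) (\<lambda>z. mpow (X z) L)"
  using vanishes_to_mpow_aux[of X X 0 UNIV L] by (simp add: mpow_def mdeg_def)

lemma vanishes_to_mpow_diff:
  "(\<And>h. vanishes_to 1 (\<lambda>z. X z $ h)) \<Longrightarrow> (\<And>h. vanishes_to 1 (\<lambda>z. Y z $ h)) \<Longrightarrow>
   (\<And>h. vanishes_to (1 + e) (\<lambda>z. X z $ h - Y z $ h)) \<Longrightarrow>
   vanishes_to (mdeg L + e) (\<lambda>z. mpow (X z) L - mpow (Y z) L)"
  using vanishes_to_mpow_aux[of X Y e UNIV L] by (simp add: mpow_def mdeg_def)

lemma line_holomorphic_add: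
  "line_holomorphic r f \<Longrightarrow> line_holomorphic r g \<Longrightarrow> line_holomorphic r (\<lambda>z. f z + g z)"
  unfolding line_holomorphic_def by (auto intro: holomorphic_intros)

lemma line_holomorphic_diff:
  "line_holomorphic r f \<Longrightarrow> line_holomorphic r g \<Longrightarrow> line_holomorphic r (\<lambda>z. f z - g z)"
  unfolding line_holomorphic_def by (auto intro: holomorphic_intros)

lemma line_holomorphic_mult:
  "line_holomorphic r f \<Longrightarrow> line_holomorphic r g \<Longrightarrow> line_holomorphic r (\<lambda>z. f z * g z)"
  unfolding line_holomorphic_def by (auto intro: holomorphic_intros)

lemma line_holomorphic_const: "line_holomorphic r (\<lambda>z. c)"
  unfolding line_holomorphic_def by (auto intro: holomorphic_intros)

lemma line_holomorphic_coord: "line_holomorphic r (\<lambda>z. z $ i)"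
  unfolding line_holomorphic_def by (auto intro!: holomorphic_intros)

lemma line_holomorphic_sum:
  "(\<And>i. i \<in> I \<Longrightarrow> line_holomorphic r (f i)) \<Longrightarrow> line_holomorphic r (\<lambda>z. \<Sum>i\<in>I. f i z)"
  unfolding line_holomorphic_def by (auto intro!: holomorphic_intros)

lemma line_holomorphic_mpow:
  "(\<And>h. line_holomorphic r (\<lambda>z. X z $ h)) \<Longrightarrow> line_holomorphic r (\<lambda>z. mpow (X z) L)"
  unfolding line_holomorphic_def mpow_def by (auto intro!: holomorphic_intros)

lemmas line_holomorphic_intros = line_holomorphic_add line_holomorphic_diff line_holomorphic_mult
  line_holomorphic_const line_holomorphic_coord line_holomorphic_sum line_holomorphic_mpow

lemma mpow_add: "mpow x (\<lambda>h. L h + M h) = mpow x L * mpow x M"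
  by (simp add: mpow_def power_add prod.distrib)

lemma mpow_unit_index: "mpow x (unit_index s) = x $ s"
proof -
  have "mpow x (unit_index s) = (\<Prod>h\<in>UNIV. if h = s then x $ s else 1)"
    unfolding mpow_def unit_index_def by (intro prod.cong) auto
  then show ?thesis by simp
qed

lemma mdeg_add: "mdeg (\<lambda>h. L h + M h) = mdeg L + mdeg M"
  by (simp add: mdeg_def sum.distrib)

lemma mdeg_unit_index [simp]: "mdeg (unit_index s) = 1"
  by (simp add: mdeg_def unit_index_def)

lemma mdeg_comb: "mdeg (comb P Q k1 k2) = k1 * mdeg P + k2 * mdeg Q"
  by (simp add: mdeg_def comb_def sum.distrib sum_distrib_left)

lemma mpow_comb: "mpow x (comb P Q k1 k2) = mpow x P ^ k1 * mpow x Q ^ k2"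
proof -
  have "mpow x (comb P Q k1 k2) = (\<Prod>h\<in>UNIV. (x $ h ^ P h) ^ k1 * (x $ h ^ Q h) ^ k2)"
    unfolding mpow_def comb_def
    by (intro prod.cong refl) (simp add: power_add mult.commute flip: power_mult)
  then show ?thesis by (simp add: mpow_def prod.distrib prod_power_distrib)
qed

section \<open>Normalization to arbitrary order\<close>

definition resonant_index :: "'n \<Rightarrow> ('n \<Rightarrow> nat) \<Rightarrow> ('n \<Rightarrow> nat) \<Rightarrow> nat \<times> nat \<Rightarrow> 'n \<Rightarrow> nat" where
  "resonant_index s P Q = (\<lambda>(k1, k2) h. unit_index s h + comb P Q k1 k2 h)"

lemma mpow_resonant_index: "mpow x (resonant_index s P Q (k1, k2)) = x $ s * mpow x (comb P Q k1 k2)"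
  by (simp add: resonant_index_def mpow_add mpow_unit_index)

lemma mdeg_resonant_index: "mdeg (resonant_index s P Q (k1, k2)) = mdeg (comb P Q k1 k2) + 1"
  by (simp add: resonant_index_def mdeg_add)

context
  fixes lam :: "complex ^ 'n::finite" and R :: "'n set" and P Q :: "'n \<Rightarrow> nat"
  assumes res: "two_resonant lam R P Q"
begin

lemma mdeg_generators_pos: "mdeg P > 0" "mdeg Q > 0"
proof -
  have indep: "\<forall>x y :: rat. (\<forall>h. x * of_nat (P h) + y * of_nat (Q h) = 0) \<longrightarrow> x = 0 \<and> y = 0"
    using res unfolding two_resonant_def by blast
  have "P \<noteq> (\<lambda>h. 0)" using indep[rule_format, of 1 0] by auto
  then obtain h where "P h \<noteq> 0" by blast
  then show "mdeg P > 0" unfolding mdeg_def by (intro sum_pos2[of _ h]) auto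
  have "Q \<noteq> (\<lambda>h. 0)" using indep[rule_format, of 0 1] by auto
  then obtain h where "Q h \<noteq> 0" by blast
  then show "mdeg Q > 0" unfolding mdeg_def by (intro sum_pos2[of _ h]) auto
qed

text \<open>
  Linear independence of the generators makes the resonant monomials of a coordinate distinct, so
  that each of them can be assigned its own coefficient.
\<close>

lemma inj_resonant_index: "inj (resonant_index s P Q)"
proof (rule injI, clarify)
  fix k1 k2 j1 j2 assume eq: "resonant_index s P Q (k1, k2) = resonant_index s P Q (j1, j2)"
  have "(of_nat k1 - of_nat j1) * of_nat (P h) + (of_nat k2 - of_nat j2) * of_nat (Q h) = (0 :: rat)" for h
  proof -
    have "k1 * P h + k2 * Q h = j1 * P h + j2 * Q h"
      using fun_cong[OF eq, of h] by (simp add: resonant_index_def comb_def)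
    then have "(of_nat (k1 * P h + k2 * Q h) :: rat) = of_nat (j1 * P h + j2 * Q h)" by simp
    then show ?thesis by (simp add: algebra_simps)
  qed
  then have "of_nat k1 - of_nat j1 = (0 :: rat) \<and> of_nat k2 - of_nat j2 = (0 :: rat)"
    using res unfolding two_resonant_def by blast
  then show "k1 = j1 \<and> k2 = j2" by simp
qed

lemma finite_comb_degree: "finite {(k1, k2). mdeg (comb P Q k1 k2) \<le> d}"
proof (rule finite_subset)
  show "{(k1, k2). mdeg (comb P Q k1 k2) \<le> d} \<subseteq> {..d} \<times> {..d}"
  proof clarify
    fix k1 k2 assume "mdeg (comb P Q k1 k2) \<le> d"
    then have "k1 * mdeg P + k2 * mdeg Q \<le> d" by (simp add: mdeg_comb)
    moreover have "k1 \<le> k1 * mdeg P" "k2 \<le> k2 * mdeg Q" using mdeg_generators_pos by simp_all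
    ultimately show "k1 \<in> {..d} \<and> k2 \<in> {..d}"
      by (meson add_leD1 add_leD2 atMost_iff order_trans)
  qed
qed simp

abbreviation "low_degree d \<equiv> {(k1, k2). k1 + k2 \<ge> 1 \<and> mdeg (comb P Q k1 k2) + 1 < d}"

abbreviation "exact_degree d \<equiv> {(k1, k2). k1 + k2 \<ge> 1 \<and> mdeg (comb P Q k1 k2) + 1 = d}"

lemma finite_low_degree: "finite (low_degree d)" and finite_exact_degree: "finite (exact_degree d)"
  by (rule finite_subset[OF _ finite_comb_degree[of d]], auto)+

definition resonant_polynomial :: "nat \<Rightarrow> (nat \<Rightarrow> nat \<Rightarrow> 'n \<Rightarrow> complex) \<Rightarrow> 'n \<Rightarrow> complex ^ 'n \<Rightarrow> complex" where
  "resonant_polynomial d a s x = lam $ s * x $ s +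
     (\<Sum>(k1, k2)\<in>low_degree d. a k1 k2 s * mpow x (comb P Q k1 k2) * x $ s)"

text \<open>
  The conjugacy to a normal form is recorded only through its components \<open>w\<close>: in the coordinates \<open>w\<close> the resonant coordinates of \<open>G\<close> follow the resonant
  polynomial up to order \<open>d\<close>.
\<close>

definition dulac_coordinates ::
  "real \<Rightarrow> (complex ^ 'n \<Rightarrow> complex ^ 'n) \<Rightarrow> nat \<Rightarrow> (nat \<Rightarrow> nat \<Rightarrow> 'n \<Rightarrow> complex) \<Rightarrow>
   (complex ^ 'n \<Rightarrow> complex ^ 'n) \<Rightarrow> bool" where
  "dulac_coordinates r G d a w \<longleftrightarrow>
     (\<forall>s. vanishes_to 2 (\<lambda>z. w z $ s - z $ s)) \<and>
     (\<forall>s. line_holomorphic r (\<lambda>z. w z $ s)) \<and>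
     (\<forall>s. line_holomorphic r (\<lambda>z. w (G z) $ s)) \<and>
     (\<forall>s. continuous_on UNIV (\<lambda>z. w z $ s)) \<and>
     (\<forall>s. s \<notin> R \<longrightarrow> (\<forall>z. w z $ s = z $ s)) \<and>
     (\<forall>s\<in>R. vanishes_to d (\<lambda>z. w (G z) $ s - resonant_polynomial d a s (w z)))"

text \<open>
  One step of the Poincare--Dulac method. The error has a leading homogeneous part of degree \<open>d\<close>.
  Adding \<open>h z^L\<close> to \<open>w $ s\<close> changes the coefficient of the monomial \<open>z^L\<close> in it by
  \<open>h * (mpow lam L - lam $ s)\<close>, so nonresonant monomials are removed, while resonant ones become
  new terms of the normal form. Terms of degree less than \<open>d\<close> stay as they are.
\<close>

lemma dulac_step:
  assumes "r > 0" "d \<ge> 2"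
    and G_hol: "\<And>s. line_holomorphic r (\<lambda>z. G z $ s)"
    and G_lin: "\<And>s. vanishes_to 2 (\<lambda>z. G z $ s - lam $ s * z $ s)"
    and w: "dulac_coordinates r G d a w"
  shows "\<exists>a' w'. dulac_coordinates r G (Suc d) a' w' \<and>
    (\<forall>k1 k2. mdeg (comb P Q k1 k2) + 1 < d \<longrightarrow> a' k1 k2 = a k1 k2)"
proof -
  define E where "E = (\<lambda>s z. w (G z) $ s - resonant_polynomial d a s (w z))"
  note wd = w[unfolded dulac_coordinates_def]
  note w2 = wd[THEN conjunct1, rule_format]
    and w_hol = wd[THEN conjunct2, THEN conjunct1, rule_format]
    and wG_hol = wd[THEN conjunct2, THEN conjunct2, THEN conjunct1, rule_format]
    and w_cont = wd[THEN conjunct2, THEN conjunct2, THEN conjunct2, THEN conjunct1, rule_format]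
    and w_out = wd[THEN conjunct2, THEN conjunct2, THEN conjunct2, THEN conjunct2, THEN conjunct1, rule_format]
  have E_van: "vanishes_to d (E s)" if "s \<in> R" for s
    using wd[THEN conjunct2, THEN conjunct2, THEN conjunct2, THEN conjunct2, THEN conjunct2, rule_format, OF that]
    unfolding E_def .
  have "line_holomorphic r (E s)" for s
    unfolding E_def resonant_polynomial_def case_prod_unfold
    by (intro line_holomorphic_intros wG_hol w_hol)
  then have "\<exists>c. vanishes_to (Suc d) (\<lambda>z. E s z - (\<Sum>L\<in>{L. mdeg L = d}. c L * mpow z L))" if "s \<in> R" for s
    using taylor_leading_term[OF _ \<open>r > 0\<close> E_van[OF that]] by simp
  then have "\<forall>s\<in>R. \<exists>c. vanishes_to (Suc d) (\<lambda>z. E s z - (\<Sum>L\<in>{L. mdeg L = d}. c L * mpow z L))"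
    by (rule ballI)
  from bchoice[OF this] obtain c
    where c_all: "\<forall>s\<in>R. vanishes_to (Suc d) (\<lambda>z. E s z - (\<Sum>L\<in>{L. mdeg L = d}. c s L * mpow z L))" ..
  note c = bspec[OF c_all]
  define h where "h = (\<lambda>s L. if lam $ s = mpow lam L then 0 else c s L / (lam $ s - mpow lam L))"
  define T where "T = (\<lambda>s z. \<Sum>L\<in>{L. mdeg L = d}. h s L * mpow z L)"
  define w' where "w' = (\<lambda>z. \<chi> s. if s \<in> R then w z $ s + T s z else z $ s)"
  define a' where "a' = (\<lambda>k1 k2 s. if mdeg (comb P Q k1 k2) + 1 = d then c s (resonant_index s P Q (k1, k2)) else a k1 k2 s)"
  have id1: "vanishes_to 1 (\<lambda>z. z $ s)" for s :: 'n by (rule vanishes_to_coord)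
  have T_van: "vanishes_to d (T s)" for s
  proof -
    have "vanishes_to (mdeg L) (\<lambda>z. h s L * mpow z L)" for L
      by (intro vanishes_to_cmult vanishes_to_mpow id1)
    then show ?thesis unfolding T_def by (intro big_sum_in_bigo) auto
  qed
  have w'w: "vanishes_to d (\<lambda>z. w' z $ s - w z $ s)" for s
    using T_van[of s] by (cases "s \<in> R") (simp_all add: w'_def w_out)
  have w'2: "vanishes_to 2 (\<lambda>z. w' z $ s - z $ s)" for s
  proof -
    have "vanishes_to 2 (\<lambda>z. (w' z $ s - w z $ s) + (w z $ s - z $ s))"
      by (intro sum_in_bigo vanishes_to_mono[OF w'w \<open>d \<ge> 2\<close>] w2)
    then show ?thesis by simp
  qed
  have near_id: "vanishes_to 1 (\<lambda>z. x z $ s)" if "vanishes_to 2 (\<lambda>z. x z $ s - z $ s)"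
    for x :: "complex ^ 'n \<Rightarrow> complex ^ 'n" and s
  proof -
    have "vanishes_to 1 (\<lambda>z. (x z $ s - z $ s) + z $ s)"
      by (intro sum_in_bigo vanishes_to_mono[OF that] id1) simp
    then show ?thesis by simp
  qed
  note w1 = near_id[OF w2] and w'1 = near_id[OF w'2]
  have lam1: "vanishes_to 1 (\<lambda>z. (\<chi> h. lam $ h * z $ h) $ s)" for s
    using vanishes_to_cmult[OF id1] by simp
  have G1: "vanishes_to 1 (\<lambda>z. G z $ s)" for s
  proof -
    have "vanishes_to 1 (\<lambda>z. (G z $ s - lam $ s * z $ s) + lam $ s * z $ s)"
      by (intro sum_in_bigo vanishes_to_mono[OF G_lin] vanishes_to_cmult id1) simp
    then show ?thesis by simp
  qed
  have mpow_G: "vanishes_to (Suc d) (\<lambda>z. h s L * (mpow (G z) L - mpow lam L * mpow z L))" if "mdeg L = d" for s L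
  proof -
    have "vanishes_to (mdeg L + 1) (\<lambda>z. mpow (G z) L - mpow (\<chi> h. lam $ h * z $ h) L)"
      using G_lin by (intro vanishes_to_mpow_diff G1 lam1) (simp add: numeral_2_eq_2)
    moreover have "mpow (\<chi> h. lam $ h * z $ h) L = mpow lam L * mpow z L" for z
      by (simp add: mpow_def power_mult_distrib prod.distrib)
    ultimately show ?thesis using that by simp
  qed
  have "vanishes_to (Suc d) (\<lambda>z. w' (G z) $ s - resonant_polynomial (Suc d) a' s (w' z))" if s: "s \<in> R" for s
  proof -
    let ?m = "\<lambda>x (k1, k2). mpow x (comb P Q k1 k2) * x $ s"
    let ?D = "{L :: 'n \<Rightarrow> nat. mdeg L = d}"
    have m: "?m x K = mpow x (resonant_index s P Q K)" for x K
      by (cases K) (simp add: mpow_resonant_index)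
    have low: "vanishes_to (Suc d) (\<lambda>z. \<Sum>(k1, k2)\<in>low_degree d. a k1 k2 s * (?m (w' z) (k1, k2) - ?m (w z) (k1, k2)))"
    proof (intro big_sum_in_bigo)
      fix K assume "K \<in> low_degree d"
      then obtain k1 k2 where K: "K = (k1, k2)" and k: "k1 + k2 \<ge> 1" "mdeg (comb P Q k1 k2) + 1 < d"
        by blast
      have "mdeg (comb P Q k1 k2) \<ge> 1"
        using k(1) mdeg_generators_pos by (cases k1; cases k2) (auto simp: mdeg_comb)
      then have deg: "Suc d \<le> mdeg (resonant_index s P Q (k1, k2)) + (d - 1)"
        using \<open>d \<ge> 2\<close> by (simp add: mdeg_resonant_index)
      have "vanishes_to (mdeg (resonant_index s P Q (k1, k2)) + (d - 1))
          (\<lambda>z. mpow (w' z) (resonant_index s P Q (k1, k2)) - mpow (w z) (resonant_index s P Q (k1, k2)))"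
        using w'w \<open>d \<ge> 2\<close> by (intro vanishes_to_mpow_diff w1 w'1) simp
      from vanishes_to_mono[OF this deg]
      have "vanishes_to (Suc d) (\<lambda>z. a k1 k2 s * (?m (w' z) (k1, k2) - ?m (w z) (k1, k2)))"
        unfolding m by (rule vanishes_to_cmult)
      then show "vanishes_to (Suc d) (\<lambda>z. case K of (k1, k2) \<Rightarrow> a k1 k2 s * (?m (w' z) (k1, k2) - ?m (w z) (k1, k2)))"
        unfolding K prod.case .
    qed
    have exact: "vanishes_to (Suc d) (\<lambda>z. \<Sum>K\<in>exact_degree d. c s (resonant_index s P Q K) * (?m (w' z) K - ?m z K))"
    proof (intro big_sum_in_bigo)
      fix K assume "K \<in> exact_degree d"
      then obtain k1 k2 where K: "K = (k1, k2)" and "mdeg (comb P Q k1 k2) + 1 = d" by blast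
      then have deg: "mdeg (resonant_index s P Q (k1, k2)) + 1 = Suc d" by (simp add: mdeg_resonant_index)
      have "vanishes_to (mdeg (resonant_index s P Q (k1, k2)) + 1)
          (\<lambda>z. mpow (w' z) (resonant_index s P Q (k1, k2)) - mpow z (resonant_index s P Q (k1, k2)))"
        using w'2 by (intro vanishes_to_mpow_diff w'1 id1) (simp add: numeral_2_eq_2)
      then show "vanishes_to (Suc d) (\<lambda>z. c s (resonant_index s P Q K) * (?m (w' z) K - ?m z K))"
        unfolding m deg K by (rule vanishes_to_cmult)
    qed
    have reindex: "(\<Sum>K\<in>exact_degree d. c s (resonant_index s P Q K) * ?m z K)
        = (\<Sum>L\<in>?D. if lam $ s = mpow lam L then c s L * mpow z L else 0)" for z
    proof -
      have "resonant_index s P Q ` exact_degree d = {L \<in> ?D. lam $ s = mpow lam L}"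
      proof -
        have "\<forall>j\<in>R. \<forall>L. resonance lam j L \<longleftrightarrow>
            (\<exists>k1 k2. k1 + k2 \<ge> 1 \<and> L = (\<lambda>h. unit_index j h + comb P Q k1 k2 h))"
          using res unfolding two_resonant_def by (elim conjE)
        then have r: "resonance lam s L \<longleftrightarrow> (\<exists>k1 k2. k1 + k2 \<ge> 1 \<and> L = resonant_index s P Q (k1, k2))" for L
          using s by (simp only: resonant_index_def prod.case)
        have "L \<in> resonant_index s P Q ` exact_degree d \<longleftrightarrow> resonance lam s L \<and> mdeg L = d" for L
        proof
          assume "L \<in> resonant_index s P Q ` exact_degree d"
          then obtain k1 k2 where "k1 + k2 \<ge> 1" "mdeg (comb P Q k1 k2) + 1 = d" "L = resonant_index s P Q (k1, k2)"
            by blast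
          then show "resonance lam s L \<and> mdeg L = d" unfolding r by (metis mdeg_resonant_index)
        next
          assume *: "resonance lam s L \<and> mdeg L = d"
          then obtain k1 k2 where "k1 + k2 \<ge> 1" and L: "L = resonant_index s P Q (k1, k2)"
            unfolding r by blast
          with * have "(k1, k2) \<in> exact_degree d" by (simp add: mdeg_resonant_index)
          then show "L \<in> resonant_index s P Q ` exact_degree d" unfolding L by (rule imageI)
        qed
        then show ?thesis using \<open>d \<ge> 2\<close> by (auto simp: resonance_def)
      qed
      then have "(\<Sum>L\<in>{L \<in> ?D. lam $ s = mpow lam L}. c s L * mpow z L)
          = (\<Sum>K\<in>exact_degree d. c s (resonant_index s P Q K) * ?m z K)"
        unfolding m using sum.reindex[OF inj_on_subset[OF inj_resonant_index subset_UNIV],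
          of "\<lambda>L. c s L * mpow z L" s "exact_degree d"] by (simp add: o_def)
      from this[unfolded sum.inter_filter[OF finite_mdeg_eq]] show ?thesis by (rule sym)
    qed
    have poly: "resonant_polynomial (Suc d) a' s x = lam $ s * x $ s
        + (\<Sum>(k1, k2)\<in>low_degree d. a k1 k2 s * ?m x (k1, k2))
        + (\<Sum>K\<in>exact_degree d. c s (resonant_index s P Q K) * ?m x K)" for x
    proof -
      have split: "low_degree (Suc d) = low_degree d \<union> exact_degree d" by auto
      have "(\<Sum>(k1, k2)\<in>low_degree (Suc d). a' k1 k2 s * mpow x (comb P Q k1 k2) * x $ s)
        = (\<Sum>(k1, k2)\<in>low_degree d. a' k1 k2 s * mpow x (comb P Q k1 k2) * x $ s)
        + (\<Sum>(k1, k2)\<in>exact_degree d. a' k1 k2 s * mpow x (comb P Q k1 k2) * x $ s)"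
        unfolding split by (intro sum.union_disjoint finite_low_degree finite_exact_degree) auto
      also have "(\<Sum>(k1, k2)\<in>low_degree d. a' k1 k2 s * mpow x (comb P Q k1 k2) * x $ s)
        = (\<Sum>(k1, k2)\<in>low_degree d. a k1 k2 s * ?m x (k1, k2))"
        by (intro sum.cong) (auto simp: a'_def)
      also have "(\<Sum>(k1, k2)\<in>exact_degree d. a' k1 k2 s * mpow x (comb P Q k1 k2) * x $ s)
        = (\<Sum>K\<in>exact_degree d. c s (resonant_index s P Q K) * ?m x K)"
        by (intro sum.cong) (auto simp: a'_def)
      finally show ?thesis by (simp add: resonant_polynomial_def)
    qed
    have cancel: "(\<Sum>L\<in>?D. c s L * mpow z L) + (\<Sum>L\<in>?D. h s L * (mpow lam L * mpow z L))
        = lam $ s * T s z + (\<Sum>K\<in>exact_degree d. c s (resonant_index s P Q K) * ?m z K)" for z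
    proof -
      have "c s L * mpow z L + h s L * (mpow lam L * mpow z L)
          = lam $ s * (h s L * mpow z L) + (if lam $ s = mpow lam L then c s L * mpow z L else 0)" for L
      proof (cases "lam $ s = mpow lam L")
        case False
        then have "h s L * (lam $ s - mpow lam L) = c s L" by (simp add: h_def)
        then have "c s L * mpow z L = h s L * (lam $ s - mpow lam L) * mpow z L" by simp
        then show ?thesis using False by (simp add: algebra_simps)
      qed (simp add: h_def)
      then show ?thesis
        unfolding reindex T_def sum_distrib_left by (simp only: sum.distrib[symmetric])
    qed
    have "w' (G z) $ s - resonant_polynomial (Suc d) a' s (w' z) =
        (E s z - (\<Sum>L\<in>?D. c s L * mpow z L))
        + (\<Sum>L\<in>?D. h s L * (mpow (G z) L - mpow lam L * mpow z L))
        - (\<Sum>(k1, k2)\<in>low_degree d. a k1 k2 s * (?m (w' z) (k1, k2) - ?m (w z) (k1, k2)))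
        - (\<Sum>K\<in>exact_degree d. c s (resonant_index s P Q K) * (?m (w' z) K - ?m z K))" for z
    proof -
      have 1: "w' (G z) $ s = w (G z) $ s + (\<Sum>L\<in>?D. h s L * mpow (G z) L)"
        using s by (simp add: w'_def T_def)
      have 2: "w' z $ s = w z $ s + T s z" using s by (simp add: w'_def)
      have 3: "(\<Sum>L\<in>?D. h s L * (mpow (G z) L - mpow lam L * mpow z L))
          = (\<Sum>L\<in>?D. h s L * mpow (G z) L) - (\<Sum>L\<in>?D. h s L * (mpow lam L * mpow z L))"
        by (simp add: right_diff_distrib sum_subtractf)
      have 4: "(\<Sum>(k1, k2)\<in>low_degree d. a k1 k2 s * (?m (w' z) (k1, k2) - ?m (w z) (k1, k2)))
          = (\<Sum>(k1, k2)\<in>low_degree d. a k1 k2 s * ?m (w' z) (k1, k2))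
          - (\<Sum>(k1, k2)\<in>low_degree d. a k1 k2 s * ?m (w z) (k1, k2))"
        by (simp add: case_prod_unfold right_diff_distrib sum_subtractf)
      have 5: "(\<Sum>K\<in>exact_degree d. c s (resonant_index s P Q K) * (?m (w' z) K - ?m z K))
          = (\<Sum>K\<in>exact_degree d. c s (resonant_index s P Q K) * ?m (w' z) K)
          - (\<Sum>K\<in>exact_degree d. c s (resonant_index s P Q K) * ?m z K)"
        by (simp only: right_diff_distrib sum_subtractf)
      have 6: "E s z = w (G z) $ s - (lam $ s * w z $ s
          + (\<Sum>(k1, k2)\<in>low_degree d. a k1 k2 s * ?m (w z) (k1, k2)))"
        by (simp add: E_def resonant_polynomial_def mult.assoc)
      have 7: "resonant_polynomial (Suc d) a' s (w' z) = lam $ s * w z $ s + lam $ s * T s z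
        + (\<Sum>(k1, k2)\<in>low_degree d. a k1 k2 s * ?m (w' z) (k1, k2))
        + (\<Sum>K\<in>exact_degree d. c s (resonant_index s P Q K) * ?m (w' z) K)"
        unfolding poly 2 by (simp add: distrib_left)
      have arith: "W + HG - (w1 + lT + S' + S'') = (W - (w1 + S) - C) + (HG - HL) - (S' - S) - (S'' - S0)"
        if "C + HL = lT + S0" for W HG w1 lT S S' S'' C HL S0 :: complex
        using that by (simp add: algebra_simps)
      show ?thesis
        unfolding 1 3 4 5 6 7 using arith[OF cancel[of z]] .
    qed
    note decomposition = this
    have "vanishes_to (Suc d) (\<lambda>z. \<Sum>L\<in>?D. h s L * (mpow (G z) L - mpow lam L * mpow z L))"
      by (rule big_sum_in_bigo) (rule mpow_G, simp)
    from sum_in_bigo(2)[OF sum_in_bigo(2)[OF sum_in_bigo(1)[OF c[OF s] this] low] exact]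
    show ?thesis unfolding decomposition .
  qed
  note resid = this
  have hol': "line_holomorphic r (\<lambda>z. w' z $ s)" "line_holomorphic r (\<lambda>z. w' (G z) $ s)" for s
    by (cases "s \<in> R"; simp add: w'_def T_def; intro line_holomorphic_intros w_hol wG_hol G_hol)+
  have cont': "continuous_on UNIV (\<lambda>z. w' z $ s)" for s
    by (cases "s \<in> R"; simp add: w'_def T_def mpow_def; intro continuous_intros w_cont)
  have "dulac_coordinates r G (Suc d) a' w'"
    unfolding dulac_coordinates_def
    by (intro conjI allI ballI impI w'2 hol' cont' resid) (simp_all add: w'_def)
  moreover have "\<forall>k1 k2. mdeg (comb P Q k1 k2) + 1 < d \<longrightarrow> a' k1 k2 = a k1 k2"
    by (auto simp: a'_def)
  ultimately show ?thesis by (intro exI[of _ a'] exI[of _ w'] conjI)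
qed

text \<open>
  The dynamical estimates need a remainder of an order that depends on the rates of contraction,
  which may exceed the order \<open>l\<close> of a given normalization. The extension to order \<open>l + m\<close> keeps
  the coefficients already determined.
\<close>

lemma dulac_coordinates_exist:
  assumes "r > 0" "l \<ge> 2"
    and G_hol: "\<And>s. line_holomorphic r (\<lambda>z. G z $ s)"
    and nf: "normal_form lam R P Q l a G"
  shows "\<exists>a' w. dulac_coordinates r G (l + m) a' w \<and>
    (\<forall>k1 k2. mdeg (comb P Q k1 k2) + 1 < l \<longrightarrow> a' k1 k2 = a k1 k2)"
proof -
  have conv: "vanishes_to k f \<longleftrightarrow> (\<lambda>z. norm (f z)) \<in> O[nhds 0](\<lambda>z. norm z ^ k)"
    for k and f :: "complex ^ 'n \<Rightarrow> complex"
  proof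
    assume "vanishes_to k f"
    then obtain C where "eventually (\<lambda>z. norm (f z) \<le> C * norm z ^ k) (nhds 0)"
      unfolding vanishes_to_iff by blast
    then show "(\<lambda>z. norm (f z)) \<in> O[nhds 0](\<lambda>z. norm z ^ k)" by (intro bigoI[of _ C]) simp
  next
    assume "(\<lambda>z. norm (f z)) \<in> O[nhds 0](\<lambda>z. norm z ^ k)"
    then obtain C where "eventually (\<lambda>z. norm (norm (f z)) \<le> C * norm (norm z ^ k)) (nhds 0)"
      by (rule landau_o.bigE)
    then show "vanishes_to k f" unfolding vanishes_to_iff by (intro exI[of _ C]) simp
  qed
  have nfR: "vanishes_to l (\<lambda>z. G z $ s - resonant_polynomial l a s z)" if "s \<in> R" for s
    using nf that unfolding normal_form_def conv[symmetric] resonant_polynomial_def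
    by (simp only: diff_diff_add)
  have G_lin: "vanishes_to 2 (\<lambda>z. G z $ s - lam $ s * z $ s)" for s
  proof (cases "s \<in> R")
    case False
    then show ?thesis using nf unfolding normal_form_def conv[symmetric] by blast
  next
    case True
    have "vanishes_to 2 (\<lambda>z. a k1 k2 s * mpow z (comb P Q k1 k2) * z $ s)" if "k1 + k2 \<ge> 1" for k1 k2
    proof -
      have "mdeg (comb P Q k1 k2) \<ge> 1"
        using that mdeg_generators_pos by (cases k1; cases k2) (auto simp: mdeg_comb)
      then have "2 \<le> mdeg (comb P Q k1 k2) + 1" by simp
      moreover have "vanishes_to (mdeg (comb P Q k1 k2)) (\<lambda>z. a k1 k2 s * mpow z (comb P Q k1 k2))"
        by (intro vanishes_to_cmult vanishes_to_mpow vanishes_to_coord)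
      ultimately show ?thesis using vanishes_to_mono[OF vanishes_to_mult[OF _ vanishes_to_coord]] by blast
    qed
    then have "vanishes_to 2 (\<lambda>z. \<Sum>(k1, k2)\<in>low_degree l. a k1 k2 s * mpow z (comb P Q k1 k2) * z $ s)"
      by (intro big_sum_in_bigo) auto
    from sum_in_bigo(1)[OF vanishes_to_mono[OF nfR[OF True] \<open>l \<ge> 2\<close>] this]
    show ?thesis by (simp add: resonant_polynomial_def)
  qed
  show ?thesis
  proof (induction m)
    case 0
    have "dulac_coordinates r G l a (\<lambda>z. z)"
      unfolding dulac_coordinates_def using nfR
      by (auto intro: line_holomorphic_coord G_hol continuous_intros)
    then show ?case by auto
  next
    case (Suc m)
    then obtain a' w where *: "dulac_coordinates r G (l + m) a' w"
      "\<And>k1 k2. mdeg (comb P Q k1 k2) + 1 < l \<Longrightarrow> a' k1 k2 = a k1 k2" by blast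
    from dulac_step[OF \<open>r > 0\<close> _ G_hol G_lin *(1)] \<open>l \<ge> 2\<close>
    obtain a'' w' where "dulac_coordinates r G (Suc (l + m)) a'' w'"
      "\<And>k1 k2. mdeg (comb P Q k1 k2) + 1 < l + m \<Longrightarrow> a'' k1 k2 = a' k1 k2" by auto
    then show ?case using *(2) by (intro exI[of _ a''] exI[of _ w']) auto
  qed
qed

end

section \<open>Expansions along a filter\<close>

lemma product_expansion_step:
  fixes f f' l l' g :: "'a \<Rightarrow> complex"
  assumes g: "g \<in> O[F](\<lambda>_. 1)"
    and l: "l \<in> O[F](g)" "l' \<in> O[F](g)"
    and f: "(\<lambda>z. f z - 1 - l z) \<in> O[F](\<lambda>z. g z ^ 2)" "(\<lambda>z. f' z - 1 - l' z) \<in> O[F](\<lambda>z. g z ^ 2)"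
  shows "(\<lambda>z. f z * f' z - 1 - (l z + l' z)) \<in> O[F](\<lambda>z. g z ^ 2)"
proof -
  have one: "(\<lambda>_. 1 :: complex) \<in> O[F](\<lambda>_. 1)" by simp
  have g2: "(\<lambda>z. g z ^ 2) \<in> O[F](\<lambda>_. 1)"
    using landau_o.big.mult[OF g g] by (simp add: power2_eq_square)
  have l1: "l \<in> O[F](\<lambda>_. 1)" "l' \<in> O[F](\<lambda>_. 1)"
    using l g by (blast intro: landau_o.big_trans)+
  have "(\<lambda>z. (f' z - 1 - l' z) + (1 + l' z)) \<in> O[F](\<lambda>_. 1)"
    by (intro sum_in_bigo one l1 landau_o.big_trans[OF f(2) g2])
  then have f'1: "f' \<in> O[F](\<lambda>_. 1)" by simp
  have "(\<lambda>z. 1 + l z) \<in> O[F](\<lambda>_. 1)" by (intro sum_in_bigo one l1)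
  from landau_o.big.mult[OF f(1) f'1] landau_o.big.mult[OF this f(2)] landau_o.big.mult[OF l]
  have "(\<lambda>z. (f z - 1 - l z) * f' z + (1 + l z) * (f' z - 1 - l' z) + l z * l' z) \<in> O[F](\<lambda>z. g z ^ 2)"
    by (intro sum_in_bigo) (simp_all add: power2_eq_square)
  then show ?thesis by (simp add: algebra_simps)
qed

lemma product_expansion:
  fixes e :: "'j \<Rightarrow> 'a \<Rightarrow> complex"
  assumes g: "g \<in> O[F](\<lambda>_. 1)" and e: "\<And>j. e j \<in> O[F](g)" and "finite S"
  shows "(\<lambda>z. (\<Prod>j\<in>S. (1 + e j z) ^ L j) - 1 - (\<Sum>j\<in>S. of_nat (L j) * e j z)) \<in> O[F](\<lambda>z. g z ^ 2)"
  using \<open>finite S\<close>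
proof (induction S rule: finite_induct)
  case (insert j S)
  have pow: "(\<lambda>z. (1 + e j z) ^ n - 1 - of_nat n * e j z) \<in> O[F](\<lambda>z. g z ^ 2)" for n
  proof (induction n)
    case (Suc n)
    have "(\<lambda>z. (1 + e j z) * (1 + e j z) ^ n - 1 - (e j z + of_nat n * e j z)) \<in> O[F](\<lambda>z. g z ^ 2)"
      by (rule product_expansion_step[OF g e _ _ Suc]) (use e in simp_all)
    then show ?case by (simp add: algebra_simps)
  qed simp
  have "(\<lambda>z. (1 + e j z) ^ L j * (\<Prod>j\<in>S. (1 + e j z) ^ L j) - 1 -
      (of_nat (L j) * e j z + (\<Sum>j\<in>S. of_nat (L j) * e j z))) \<in> O[F](\<lambda>z. g z ^ 2)"
    by (rule product_expansion_step[OF g _ _ pow insert.IH]) (use e in \<open>auto intro!: big_sum_in_bigo\<close>)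
  then show ?case using insert.hyps by simp
qed simp

text \<open>
  The derivative of \<open>1 / (1 + \<delta>) ^ n\<close> at 0, multiplied by a factor \<open>W\<close> of the size of
  \<open>1 / \<delta>\<close>. It gives the increments of both Fatou coordinates below.
\<close>

lemma inverse_power_increment:
  fixes \<delta> W :: "'a \<Rightarrow> complex"
  assumes \<delta>: "(\<delta> \<longlongrightarrow> 0) F" and W: "((\<lambda>z. W z * \<delta> z) \<longlongrightarrow> a) F"
  shows "((\<lambda>z. W z * (1 / (1 + \<delta> z) ^ n - 1)) \<longlongrightarrow> - of_nat n * a) F"
proof -
  have "((\<lambda>z. 1 + \<delta> z) \<longlongrightarrow> 1 + 0) F" by (intro tendsto_intros \<delta>)
  then have one: "((\<lambda>z. 1 + \<delta> z) \<longlongrightarrow> 1) F" by simp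
  have "((\<lambda>z. - (W z * \<delta> z) * (\<Sum>i<n. (1 + \<delta> z) ^ i) / (1 + \<delta> z) ^ n) \<longlongrightarrow>
      - a * (\<Sum>i<n. 1 ^ i) / 1 ^ n) F"
    by (intro tendsto_intros W one) simp
  then have lim: "((\<lambda>z. - (W z * \<delta> z) * (\<Sum>i<n. (1 + \<delta> z) ^ i) / (1 + \<delta> z) ^ n) \<longlongrightarrow> - of_nat n * a) F"
    by (simp add: mult.commute)
  have "eventually (\<lambda>z. 1 + \<delta> z \<noteq> 0) F" by (rule tendsto_imp_eventually_ne[OF one]) simp
  then have "eventually (\<lambda>z. - (W z * \<delta> z) * (\<Sum>i<n. (1 + \<delta> z) ^ i) / (1 + \<delta> z) ^ n
      = W z * (1 / (1 + \<delta> z) ^ n - 1)) F"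
  proof eventually_elim
    case (elim z)
    have "(1 + \<delta> z) ^ n - 1 = \<delta> z * (\<Sum>i<n. (1 + \<delta> z) ^ i)"
      using power_diff_1_eq[of "1 + \<delta> z" n] by simp
    moreover have "1 / (1 + \<delta> z) ^ n - 1 = - ((1 + \<delta> z) ^ n - 1) / (1 + \<delta> z) ^ n"
      using elim by (simp add: divide_simps)
    ultimately show ?case by simp
  qed
  then show ?thesis using lim by (rule Lim_transform_eventually[rotated])
qed

section \<open>Dynamics along an irregular nondegenerate direction\<close>

text \<open>
  \<open>X\<close> is a system of local coordinates in which the \<open>j\<close>-th coordinate is multiplied by
  \<open>lam $ j * (1 + N j u1 u2)\<close>, up to a small error, when \<open>j \<in> R\<close>; here \<open>u1\<close>, \<open>u2\<close> are the
  resonant monomials. \<open>N j\<close> has the leading part \<open>u1 ^ k0 * B j (u2 / u1)\<close>, homogeneous of degree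
  \<open>k0\<close>. The direction is \<open>(v1, v1 * y0)\<close>. The three conditions \<open>normalized\<close>, \<open>irregular\<close> and
  \<open>rate\<close> say that it is normalized, irregular and attracting; \<open>irregular\<close> is the
  factorization of $g_2$ at \<open>y0\<close>, whose order \<open>m\<close> is at least 2. The cone \<open>\<theta>\<close>, the rate
  \<open>\<gamma>\<close> and the exponent \<open>M\<close> are fixed beforehand since the order of the remainder in
  \<open>step_R\<close> depends on them.
\<close>

locale irregular_dynamics =
  fixes F X :: "complex ^ 'n::finite \<Rightarrow> complex ^ 'n"
    and rad low :: real
    and R :: "'n set" and P Q :: "'n \<Rightarrow> nat" and lam :: "complex ^ 'n"
    and k0 m M :: nat and v1 y0 :: complex
    and B :: "'n \<Rightarrow> complex \<Rightarrow> complex" and N :: "'n \<Rightarrow> complex \<Rightarrow> complex \<Rightarrow> complex"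
    and h :: "complex \<Rightarrow> complex" and \<theta> \<gamma> :: real
  assumes rad_pos: "rad > 0" and low_pos: "low > 0"
    and X_lower: "\<And>z. norm z < rad \<Longrightarrow> low * norm z \<le> norm (X z)"
    and X_cont: "continuous_on (ball 0 rad) X" and X_0: "X 0 = 0"
    and X_open: "\<And>\<epsilon>. \<epsilon> > 0 \<Longrightarrow> 0 \<in> interior (X ` ball 0 \<epsilon>)"
    and F_cont: "(F \<longlongrightarrow> 0) (nhds 0)"
    and supp: "\<And>j. j \<notin> R \<Longrightarrow> P j = 0 \<and> Q j = 0"
    and indep: "\<exists>i j. P i * Q j \<noteq> P j * Q i"
    and lam_P: "mpow lam P = 1" and lam_Q: "mpow lam Q = 1"
    and lam_R: "\<And>j. j \<in> R \<Longrightarrow> norm (lam $ j) = 1"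
    and lam_out: "\<And>j. j \<notin> R \<Longrightarrow> norm (lam $ j) < 1"
    and k0_pos: "k0 \<ge> 1" and m_ge_2: "m \<ge> 2" and M_pos: "M \<ge> 1" and v1_nz: "v1 \<noteq> 0"
    and theta: "0 < \<theta>" "\<theta> \<le> 1 / 2" and gamma_pos: "\<gamma> > 0" and M_gamma: "real M * \<gamma> \<ge> 4"
    and B_cont: "\<And>j. j \<in> R \<Longrightarrow> isCont (B j) y0"
    and rate: "\<And>j. j \<in> R \<Longrightarrow> Re (v1 ^ k0 * B j y0) + \<theta> * \<bar>Im (v1 ^ k0 * B j y0)\<bar> \<le> - 4 * \<gamma>"
    and normalized: "of_nat k0 * (v1 ^ k0 * (\<Sum>j\<in>R. of_nat (P j) * B j y0)) = - 1"
    and h_cont: "isCont h y0" and h_nz: "h y0 \<noteq> 0"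
    and irregular: "\<forall>\<^sub>F y in nhds y0. y * (\<Sum>j\<in>R. (of_nat (Q j) - of_nat (P j)) * B j y) = h y * (y - y0) ^ m"
    and N_expansion: "\<And>j. j \<in> R \<Longrightarrow> \<exists>C \<delta>. \<delta> > 0 \<and> (\<forall>s t. norm s < \<delta> \<and> norm t < \<delta> \<and> s \<noteq> 0 \<longrightarrow>
        norm (N j s t - s ^ k0 * B j (t / s)) \<le> C * (norm s + norm t) ^ (k0 + 1))"
    and step_R: "\<And>j. j \<in> R \<Longrightarrow> \<exists>C. \<forall>\<^sub>F z in nhds 0.
        norm (X (F z) $ j - lam $ j * X z $ j * (1 + N j (mpow (X z) P) (mpow (X z) Q)))
          \<le> C * norm (X z) ^ (M * (k0 + 4))"
    and step_out: "\<And>j. j \<notin> R \<Longrightarrow> \<exists>C. \<forall>\<^sub>F z in nhds 0.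
        norm (X (F z) $ j - lam $ j * X z $ j) \<le> C * norm (X z) ^ 2"
begin

text \<open>
  The Fatou coordinate \<open>U\<close> of the radial direction grows by about 1 in each step. In the
  transversal direction \<open>\<eta>\<close> changes by about \<open>v1 ^ k0 * h y0 * \<eta> ^ m / U\<close>, a parabolic flow in the
  time $\log n$; its Fatou coordinate is \<open>\<zeta>\<close>, with increment about \<open>1 / U\<close>. The normalization
  \<open>size\<close> of the modulus of \<open>u1\<close> satisfies \<open>size ^ k0 = 1 / norm U\<close>.
\<close>

definition u1 :: "complex ^ 'n \<Rightarrow> complex" where "u1 z = mpow (X z) P"
definition u2 :: "complex ^ 'n \<Rightarrow> complex" where "u2 z = mpow (X z) Q"
definition size :: "complex ^ 'n \<Rightarrow> real" where "size z = norm (u1 z) / norm v1"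
definition U :: "complex ^ 'n \<Rightarrow> complex" where "U z = v1 ^ k0 / u1 z ^ k0"
definition y :: "complex ^ 'n \<Rightarrow> complex" where "y z = u2 z / u1 z"
definition \<eta> :: "complex ^ 'n \<Rightarrow> complex" where "\<eta> z = y z - y0"
definition fatou_const :: complex where "fatou_const = - 1 / (of_nat (m - 1) * h y0 * v1 ^ k0)"
definition \<zeta> :: "complex ^ 'n \<Rightarrow> complex" where "\<zeta> z = fatou_const / \<eta> z ^ (m - 1)"

text \<open>
  The regions that will be invariant for large \<open>K\<close>. As \<open>\<zeta>\<close> moves only logarithmically,
  the bound of its modulus by a power of the modulus of \<open>U\<close> persists; it keeps
  the errors of order \<open>size ^ (k0 + 1)\<close> negligible against \<open>\<eta> ^ m\<close>. The last condition makes the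
  remainder of the normal form negligible, since \<open>norm (X z) ^ (M * q)\<close> is of order \<open>size z ^ q\<close>.
\<close>

definition D :: "real \<Rightarrow> (complex ^ 'n) set" where
  "D K = {z \<in> ball 0 rad. u1 z \<noteq> 0 \<and> K < Re (U z) \<and> \<bar>Im (U z)\<bar> < \<theta> * Re (U z) \<and>
     \<eta> z \<noteq> 0 \<and> K < Re (\<zeta> z) \<and> norm (\<zeta> z) ^ (4 * k0) < norm (U z) \<and>
     (\<forall>j. norm (X z $ j) ^ M < size z)}"

text \<open>
  The filter of these regions for \<open>K\<close> tending to infinity. All estimates of one step are limits
  or orders of magnitude along it.
\<close>

definition deep :: "(complex ^ 'n) filter" where "deep = (INF K. principal (D K))"

lemma D_antimono: "K \<le> K' \<Longrightarrow> D K' \<subseteq> D K"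
  unfolding D_def by auto

lemma eventually_deep: "eventually p deep \<longleftrightarrow> (\<exists>K. \<forall>z\<in>D K. p z)"
proof -
  have "eventually p deep \<longleftrightarrow> (\<exists>K\<in>UNIV. eventually p (principal (D K)))"
    unfolding deep_def
  proof (rule eventually_INF_base)
    fix a b :: real
    show "\<exists>x\<in>UNIV. principal (D x) \<le> inf (principal (D a)) (principal (D b))"
      by (rule bexI[of _ "max a b"]) (simp_all add: D_antimono)
  qed simp
  then show ?thesis by (simp add: eventually_principal)
qed

lemma eventually_deepI: "(\<And>z. z \<in> D K \<Longrightarrow> p z) \<Longrightarrow> eventually p deep"
  unfolding eventually_deep by blast

lemma deep_basic:
  "\<forall>\<^sub>F z in deep. u1 z \<noteq> 0" "\<forall>\<^sub>F z in deep. \<eta> z \<noteq> 0" "\<forall>\<^sub>F z in deep. norm z < rad"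
  "\<forall>\<^sub>F z in deep. K < Re (U z)" "\<forall>\<^sub>F z in deep. \<bar>Im (U z)\<bar> < \<theta> * Re (U z)"
  "\<forall>\<^sub>F z in deep. K < Re (\<zeta> z)" "\<forall>\<^sub>F z in deep. norm (\<zeta> z) ^ (4 * k0) < norm (U z)"
  "\<forall>\<^sub>F z in deep. norm (X z $ j) ^ M < size z"
  by (rule eventually_deepI[of K]; simp add: D_def)+

lemma fatou_const_nz: "fatou_const \<noteq> 0"
  using m_ge_2 h_nz v1_nz by (simp add: fatou_const_def)

lemma size_power: "u1 z \<noteq> 0 \<Longrightarrow> size z ^ k0 = 1 / norm (U z)"
  by (simp add: size_def U_def norm_divide norm_power power_divide)

lemma size_nonneg: "size z \<ge> 0"
  by (simp add: size_def)

lemma size_pos: "u1 z \<noteq> 0 \<Longrightarrow> size z > 0"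
  using v1_nz by (simp add: size_def)

lemma eventually_size_less:
  assumes "e > 0" shows "\<forall>\<^sub>F z in deep. size z < e"
  using deep_basic(1) deep_basic(4)[of "1 / e ^ k0"]
proof eventually_elim
  case (elim z)
  have e: "1 / e ^ k0 > 0" using assms by simp
  have "1 / e ^ k0 < norm (U z)" using elim(2) complex_Re_le_cmod[of "U z"] by linarith
  moreover from this have "norm (U z) > 0" using e by linarith
  ultimately have "1 / norm (U z) < e ^ k0" using assms by (simp add: field_simps)
  then have "size z ^ k0 < e ^ k0" using size_power[OF elim(1)] by simp
  then show ?case by (rule power_less_imp_less_base) (use assms in simp)
qed

lemma size_tendsto: "(size \<longlongrightarrow> 0) deep"
  by (rule tendstoI) (use eventually_size_less size_nonneg in \<open>simp add: dist_real_def\<close>)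

lemma eta_tendsto: "(\<eta> \<longlongrightarrow> 0) deep"
proof (rule tendstoI)
  fix e :: real assume "e > 0"
  show "\<forall>\<^sub>F z in deep. dist (\<eta> z) 0 < e"
    using deep_basic(2) deep_basic(6)[of "norm fatou_const / e ^ (m - 1)"]
  proof eventually_elim
    case (elim z)
    have "norm fatou_const / e ^ (m - 1) < norm (\<zeta> z)"
      using elim(2) complex_Re_le_cmod[of "\<zeta> z"] by linarith
    also have "\<dots> = norm fatou_const / norm (\<eta> z) ^ (m - 1)"
      by (simp add: \<zeta>_def norm_divide norm_power)
    finally have "norm (\<eta> z) ^ (m - 1) < e ^ (m - 1)"
      using \<open>e > 0\<close> elim(1) fatou_const_nz by (simp add: field_simps)
    then have "norm (\<eta> z) < e" by (rule power_less_imp_less_base) (use \<open>e > 0\<close> in simp)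
    then show ?case by simp
  qed
qed

lemma y_tendsto: "(y \<longlongrightarrow> y0) deep"
proof -
  have "((\<lambda>z. \<eta> z + y0) \<longlongrightarrow> 0 + y0) deep" by (intro tendsto_intros eta_tendsto)
  then show ?thesis by (simp add: \<eta>_def)
qed

lemma X_coord_tendsto: "((\<lambda>z. X z $ j) \<longlongrightarrow> 0) deep"
proof (rule tendstoI)
  fix e :: real assume "e > 0"
  then have "e ^ M > 0" by simp
  from eventually_size_less[OF this] deep_basic(8)[of j]
  show "\<forall>\<^sub>F z in deep. dist (X z $ j) 0 < e"
  proof eventually_elim
    case (elim z)
    then have "norm (X z $ j) ^ M < e ^ M" by simp
    then have "norm (X z $ j) < e" by (rule power_less_imp_less_base) (use \<open>e > 0\<close> in simp)
    then show ?case by simp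
  qed
qed

lemma X_tendsto: "(X \<longlongrightarrow> 0) deep"
  by (rule vec_tendstoI) (simp add: X_coord_tendsto)

lemma id_tendsto: "((\<lambda>z. z) \<longlongrightarrow> 0) deep"
proof (rule tendstoI)
  fix e :: real assume "e > 0"
  then have "low * e > 0" using low_pos by simp
  from tendstoD[OF X_tendsto this] deep_basic(3) show "\<forall>\<^sub>F z in deep. dist z 0 < e"
  proof eventually_elim
    case (elim z)
    then have "low * norm z < low * e" using X_lower[of z] by simp
    then show ?case using low_pos by simp
  qed
qed

lemma eventually_nhds_0_deep: "eventually p (nhds 0) \<Longrightarrow> eventually p deep"
  using eventually_compose_filterlim[OF _ id_tendsto] .

lemma norm_X_power_le: "\<exists>C. \<forall>z q. (\<forall>j. norm (X z $ j) ^ M < size z) \<longrightarrow> norm (X z) ^ (M * q) \<le> C ^ q * size z ^ q"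
proof (intro exI[of _ "real CARD('n) ^ M"] allI impI)
  fix z q assume *: "\<forall>j. norm (X z $ j) ^ M < size z"
  let ?f = "\<lambda>i. norm (X z $ i)"
  have "Max (range ?f) \<in> range ?f" by (rule Max_in) simp_all
  then obtain j where "?f j = Max (range ?f)" by (elim imageE) simp
  then have j: "?f i \<le> ?f j" for i by (simp add: Max_ge)
  have "norm (X z) \<le> (\<Sum>i\<in>UNIV. ?f i)" unfolding norm_vec_def by (rule L2_set_le_sum) simp
  also have "\<dots> \<le> of_nat CARD('n) * norm (X z $ j)" by (intro sum_bounded_above j)
  finally have "norm (X z) ^ M \<le> (real CARD('n) * norm (X z $ j)) ^ M" by (intro power_mono) auto
  also have "\<dots> = real CARD('n) ^ M * norm (X z $ j) ^ M" by (rule power_mult_distrib)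
  also have "\<dots> \<le> real CARD('n) ^ M * size z" using * by (intro mult_left_mono) (auto simp: less_imp_le)
  finally have "(norm (X z) ^ M) ^ q \<le> (real CARD('n) ^ M * size z) ^ q" by (intro power_mono) auto
  then show "norm (X z) ^ (M * q) \<le> (real CARD('n) ^ M) ^ q * size z ^ q"
    by (simp add: power_mult power_mult_distrib)
qed

abbreviation small :: "nat \<Rightarrow> (complex ^ 'n \<Rightarrow> complex) \<Rightarrow> bool" where
  "small k f \<equiv> f \<in> O[deep](\<lambda>z. of_real (size z) ^ k)"

lemma smallI: "\<forall>\<^sub>F z in deep. norm (f z) \<le> C * size z ^ k \<Longrightarrow> small k f"
  by (rule bigoI[of _ C]) (simp add: norm_power size_nonneg)

lemma smallE:
  assumes "small k f"
  obtains C where "C > 0" "\<forall>\<^sub>F z in deep. norm (f z) \<le> C * size z ^ k"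
proof -
  obtain C where "C > 0" "\<forall>\<^sub>F z in deep. norm (f z) \<le> C * norm (of_real (size z) ^ k :: complex)"
    using assms by (rule landau_o.bigE)
  then show thesis by (intro that[of C]) (simp_all add: norm_power size_nonneg)
qed

lemma small_mono:
  assumes "small k f" "j \<le> k" shows "small j f"
proof -
  obtain C where C: "C > 0" "\<forall>\<^sub>F z in deep. norm (f z) \<le> C * size z ^ k" using assms(1) by (rule smallE)
  from C(2) eventually_size_less[of 1]
  have "\<forall>\<^sub>F z in deep. norm (f z) \<le> C * size z ^ j"
  proof (rule eventually_elim2)
    fix z assume 1: "norm (f z) \<le> C * size z ^ k" "size z < 1"
    have "size z ^ k \<le> size z ^ j" using 1(2) assms(2) size_nonneg by (intro power_decreasing) auto
    then show "norm (f z) \<le> C * size z ^ j"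
      using 1(1) C(1) by (meson mult_left_mono less_imp_le order_trans)
  qed simp
  then show ?thesis by (rule smallI)
qed

lemma small_mult: "small j f \<Longrightarrow> small k g \<Longrightarrow> small (j + k) (\<lambda>z. f z * g z)"
  using landau_o.big.mult[of f deep _ g] by (simp add: power_add)

lemma tendsto_imp_small: "(f \<longlongrightarrow> c) deep \<Longrightarrow> small 0 f"
proof -
  assume "(f \<longlongrightarrow> c) deep"
  from tendstoD[OF this, of 1] have "\<forall>\<^sub>F z in deep. dist (f z) c < 1" by simp
  then have "\<forall>\<^sub>F z in deep. norm (f z) \<le> (norm c + 1) * size z ^ 0"
  proof eventually_elim
    case (elim z)
    then show ?case using norm_triangle_ineq2[of "f z" c] by (simp add: dist_norm)
  qed
  then show ?thesis by (rule smallI)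
qed

lemma small_tendsto: "small (Suc k) f \<Longrightarrow> (f \<longlongrightarrow> 0) deep"
proof -
  assume "small (Suc k) f"
  then have "small 1 f" by (rule small_mono) simp
  then obtain C where C: "C > 0" "\<forall>\<^sub>F z in deep. norm (f z) \<le> C * size z ^ 1" by (rule smallE)
  have "((\<lambda>z. C * size z ^ 1) \<longlongrightarrow> C * 0 ^ 1) deep" by (intro tendsto_intros size_tendsto)
  then show ?thesis using C(2) by (intro Lim_null_comparison[of f "\<lambda>z. C * size z ^ 1"]) simp_all
qed

text \<open>
  \<open>U\<close> is of order \<open>size ^ - k0\<close>.
\<close>

lemma U_mult_small:
  assumes "small (k0 + k) f" shows "small k (\<lambda>z. U z * f z)"
proof -
  obtain C where C: "C > 0" "\<forall>\<^sub>F z in deep. norm (f z) \<le> C * size z ^ (k0 + k)" using assms by (rule smallE)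
  from C(2) deep_basic(1) have "\<forall>\<^sub>F z in deep. norm (U z * f z) \<le> C * size z ^ k"
  proof eventually_elim
    case (elim z)
    have "U z \<noteq> 0" using elim(2) v1_nz by (simp add: U_def)
    have "norm (U z * f z) \<le> norm (U z) * (C * size z ^ (k0 + k))"
      using elim(1) by (simp add: norm_mult mult_left_mono)
    also have "\<dots> = C * size z ^ k"
      using \<open>U z \<noteq> 0\<close> by (simp add: power_add size_power[OF elim(2)])
    finally show ?case .
  qed
  then show ?thesis by (rule smallI)
qed

lemma U_u1: "\<forall>\<^sub>F z in deep. U z * u1 z ^ k0 = v1 ^ k0"
  using deep_basic(1) by eventually_elim (simp add: U_def)

lemma u1_small: "small 1 u1"
  using v1_nz by (intro smallI[of _ "norm v1"]) (simp add: size_def)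

lemma u1_power_small: "small k (\<lambda>z. u1 z ^ k)"
  using v1_nz by (intro smallI[of _ "norm v1 ^ k"]) (simp add: size_def norm_power power_divide)

text \<open>
  By definition of \<open>\<zeta>\<close> the modulus of \<open>1 / \<eta> ^ (m - 1)\<close> is proportional to that of \<open>\<zeta>\<close>, and
  $m\le2(m-1)$, so the quotient is at most a constant times
  \<open>size z * norm (\<zeta> z) ^ 2\<close>. The bound of \<open>\<zeta>\<close> in \<open>D\<close> says that \<open>norm (\<zeta> z) ^ 4\<close> is at most
  \<open>1 / size z\<close>.
\<close>

lemma size_over_eta_power: "((\<lambda>z. size z / norm (\<eta> z) ^ m) \<longlongrightarrow> 0) deep"
proof (rule tendstoI)
  fix e :: real assume "e > 0"
  let ?c = "norm fatou_const"
  have c: "?c > 0" using fatou_const_nz by simp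
  have "(e * ?c\<^sup>2)\<^sup>2 > 0" using \<open>e > 0\<close> c by simp
  from eventually_size_less[OF this] tendstoD[OF eta_tendsto zero_less_one]
    deep_basic(1) deep_basic(2) deep_basic(7)
  show "\<forall>\<^sub>F z in deep. dist (size z / norm (\<eta> z) ^ m) 0 < e"
  proof eventually_elim
    case (elim z)
    have x: "size z > 0" using size_pos elim(3) by blast
    have \<eta>: "0 < norm (\<eta> z)" "norm (\<eta> z) \<le> 1" using elim by auto
    have \<zeta>: "norm (\<zeta> z) * norm (\<eta> z) ^ (m - 1) = ?c"
      using \<eta> by (simp add: \<zeta>_def norm_divide norm_power)
    have "(norm (\<zeta> z) ^ 4 * size z) ^ k0 = norm (\<zeta> z) ^ (4 * k0) / norm (U z)"
      by (simp add: power_mult_distrib size_power[OF elim(3)] power_mult)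
    also have "\<dots> < 1"
    proof -
      have "norm (U z) > 0" by (rule le_less_trans[OF _ elim(5)]) simp
      then show ?thesis using elim(5) by simp
    qed
    finally have "(norm (\<zeta> z) ^ 4 * size z) ^ k0 < 1 ^ k0" by simp
    then have "norm (\<zeta> z) ^ 4 * size z < 1" by (rule power_less_imp_less_base) simp
    then have "(norm (\<zeta> z) ^ 4 * size z) * size z \<le> 1 * size z"
      using x by (intro mult_right_mono) auto
    moreover have "(size z * norm (\<zeta> z) ^ 2)\<^sup>2 = norm (\<zeta> z) ^ 4 * size z * size z"
      by algebra
    ultimately have "(size z * norm (\<zeta> z) ^ 2)\<^sup>2 \<le> size z" by linarith
    also have "\<dots> < (e * ?c\<^sup>2)\<^sup>2" by (rule elim(1))
    finally have 1: "size z * norm (\<zeta> z) ^ 2 < e * ?c\<^sup>2"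
      by (rule power_less_imp_less_base) (use \<open>e > 0\<close> in simp)
    have "norm (\<eta> z) ^ (2 * (m - 1)) \<le> norm (\<eta> z) ^ m"
      using \<eta> m_ge_2 by (intro power_decreasing) auto
    then have "size z / norm (\<eta> z) ^ m \<le> size z / norm (\<eta> z) ^ (2 * (m - 1))"
      using x \<eta> by (intro divide_left_mono) auto
    also have "\<dots> = size z * norm (\<zeta> z) ^ 2 / ?c\<^sup>2"
    proof -
      have "norm (\<zeta> z) \<noteq> 0" using \<zeta> c by auto
      then show ?thesis
        unfolding \<zeta>[symmetric] power_mult_distrib using \<eta>
        by (simp add: power_mult[symmetric] mult.commute)
    qed
    also have "\<dots> < e" using 1 c by (simp add: divide_less_eq)
    finally show ?case using x by (simp add: dist_real_def)
  qed
qed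

lemma size_over_y: "\<forall>\<^sub>F z in deep. size z \<le> norm (y z)"
proof (cases "y0 = 0")
  case True
  from tendstoD[OF size_over_eta_power zero_less_one] tendstoD[OF eta_tendsto zero_less_one]
    deep_basic(2)
  show ?thesis
  proof eventually_elim
    case (elim z)
    then have "size z < norm (\<eta> z) ^ m" by (simp add: dist_real_def size_nonneg divide_less_eq)
    also have "\<dots> \<le> norm (\<eta> z) ^ 1" using elim m_ge_2 by (intro power_decreasing) auto
    finally have "size z \<le> norm (\<eta> z)" by simp
    moreover have "\<eta> z = y z" unfolding \<eta>_def using True by simp
    ultimately show ?case by metis
  qed
next
  case False
  then have "norm y0 / 2 > 0" by simp
  from tendstoD[OF y_tendsto this] eventually_size_less[OF this] show ?thesis
  proof eventually_elim
    case (elim z)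
    have "norm y0 \<le> norm (y z) + dist (y z) y0"
      by (metis dist_norm norm_minus_commute norm_triangle_sub add.commute)
    then show ?case using elim by linarith
  qed
qed

lemma mpow_le_coord:
  assumes "\<forall>i. norm (x $ i) \<le> 1" "L j > 0" shows "norm (mpow x L) \<le> norm (x $ j)"
proof -
  have "norm (mpow x L) = norm (x $ j) ^ L j * (\<Prod>i\<in>UNIV - {j}. norm (x $ i) ^ L i)"
    unfolding mpow_def by (subst prod.remove[of _ j]) (simp_all add: norm_mult norm_power flip: prod_norm)
  also have "\<dots> \<le> norm (x $ j) ^ L j * 1"
    using assms(1) by (intro mult_left_mono prod_le_1) (auto intro: power_le_one)
  also have "\<dots> \<le> norm (x $ j) ^ 1"
    using assms power_decreasing[of 1 "L j" "norm (x $ j)"] by simp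
  finally show ?thesis by simp
qed

text \<open>
  A coordinate occurring in \<open>u1\<close> or \<open>u2\<close> cannot be much smaller than that monomial, because the
  others have modulus at most 1. Hence the absolute errors of these coordinates are also small
  relative errors.
\<close>

lemma X_coord_lower:
  assumes "P j > 0 \<or> Q j > 0"
  shows "\<forall>\<^sub>F z in deep. norm v1 * size z ^ 2 \<le> norm (X z $ j)"
proof -
  have "\<forall>\<^sub>F z in deep. norm (X z $ i) \<le> 1" for i
    using tendstoD[OF X_coord_tendsto[of i] zero_less_one] by eventually_elim simp
  then have "\<forall>\<^sub>F z in deep. \<forall>i. norm (X z $ i) \<le> 1" by (rule eventually_all_finite)
  moreover have "\<forall>\<^sub>F z in deep. size z < 1" using eventually_size_less by simp
  ultimately show ?thesis using size_over_y deep_basic(1)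
  proof eventually_elim
    case (elim z)
    have u1: "norm (u1 z) = norm v1 * size z" using v1_nz by (simp add: size_def)
    have sq: "size z ^ 2 \<le> size z"
      using elim(2) size_nonneg[of z] by (simp add: power2_eq_square mult_left_le)
    show ?case
    proof (cases "P j > 0")
      case True
      have "norm v1 * size z ^ 2 \<le> norm (u1 z)" unfolding u1 using sq by (intro mult_left_mono) auto
      also have "\<dots> \<le> norm (X z $ j)" unfolding u1_def by (rule mpow_le_coord[where L = P, OF elim(1) True])
      finally show ?thesis .
    next
      case False
      then have Q: "Q j > 0" using assms by simp
      have "norm v1 * size z ^ 2 = norm (u1 z) * size z" unfolding u1 by (simp add: power2_eq_square)
      also have "\<dots> \<le> norm (u1 z) * norm (y z)" using elim(3) by (intro mult_left_mono) auto
      also have "\<dots> = norm (u2 z)" using elim(4) by (simp add: y_def norm_divide)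
      also have "\<dots> \<le> norm (X z $ j)" unfolding u2_def by (rule mpow_le_coord[where L = Q, OF elim(1) Q])
      finally show ?thesis .
    qed
  qed
qed

lemma remainder_small:
  assumes "j \<in> R"
  shows "small (k0 + 4) (\<lambda>z. X (F z) $ j - lam $ j * X z $ j * (1 + N j (u1 z) (u2 z)))"
proof -
  obtain C where C: "\<forall>\<^sub>F z in nhds 0. norm (X (F z) $ j - lam $ j * X z $ j * (1 + N j (u1 z) (u2 z)))
      \<le> C * norm (X z) ^ (M * (k0 + 4))"
    using step_R[OF assms] unfolding u1_def u2_def by blast
  obtain E where E: "\<And>z q. \<forall>j. norm (X z $ j) ^ M < size z \<Longrightarrow> norm (X z) ^ (M * q) \<le> E ^ q * size z ^ q"
    using norm_X_power_le by blast
  have "\<forall>\<^sub>F z in deep. \<forall>j. norm (X z $ j) ^ M < size z"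
    by (intro eventually_all_finite deep_basic(8))
  with eventually_nhds_0_deep[OF C]
  have "\<forall>\<^sub>F z in deep. norm (X (F z) $ j - lam $ j * X z $ j * (1 + N j (u1 z) (u2 z)))
      \<le> (\<bar>C\<bar> * E ^ (k0 + 4)) * size z ^ (k0 + 4)"
  proof eventually_elim
    case (elim z)
    have "C * norm (X z) ^ (M * (k0 + 4)) \<le> \<bar>C\<bar> * norm (X z) ^ (M * (k0 + 4))"
      by (intro mult_right_mono) auto
    also have "\<dots> \<le> \<bar>C\<bar> * (E ^ (k0 + 4) * size z ^ (k0 + 4))"
      by (intro mult_left_mono E elim(2)) auto
    finally show ?case using elim(1) by (simp add: mult.assoc)
  qed
  then show ?thesis by (rule smallI)
qed

lemma u_tendsto: "(u1 \<longlongrightarrow> 0) deep" "(u2 \<longlongrightarrow> 0) deep"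
proof -
  show u1: "(u1 \<longlongrightarrow> 0) deep" using small_tendsto[where k = 0 and f = u1] u1_small by simp
  have "((\<lambda>z. u1 z * y z) \<longlongrightarrow> 0 * y0) deep" by (intro tendsto_intros u1 y_tendsto)
  moreover have "\<forall>\<^sub>F z in deep. u1 z * y z = u2 z"
    using deep_basic(1) by eventually_elim (simp add: y_def)
  ultimately show "(u2 \<longlongrightarrow> 0) deep" by (simp add: tendsto_cong)
qed

lemma N_small:
  assumes "j \<in> R"
  shows "small (k0 + 1) (\<lambda>z. N j (u1 z) (u2 z) - u1 z ^ k0 * B j (y z))"
proof -
  obtain C \<delta> where "\<delta> > 0" and C: "\<And>s t. norm s < \<delta> \<Longrightarrow> norm t < \<delta> \<Longrightarrow> s \<noteq> 0 \<Longrightarrow>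
      norm (N j s t - s ^ k0 * B j (t / s)) \<le> C * (norm s + norm t) ^ (k0 + 1)"
    using N_expansion[OF assms] by blast
  have "\<forall>\<^sub>F z in deep. norm (N j (u1 z) (u2 z) - u1 z ^ k0 * B j (y z))
      \<le> (\<bar>C\<bar> * (norm v1 * (norm y0 + 2)) ^ (k0 + 1)) * size z ^ (k0 + 1)"
    using tendstoD[OF u_tendsto(1) \<open>\<delta> > 0\<close>] tendstoD[OF u_tendsto(2) \<open>\<delta> > 0\<close>] deep_basic(1)
      tendstoD[OF y_tendsto zero_less_one]
  proof eventually_elim
    case (elim z)
    have "norm (y z) \<le> norm y0 + 1"
      using elim(4) norm_triangle_ineq2[of "y z" y0] by (simp add: dist_norm)
    then have "norm (u1 z) * norm (y z) \<le> norm (u1 z) * (norm y0 + 1)" by (intro mult_left_mono) auto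
    then have "norm (u1 z) + norm (u2 z) \<le> norm (u1 z) * (norm y0 + 2)"
      using elim(3) by (simp add: y_def norm_divide algebra_simps)
    also have "\<dots> = norm v1 * (norm y0 + 2) * size z" using v1_nz by (simp add: size_def)
    finally have "(norm (u1 z) + norm (u2 z)) ^ (k0 + 1) \<le> (norm v1 * (norm y0 + 2) * size z) ^ (k0 + 1)"
      by (intro power_mono) auto
    then have "\<bar>C\<bar> * (norm (u1 z) + norm (u2 z)) ^ (k0 + 1) \<le> \<bar>C\<bar> * (norm v1 * (norm y0 + 2) * size z) ^ (k0 + 1)"
      by (intro mult_left_mono) auto
    moreover have "C * (norm (u1 z) + norm (u2 z)) ^ (k0 + 1) \<le> \<bar>C\<bar> * (norm (u1 z) + norm (u2 z)) ^ (k0 + 1)"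
      by (intro mult_right_mono) auto
    moreover have "norm (N j (u1 z) (u2 z) - u1 z ^ k0 * B j (y z)) \<le> C * (norm (u1 z) + norm (u2 z)) ^ (k0 + 1)"
      unfolding y_def by (rule C) (use elim in auto)
    ultimately have "norm (N j (u1 z) (u2 z) - u1 z ^ k0 * B j (y z)) \<le> \<bar>C\<bar> * (norm v1 * (norm y0 + 2) * size z) ^ (k0 + 1)"
      by linarith
    then show ?case
      unfolding power_mult_distrib[of "norm v1 * (norm y0 + 2)" "size z"] mult.assoc[of "\<bar>C\<bar>"] .
  qed
  then show ?thesis by (rule smallI)
qed

lemma generator_index_in_R: "P j > 0 \<or> Q j > 0 \<Longrightarrow> j \<in> R"
proof (rule ccontr)
  assume "P j > 0 \<or> Q j > 0" "j \<notin> R"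
  with supp[OF this(2)] show False by simp
qed

lemma B_tendsto: "j \<in> R \<Longrightarrow> ((\<lambda>z. B j (y z)) \<longlongrightarrow> B j y0) deep"
  using B_cont y_tendsto by (auto intro: isCont_tendsto_compose)

lemma lam_nz: "j \<in> R \<Longrightarrow> lam $ j \<noteq> 0"
  using lam_R by force

text \<open>
  \<open>1 + factor j z\<close> is the quotient of the new and the old \<open>j\<close>-th coordinate divided by \<open>lam $ j\<close>. It is
  needed only for the coordinates that occur in \<open>u1\<close> or \<open>u2\<close>; the value 0 for the others lets
  the products below run over all indices.
\<close>

definition factor :: "'n \<Rightarrow> complex ^ 'n \<Rightarrow> complex" where
  "factor j z = (if P j > 0 \<or> Q j > 0 then X (F z) $ j / (lam $ j * X z $ j) - 1 else 0)"

text \<open>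
  The division by a coordinate, which is at least of order \<open>size ^ 2\<close>, costs two of the \<open>k0 + 4\<close> orders of
  the remainder.
\<close>

lemma factor_expansion:
  assumes "P j > 0 \<or> Q j > 0"
  shows "small (k0 + 1) (\<lambda>z. factor j z - u1 z ^ k0 * B j (y z))"
proof -
  have j: "j \<in> R" using assms by (rule generator_index_in_R)
  obtain C where C: "C > 0" "\<forall>\<^sub>F z in deep.
      norm (X (F z) $ j - lam $ j * X z $ j * (1 + N j (u1 z) (u2 z))) \<le> C * size z ^ (k0 + 4)"
    using remainder_small[OF j] by (rule smallE)
  from C(2) X_coord_lower[OF assms] deep_basic(1)
  have "\<forall>\<^sub>F z in deep. norm (factor j z - N j (u1 z) (u2 z)) \<le> (C / norm v1) * size z ^ (k0 + 2)"
  proof eventually_elim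
    case (elim z)
    have x: "size z > 0" using size_pos elim(3) by blast
    then have low: "norm v1 * size z ^ 2 > 0" using v1_nz by simp
    then have Xz: "X z $ j \<noteq> 0" using elim(2) by auto
    have "factor j z - N j (u1 z) (u2 z)
        = (X (F z) $ j - lam $ j * X z $ j * (1 + N j (u1 z) (u2 z))) / (lam $ j * X z $ j)"
      using assms Xz lam_nz[OF j] by (simp add: factor_def field_simps)
    then have "norm (factor j z - N j (u1 z) (u2 z))
        = norm (X (F z) $ j - lam $ j * X z $ j * (1 + N j (u1 z) (u2 z))) / norm (X z $ j)"
      by (simp add: norm_divide norm_mult lam_R[OF j])
    also have "\<dots> \<le> C * size z ^ (k0 + 4) / (norm v1 * size z ^ 2)"
      using elim(1,2) low C(1) x by (intro frac_le) auto
    also have "\<dots> = (C / norm v1) * size z ^ (k0 + 2)"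
      using x v1_nz by (simp add: field_simps power_add eval_nat_numeral)
    finally show ?case .
  qed
  from smallI[OF this] have "small (k0 + 1) (\<lambda>z. factor j z - N j (u1 z) (u2 z))"
    by (rule small_mono) simp
  from sum_in_bigo(1)[OF this N_small[OF j]] show ?thesis by simp
qed

lemma u1_B_small: "j \<in> R \<Longrightarrow> small k0 (\<lambda>z. u1 z ^ k0 * B j (y z))"
  using small_mult[OF u1_power_small[of k0] tendsto_imp_small[OF B_tendsto]] by simp

lemma factor_small: "small k0 (factor j)"
proof (cases "P j > 0 \<or> Q j > 0")
  case True
  have j: "j \<in> R" using True by (rule generator_index_in_R)
  have "small k0 (\<lambda>z. factor j z - u1 z ^ k0 * B j (y z))"
    using factor_expansion[OF True] by (rule small_mono) simp
  from sum_in_bigo(1)[OF this u1_B_small[OF j]] show ?thesis by simp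
qed (simp add: factor_def[abs_def])

text \<open>
  To first order the growth of a monomial is the sum of the growths of its factors; quadratic terms
  have order \<open>2 * k0\<close>, which is at least \<open>k0 + 1\<close>. The unimodular constants cancel because the
  monomial is invariant under the linear part.
\<close>

lemma monomial_growth:
  assumes L: "\<And>j. L j > 0 \<Longrightarrow> P j > 0 \<or> Q j > 0" and "mpow lam L = 1"
  defines "g \<equiv> \<lambda>z. \<Prod>j\<in>UNIV. (1 + factor j z) ^ L j"
  shows "\<forall>\<^sub>F z in deep. mpow (X (F z)) L = mpow (X z) L * g z"
    and "small (k0 + 1) (\<lambda>z. g z - 1 - u1 z ^ k0 * (\<Sum>j\<in>R. of_nat (L j) * B j (y z)))"
proof -
  have "\<forall>\<^sub>F z in deep. \<forall>j. P j > 0 \<or> Q j > 0 \<longrightarrow> X z $ j \<noteq> 0"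
  proof (intro eventually_all_finite)
    fix j
    show "\<forall>\<^sub>F z in deep. P j > 0 \<or> Q j > 0 \<longrightarrow> X z $ j \<noteq> 0"
    proof (cases "P j > 0 \<or> Q j > 0")
      case True
      from X_coord_lower[OF True] deep_basic(1) show ?thesis
      proof eventually_elim
        case (elim z)
        have "norm v1 * size z ^ 2 > 0" using v1_nz size_pos[OF elim(2)] by simp
        then show ?case using elim(1) by auto
      qed
    qed simp
  qed
  then show "\<forall>\<^sub>F z in deep. mpow (X (F z)) L = mpow (X z) L * g z"
  proof eventually_elim
    case (elim z)
    have "(X (F z) $ j) ^ L j = (lam $ j) ^ L j * ((X z $ j) ^ L j * (1 + factor j z) ^ L j)" for j
    proof (cases "L j = 0")
      case False
      then have j: "P j > 0 \<or> Q j > 0" using L[of j] by simp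
      then have "j \<in> R" by (rule generator_index_in_R)
      moreover have "X z $ j \<noteq> 0" using elim j by blast
      ultimately have "X (F z) $ j = lam $ j * (X z $ j * (1 + factor j z))"
        using j lam_nz[of j] by (simp add: factor_def)
      then show ?thesis by (simp add: power_mult_distrib)
    qed simp
    then have "mpow (X (F z)) L = mpow lam L * (mpow (X z) L * g z)"
      by (simp add: mpow_def g_def prod.distrib)
    then show ?case using \<open>mpow lam L = 1\<close> by simp
  qed
  have "small (k0 + k0) (\<lambda>z. g z - 1 - (\<Sum>j\<in>UNIV. of_nat (L j) * factor j z))"
  proof -
    have "(\<lambda>z. of_real (size z) ^ k0) \<in> O[deep](\<lambda>_. 1 :: complex)"
      using small_mono[where k = k0 and f = "\<lambda>z. of_real (size z) ^ k0" and j = 0] by simp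
    from product_expansion[OF this factor_small, where S = UNIV and L = L]
    show ?thesis by (simp add: g_def power2_eq_square power_add)
  qed
  then have 1: "small (k0 + 1) (\<lambda>z. g z - 1 - (\<Sum>j\<in>UNIV. of_nat (L j) * factor j z))"
    by (rule small_mono) (use k0_pos in simp)
  have "small (k0 + 1) (\<lambda>z. of_nat (L j) * (factor j z - u1 z ^ k0 * B j (y z)))" if "j \<in> R" for j
    by (cases "L j = 0") (use factor_expansion L[of j] in auto)
  then have 2: "small (k0 + 1) (\<lambda>z. \<Sum>j\<in>R. of_nat (L j) * (factor j z - u1 z ^ k0 * B j (y z)))"
    by (intro big_sum_in_bigo)
  have "(\<Sum>j\<in>UNIV. of_nat (L j) * factor j z) = (\<Sum>j\<in>R. of_nat (L j) * factor j z)" for z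
    by (rule sum.mono_neutral_right) (use supp in \<open>auto simp: factor_def\<close>)
  then have eq: "(g z - 1 - (\<Sum>j\<in>UNIV. of_nat (L j) * factor j z))
      + (\<Sum>j\<in>R. of_nat (L j) * (factor j z - u1 z ^ k0 * B j (y z)))
      = g z - 1 - u1 z ^ k0 * (\<Sum>j\<in>R. of_nat (L j) * B j (y z))" for z
    by (simp add: right_diff_distrib sum_subtractf sum_distrib_left mult_ac)
  from sum_in_bigo(1)[OF 1 2]
  show "small (k0 + 1) (\<lambda>z. g z - 1 - u1 z ^ k0 * (\<Sum>j\<in>R. of_nat (L j) * B j (y z)))"
    unfolding eq .
qed

end

section \<open>One step in the Fatou coordinates\<close>

lemma norm_one_plus_le:
  assumes "norm a \<le> 1 / 2" shows "norm (1 + a :: complex) \<le> 1 + Re a + norm a ^ 2"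
proof (rule power2_le_imp_le)
  have "Re a \<ge> - 1 / 2" using assms abs_Re_le_cmod[of a] by linarith
  then show "0 \<le> 1 + Re a + norm a ^ 2" by (simp add: add_nonneg_nonneg)
  have "norm (1 + a) ^ 2 = 1 + 2 * Re a + norm a ^ 2"
    unfolding cmod_power2 by (simp add: power2_eq_square algebra_simps)
  also have "\<dots> \<le> 1 + 2 * Re a + norm a ^ 2 + (norm a ^ 2 + (Re a + norm a ^ 2) ^ 2)" by simp
  also have "\<dots> = (1 + Re a + norm a ^ 2) ^ 2" by (simp add: power2_eq_square algebra_simps)
  finally show "norm (1 + a) ^ 2 \<le> (1 + Re a + norm a ^ 2) ^ 2" .
qed

lemma cone_norm_le:
  fixes W :: complex
  assumes "\<bar>Im W\<bar> \<le> \<theta> * Re W" "\<theta> \<le> 1 / 2" "Re W > 0"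
  shows "norm W \<le> 3 / 2 * Re W"
proof -
  have "\<theta> * Re W \<le> 1 / 2 * Re W" using assms by (intro mult_right_mono) auto
  then show ?thesis using cmod_le[of W] assms by linarith
qed

lemma Re_divide_cone_le:
  fixes W b w :: complex
  assumes W: "\<bar>Im W\<bar> \<le> \<theta> * Re W" "\<theta> \<le> 1 / 2" "Re W > 0"
    and b: "Re b + \<theta> * \<bar>Im b\<bar> \<le> - 4 * \<gamma>" and w: "norm (w - b) \<le> \<gamma>" and "\<gamma> > 0"
  shows "Re (w / W) \<le> - (5 / 3) * \<gamma> / norm W"
proof -
  have "norm W > 0" using W(3) by auto
  have "Re ((w - b) * cnj W) \<le> norm ((w - b) * cnj W)" by (rule complex_Re_le_cmod)
  also have "\<dots> \<le> \<gamma> * norm W" using w by (simp add: norm_mult mult_right_mono)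
  finally have 1: "Re ((w - b) * cnj W) \<le> \<gamma> * norm W" .
  have "Im b * Im W \<le> \<bar>Im b\<bar> * \<bar>Im W\<bar>" by (metis abs_ge_self abs_mult)
  also have "\<dots> \<le> \<bar>Im b\<bar> * (\<theta> * Re W)" using W(1) by (intro mult_left_mono) auto
  finally have "Re (b * cnj W) \<le> Re W * (Re b + \<theta> * \<bar>Im b\<bar>)" by (simp add: algebra_simps)
  also have "\<dots> \<le> Re W * (- 4 * \<gamma>)" using b W(3) by (intro mult_left_mono) auto
  finally have 2: "Re (b * cnj W) \<le> - 4 * \<gamma> * Re W" by (simp add: mult.commute)
  have "\<gamma> * norm W \<le> \<gamma> * (3 / 2 * Re W)"
    using cone_norm_le[OF W] \<open>\<gamma> > 0\<close> by (intro mult_left_mono) auto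
  then have 3: "- 4 * \<gamma> * Re W \<le> - (8 / 3) * (\<gamma> * norm W)" by simp
  have "Re (w * cnj W) = Re ((w - b) * cnj W) + Re (b * cnj W)" by (simp add: algebra_simps)
  then have "Re (w * cnj W) \<le> - (5 / 3) * \<gamma> * norm W" using 1 2 3 by linarith
  then have "Re (w * cnj W) / norm W ^ 2 \<le> - (5 / 3) * \<gamma> * norm W / norm W ^ 2"
    by (intro divide_right_mono) auto
  moreover have "Re (w / W) = Re (w * cnj W) / norm W ^ 2"
    by (simp add: Re_divide cmod_power2)
  ultimately show ?thesis using \<open>norm W > 0\<close> by (simp add: power2_eq_square)
qed

text \<open>
  By Bernoulli's inequality the \<open>M\<close>-th power of the contraction of a coordinate is below the
  factor by which \<open>u1\<close> shrinks, which will be at least \<open>1 - 2 * S\<close> for \<open>S = size ^ k0\<close>.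
\<close>

lemma contraction_power_less:
  fixes \<gamma> S :: real
  assumes "\<gamma> > 0" "real M * \<gamma> \<ge> 4" "0 < S" "S < 1 / 4" "\<gamma> * S \<le> 1"
  shows "(1 - \<gamma> * S) ^ M < 1 - 2 * S"
proof -
  let ?a = "\<gamma> * S"
  have a: "0 \<le> ?a" "?a \<le> 1" using assms by auto
  have "1 + 4 * S \<le> 1 + real M * ?a"
    using assms(2,3) by (simp add: mult_right_mono flip: mult.assoc)
  also have "\<dots> \<le> (1 + ?a) ^ M" by (rule Bernoulli_inequality) (use a in simp)
  finally have "(1 - ?a) ^ M * (1 + 4 * S) \<le> (1 - ?a) ^ M * (1 + ?a) ^ M"
    using a by (intro mult_left_mono) auto
  also have "\<dots> = (1 - ?a ^ 2) ^ M" by (simp add: power_mult_distrib[symmetric] power2_eq_square algebra_simps)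
  also have "\<dots> \<le> 1" using a by (intro power_le_one) (auto simp: power_le_one)
  also have "1 < (1 - 2 * S) * (1 + 4 * S)"
  proof -
    have "S * S < S * (1 / 4)" using assms(3,4) by (intro mult_strict_left_mono)
    then show ?thesis by (simp add: algebra_simps)
  qed
  finally show ?thesis using assms(3) by simp
qed

lemma open_less_on:
  fixes f g :: "'a::topological_space \<Rightarrow> real"
  assumes "open S" "continuous_on S f" "continuous_on S g"
  shows "open {z \<in> S. f z < g z}"
proof -
  have "open (S \<inter> (\<lambda>z. g z - f z) -` {0<..})"
    using assms by (intro continuous_open_preimage continuous_intros) auto
  also have "S \<inter> (\<lambda>z. g z - f z) -` {0<..} = {z \<in> S. f z < g z}" by auto
  finally show ?thesis .
qed

context irregular_dynamics
begin

definition growth_P :: "complex ^ 'n \<Rightarrow> complex" where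
  "growth_P z = (\<Prod>j\<in>UNIV. (1 + factor j z) ^ P j)"

definition growth_Q :: "complex ^ 'n \<Rightarrow> complex" where
  "growth_Q z = (\<Prod>j\<in>UNIV. (1 + factor j z) ^ Q j)"

lemma growth_P:
  "\<forall>\<^sub>F z in deep. u1 (F z) = u1 z * growth_P z"
  "small (k0 + 1) (\<lambda>z. growth_P z - 1 - u1 z ^ k0 * (\<Sum>j\<in>R. of_nat (P j) * B j (y z)))"
  using monomial_growth[where L = P] lam_P unfolding growth_P_def u1_def by simp_all

lemma growth_Q:
  "\<forall>\<^sub>F z in deep. u2 (F z) = u2 z * growth_Q z"
  "small (k0 + 1) (\<lambda>z. growth_Q z - 1 - u1 z ^ k0 * (\<Sum>j\<in>R. of_nat (Q j) * B j (y z)))"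
  using monomial_growth[where L = Q] lam_Q unfolding growth_Q_def u2_def by simp_all

lemma U_mult_tendsto:
  assumes d: "small (k0 + 1) (\<lambda>z. d z - u1 z ^ k0 * b z)" and b: "(b \<longlongrightarrow> b0) deep"
  shows "((\<lambda>z. U z * d z) \<longlongrightarrow> v1 ^ k0 * b0) deep"
proof -
  have "small (Suc 0) (\<lambda>z. U z * (d z - u1 z ^ k0 * b z))" using U_mult_small[OF d] by simp
  then have "((\<lambda>z. U z * (d z - u1 z ^ k0 * b z)) \<longlongrightarrow> 0) deep" by (rule small_tendsto)
  then have "((\<lambda>z. U z * (d z - u1 z ^ k0 * b z) + v1 ^ k0 * b z) \<longlongrightarrow> 0 + v1 ^ k0 * b0) deep"
    by (intro tendsto_intros b)
  moreover have "\<forall>\<^sub>F z in deep. U z * (d z - u1 z ^ k0 * b z) + v1 ^ k0 * b z = U z * d z"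
    using U_u1
  proof eventually_elim
    case (elim z)
    show ?case unfolding elim[symmetric] by (simp add: algebra_simps)
  qed
  ultimately show ?thesis by (simp add: tendsto_cong)
qed

lemma sum_B_tendsto:
  "((\<lambda>z. \<Sum>j\<in>R. c j * B j (y z)) \<longlongrightarrow> (\<Sum>j\<in>R. c j * B j y0)) deep"
  by (intro tendsto_sum tendsto_mult tendsto_const B_tendsto)

lemma inverse_U_tendsto: "((\<lambda>z. inverse (U z)) \<longlongrightarrow> 0) deep"
proof -
  have "\<forall>\<^sub>F z in deep. norm (inverse (U z)) \<le> 1 * size z ^ k0"
    using deep_basic(1) by eventually_elim (simp add: size_power norm_divide inverse_eq_divide)
  then have "small k0 (\<lambda>z. inverse (U z))" by (rule smallI)
  then have "small (Suc 0) (\<lambda>z. inverse (U z))" by (rule small_mono) (use k0_pos in simp)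
  then show ?thesis by (rule small_tendsto)
qed

lemma vanishing_if_U_mult_tendsto:
  assumes "((\<lambda>z. U z * d z) \<longlongrightarrow> a) deep" shows "(d \<longlongrightarrow> 0) deep"
proof -
  have "((\<lambda>z. inverse (U z) * (U z * d z)) \<longlongrightarrow> 0 * a) deep"
    by (intro tendsto_intros assms inverse_U_tendsto)
  moreover have "\<forall>\<^sub>F z in deep. inverse (U z) * (U z * d z) = d z"
    using deep_basic(1) by eventually_elim (use v1_nz in \<open>simp add: U_def\<close>)
  ultimately show ?thesis by (simp add: tendsto_cong)
qed

lemma U_growth_P: "((\<lambda>z. U z * (growth_P z - 1)) \<longlongrightarrow> - 1 / of_nat k0) deep"
proof -
  have "v1 ^ k0 * (\<Sum>j\<in>R. of_nat (P j) * B j y0) = - 1 / of_nat k0"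
    using normalized k0_pos by (simp add: field_simps)
  with U_mult_tendsto[OF growth_P(2) sum_B_tendsto[of "\<lambda>j. of_nat (P j)"]] show ?thesis by simp
qed

lemma growth_P_tendsto: "(growth_P \<longlongrightarrow> 1) deep"
proof -
  have "((\<lambda>z. (growth_P z - 1) + 1) \<longlongrightarrow> 0 + 1) deep"
    by (intro tendsto_intros vanishing_if_U_mult_tendsto[OF U_growth_P])
  then show ?thesis by simp
qed

lemma growth_P_nz: "\<forall>\<^sub>F z in deep. growth_P z \<noteq> 0"
  by (rule tendsto_imp_eventually_ne[OF growth_P_tendsto]) simp

lemma U_increment: "((\<lambda>z. U (F z) - U z) \<longlongrightarrow> 1) deep"
proof -
  have "((\<lambda>z. U z * (1 / (1 + (growth_P z - 1)) ^ k0 - 1)) \<longlongrightarrow> - of_nat k0 * (- 1 / of_nat k0)) deep"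
    by (rule inverse_power_increment[OF vanishing_if_U_mult_tendsto[OF U_growth_P] U_growth_P])
  moreover have "- of_nat k0 * (- 1 / of_nat k0) = (1 :: complex)" using k0_pos by simp
  moreover have "\<forall>\<^sub>F z in deep. U z * (1 / (1 + (growth_P z - 1)) ^ k0 - 1) = U (F z) - U z"
    using growth_P(1) by eventually_elim (simp add: U_def power_mult_distrib algebra_simps)
  ultimately show ?thesis by (simp add: tendsto_cong)
qed

text \<open>
  The growth factors of \<open>u1\<close> and \<open>u2\<close> differ by \<open>u1 ^ k0\<close> times the sum in the hypothesis
  \<open>irregular\<close>, up to order \<open>size ^ (k0 + 1)\<close>. After multiplication by \<open>y\<close> the main term is
  \<open>u1 ^ k0 * h y * \<eta> ^ m\<close>, and the error divided by \<open>\<eta> ^ m\<close> tends to 0.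
\<close>

lemma eta_increment:
  "((\<lambda>z. U z * (\<eta> (F z) - \<eta> z) / \<eta> z ^ m) \<longlongrightarrow> v1 ^ k0 * h y0) deep"
proof -
  define r where "r = (\<lambda>z. (growth_Q z - growth_P z)
      - u1 z ^ k0 * (\<Sum>j\<in>R. (of_nat (Q j) - of_nat (P j)) * B j (y z)))"
  have "small (k0 + 1) r"
    using sum_in_bigo(2)[OF growth_Q(2) growth_P(2)]
    by (simp add: r_def algebra_simps sum_subtractf)
  then have "small 1 (\<lambda>z. U z * r z)" by (rule U_mult_small)
  then obtain C where C: "C > 0" "\<forall>\<^sub>F z in deep. norm (U z * r z) \<le> C * size z ^ 1" by (rule smallE)
  have lim: "((\<lambda>z. norm (y z) * C * (size z / norm (\<eta> z) ^ m)) \<longlongrightarrow> norm y0 * C * 0) deep"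
    by (intro tendsto_intros y_tendsto size_over_eta_power)
  have "\<forall>\<^sub>F z in deep. norm (y z * (U z * r z) / \<eta> z ^ m) \<le> norm (y z) * C * (size z / norm (\<eta> z) ^ m)"
    using C(2)
  proof eventually_elim
    case (elim z)
    have "norm (y z) * norm (U z * r z) / norm (\<eta> z) ^ m \<le> norm (y z) * (C * size z) / norm (\<eta> z) ^ m"
      using elim by (intro divide_right_mono mult_left_mono) auto
    then show ?case by (simp add: norm_mult norm_divide norm_power mult.assoc)
  qed
  from Lim_null_comparison[OF this lim[unfolded mult_zero_right]]
  have rest: "((\<lambda>z. y z * (U z * r z) / \<eta> z ^ m) \<longlongrightarrow> 0) deep" .
  have hy: "((\<lambda>z. h (y z)) \<longlongrightarrow> h y0) deep"
    using h_cont y_tendsto by (rule isCont_tendsto_compose)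
  have "((\<lambda>z. (y z * (U z * r z) / \<eta> z ^ m + v1 ^ k0 * h (y z)) / growth_P z) \<longlongrightarrow> (0 + v1 ^ k0 * h y0) / 1) deep"
    by (intro tendsto_intros rest hy growth_P_tendsto) simp
  moreover have "\<forall>\<^sub>F z in deep. (y z * (U z * r z) / \<eta> z ^ m + v1 ^ k0 * h (y z)) / growth_P z
      = U z * (\<eta> (F z) - \<eta> z) / \<eta> z ^ m"
    using growth_P(1) growth_Q(1) growth_P_nz U_u1 deep_basic(1) deep_basic(2)
      eventually_compose_filterlim[OF irregular y_tendsto]
  proof eventually_elim
    case (elim z)
    let ?s = "\<Sum>j\<in>R. (of_nat (Q j) - of_nat (P j)) * B j (y z)"
    have "y (F z) = y z * growth_Q z / growth_P z"
      unfolding y_def elim(1) elim(2) by simp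
    then have "\<eta> (F z) - \<eta> z = y z * (growth_Q z - growth_P z) / growth_P z"
      using elim(3) by (simp add: \<eta>_def diff_divide_distrib right_diff_distrib)
    also have "growth_Q z - growth_P z = r z + u1 z ^ k0 * ?s" by (simp add: r_def)
    finally have "U z * (\<eta> (F z) - \<eta> z) = (y z * (U z * r z) + (U z * u1 z ^ k0) * (y z * ?s)) / growth_P z"
      by (simp add: algebra_simps)
    also have "\<dots> = (y z * (U z * r z) + v1 ^ k0 * (h (y z) * \<eta> z ^ m)) / growth_P z"
      unfolding elim(4) elim(7) \<eta>_def ..
    finally show ?case using elim(6) by (simp add: add_divide_distrib)
  qed
  ultimately show ?thesis by (simp add: tendsto_cong)
qed

lemma eta_relative_increment: "((\<lambda>z. (\<eta> (F z) - \<eta> z) / \<eta> z) \<longlongrightarrow> 0) deep"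
proof -
  have "((\<lambda>z. (U z * (\<eta> (F z) - \<eta> z) / \<eta> z ^ m) * \<eta> z ^ (m - 1) * inverse (U z))
      \<longlongrightarrow> (v1 ^ k0 * h y0) * 0 ^ (m - 1) * 0) deep"
    by (intro tendsto_intros eta_increment eta_tendsto inverse_U_tendsto)
  moreover have "\<forall>\<^sub>F z in deep. (U z * (\<eta> (F z) - \<eta> z) / \<eta> z ^ m) * \<eta> z ^ (m - 1) * inverse (U z)
      = (\<eta> (F z) - \<eta> z) / \<eta> z"
    using deep_basic(1) deep_basic(2)
  proof eventually_elim
    case (elim z)
    have "\<eta> z ^ m = \<eta> z * \<eta> z ^ (m - 1)" using m_ge_2 by (cases m) auto
    moreover have "U z \<noteq> 0" using elim(1) v1_nz by (simp add: U_def)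
    ultimately show ?case using elim(2) by simp
  qed
  ultimately show ?thesis by (simp add: tendsto_cong)
qed

lemma eta_step_nz: "\<forall>\<^sub>F z in deep. \<eta> (F z) \<noteq> 0"
  using tendstoD[OF eta_relative_increment zero_less_one] deep_basic(2)
proof eventually_elim
  case (elim z)
  then show ?case by (auto simp: norm_divide)
qed

text \<open>
  The constant in \<open>\<zeta>\<close> is chosen so that this limit is 1.
\<close>

lemma zeta_increment: "((\<lambda>z. U z * (\<zeta> (F z) - \<zeta> z)) \<longlongrightarrow> 1) deep"
proof -
  let ?\<sigma> = "\<lambda>z. (\<eta> (F z) - \<eta> z) / \<eta> z"
  have "((\<lambda>z. fatou_const * (U z * (\<eta> (F z) - \<eta> z) / \<eta> z ^ m)) \<longlongrightarrow> fatou_const * (v1 ^ k0 * h y0)) deep"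
    by (intro tendsto_intros eta_increment)
  moreover have "\<forall>\<^sub>F z in deep. fatou_const * (U z * (\<eta> (F z) - \<eta> z) / \<eta> z ^ m) = U z * \<zeta> z * ?\<sigma> z"
    using deep_basic(2)
  proof eventually_elim
    case (elim z)
    have "\<eta> z ^ m = \<eta> z * \<eta> z ^ (m - 1)" using m_ge_2 by (cases m) auto
    then show ?case by (simp add: \<zeta>_def mult_ac)
  qed
  ultimately have "((\<lambda>z. U z * \<zeta> z * ?\<sigma> z) \<longlongrightarrow> fatou_const * (v1 ^ k0 * h y0)) deep"
    by (simp add: tendsto_cong)
  from inverse_power_increment[OF eta_relative_increment this, of "m - 1"]
  have lim: "((\<lambda>z. U z * \<zeta> z * (1 / (1 + ?\<sigma> z) ^ (m - 1) - 1)) \<longlongrightarrow>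
      - of_nat (m - 1) * (fatou_const * (v1 ^ k0 * h y0))) deep" .
  have nz: "of_nat (m - 1) * h y0 * v1 ^ k0 \<noteq> 0" using m_ge_2 h_nz v1_nz by simp
  have "- of_nat (m - 1) * (fatou_const * (v1 ^ k0 * h y0))
      = (of_nat (m - 1) * h y0 * v1 ^ k0) / (of_nat (m - 1) * h y0 * v1 ^ k0)"
    by (simp add: fatou_const_def mult_ac)
  then have one: "- of_nat (m - 1) * (fatou_const * (v1 ^ k0 * h y0)) = 1"
    unfolding divide_self[OF nz] .
  have "\<forall>\<^sub>F z in deep. U z * \<zeta> z * (1 / (1 + ?\<sigma> z) ^ (m - 1) - 1) = U z * (\<zeta> (F z) - \<zeta> z)"
    using deep_basic(2)
  proof eventually_elim
    case (elim z)
    then have "\<eta> (F z) = \<eta> z * (1 + ?\<sigma> z)" by (simp add: field_simps)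
    then have "\<eta> (F z) ^ (m - 1) = \<eta> z ^ (m - 1) * (1 + ?\<sigma> z) ^ (m - 1)"
      by (metis power_mult_distrib)
    then have "\<zeta> (F z) = \<zeta> z * (1 / (1 + ?\<sigma> z) ^ (m - 1))" by (simp add: \<zeta>_def)
    then show ?case by (simp add: algebra_simps)
  qed
  from Lim_transform_eventually[OF lim this] show ?thesis unfolding one .
qed

lemma cone_U: "\<forall>\<^sub>F z in deep. \<bar>Im (U z)\<bar> \<le> \<theta> * Re (U z) \<and> Re (U z) > 0"
  using deep_basic(5) deep_basic(4)[of 0] by eventually_elim simp

text \<open>
  \<open>U * N j\<close> tends to \<open>v1 ^ k0 * B j y0\<close>, whose real part is negative, and \<open>U\<close> stays in a cone
  so narrow that dividing by it keeps the real part of \<open>N j\<close> below a negative multiple of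
  \<open>1 / norm U\<close>.
\<close>

lemma resonant_contraction:
  assumes j: "j \<in> R"
  shows "\<forall>\<^sub>F z in deep. norm (1 + N j (u1 z) (u2 z)) \<le> 1 - (3 / 2) * \<gamma> * size z ^ k0"
proof -
  let ?N = "\<lambda>z. N j (u1 z) (u2 z)"
  have lim: "((\<lambda>z. U z * ?N z) \<longlongrightarrow> v1 ^ k0 * B j y0) deep"
    by (rule U_mult_tendsto[OF N_small[OF j] B_tendsto[OF j]])
  have N0: "(?N \<longlongrightarrow> 0) deep" by (rule vanishing_if_U_mult_tendsto[OF lim])
  have "((\<lambda>z. norm (?N z) * norm (U z * ?N z)) \<longlongrightarrow> norm (0 :: complex) * norm (v1 ^ k0 * B j y0)) deep"
    by (intro tendsto_intros lim N0)
  then have "((\<lambda>z. norm (?N z) * norm (U z * ?N z)) \<longlongrightarrow> 0) deep" by simp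
  then have "\<forall>\<^sub>F z in deep. norm (?N z) * norm (U z * ?N z) < \<gamma> / 6"
    by (rule order_tendstoD(2)) (use gamma_pos in simp)
  moreover have "\<forall>\<^sub>F z in deep. norm (?N z) < 1 / 2" using tendstoD[OF N0, of "1 / 2"] by simp
  moreover have "\<forall>\<^sub>F z in deep. norm (U z * ?N z - v1 ^ k0 * B j y0) < \<gamma>"
    using tendstoD[OF lim gamma_pos] by (simp add: dist_norm)
  ultimately show ?thesis using cone_U deep_basic(1)
  proof eventually_elim
    case (elim z)
    have Un: "U z \<noteq> 0" using elim(4) by auto
    have S: "size z ^ k0 = 1 / norm (U z)" by (rule size_power[OF elim(5)])
    have "Re (U z * ?N z / U z) \<le> - (5 / 3) * \<gamma> / norm (U z)"
      using elim(3,4) by (intro Re_divide_cone_le[OF _ theta(2) _ rate[OF j]] gamma_pos) auto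
    then have "Re (?N z) \<le> - (5 / 3) * \<gamma> * size z ^ k0" using Un by (simp add: S)
    moreover have "norm (?N z) ^ 2 \<le> (\<gamma> / 6) * size z ^ k0"
    proof -
      have "norm (?N z) ^ 2 = norm (?N z) * norm (U z * ?N z) * size z ^ k0"
        using Un by (simp add: S norm_mult power2_eq_square)
      also have "\<dots> \<le> (\<gamma> / 6) * size z ^ k0"
        using elim(1) size_nonneg by (intro mult_right_mono) auto
      finally show ?thesis .
    qed
    moreover have "norm (1 + ?N z) \<le> 1 + Re (?N z) + norm (?N z) ^ 2"
      using elim(2) by (intro norm_one_plus_le) simp
    ultimately show ?case by (simp add: algebra_simps)
  qed
qed

text \<open>
  In \<open>D\<close> every coordinate of \<open>X\<close> has modulus less than \<open>radius\<close>.
\<close>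

definition radius :: "complex ^ 'n \<Rightarrow> real" where "radius z = root M (size z)"

lemma radius_power: "radius z ^ M = size z"
  using M_pos size_nonneg by (simp add: radius_def)

lemma radius_nonneg: "radius z \<ge> 0"
  using size_nonneg by (simp add: radius_def real_root_ge_zero)

lemma X_coord_less_radius: "norm (X z $ j) ^ M < size z \<Longrightarrow> norm (X z $ j) < radius z"
  by (rule power_less_imp_less_base[of _ M]) (simp_all add: radius_power radius_nonneg)

lemma size_le_radius: "size z < 1 \<Longrightarrow> size z \<le> radius z"
proof -
  assume "size z < 1"
  then have "size z ^ M \<le> size z ^ 1" using size_nonneg M_pos by (intro power_decreasing) auto
  then have "size z ^ M \<le> radius z ^ M" by (simp add: radius_power)
  then show ?thesis
    using power_mono_iff[of "size z" "radius z" M] M_pos size_nonneg radius_nonneg by simp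
qed

lemma radius_tendsto: "(radius \<longlongrightarrow> 0) deep"
proof -
  have "((\<lambda>z. root M (size z)) \<longlongrightarrow> root M 0) deep" by (intro tendsto_intros size_tendsto)
  then show ?thesis by (simp add: radius_def[abs_def])
qed

text \<open>
  For \<open>j \<in> R\<close> the remainder has order \<open>size ^ (k0 + 4)\<close> and is absorbed by half of the contraction
  rate, as \<open>radius\<close> is at least \<open>size\<close>. For the other coordinates the linear contraction
  dominates the quadratic terms.
\<close>

lemma coordinate_contraction:
  "\<forall>\<^sub>F z in deep. norm (X (F z) $ j) \<le> radius z * (1 - \<gamma> * size z ^ k0)"
proof (cases "j \<in> R")
  case True
  obtain C where C: "C > 0" "\<forall>\<^sub>F z in deep.
      norm (X (F z) $ j - lam $ j * X z $ j * (1 + N j (u1 z) (u2 z))) \<le> C * size z ^ (k0 + 4)"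
    using remainder_small[OF True] by (rule smallE)
  have "\<gamma> / (2 * C) > 0" using C(1) gamma_pos by simp
  from C(2) resonant_contraction[OF True] eventually_size_less[OF this] eventually_size_less[OF zero_less_one]
    deep_basic(8)[of j]
  show ?thesis
  proof eventually_elim
    case (elim z)
    let ?N = "N j (u1 z) (u2 z)" and ?S = "size z ^ k0"
    have "C * size z ^ 3 \<le> C * size z ^ 1"
      using elim(4) C(1) size_nonneg by (intro mult_left_mono power_decreasing) auto
    also have "\<dots> \<le> \<gamma> / 2" using elim(3) C(1) by (simp add: field_simps)
    finally have "C * size z ^ 3 \<le> \<gamma> / 2" .
    moreover have "?S * size z \<le> ?S * radius z"
      using size_le_radius[OF elim(4)] size_nonneg[of z] by (intro mult_left_mono) auto
    ultimately have "(C * size z ^ 3) * (?S * size z) \<le> (\<gamma> / 2) * (?S * radius z)"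
      by (rule mult_mono) (use size_nonneg[of z] gamma_pos in auto)
    then have err: "C * size z ^ (k0 + 4) \<le> (\<gamma> / 2) * ?S * radius z"
      by (simp add: power_add eval_nat_numeral mult_ac)
    have "norm (lam $ j * X z $ j * (1 + ?N)) = norm (X z $ j) * norm (1 + ?N)"
      by (simp add: norm_mult lam_R[OF True])
    also have "\<dots> \<le> radius z * (1 - (3 / 2) * \<gamma> * ?S)"
      using elim(2) X_coord_less_radius[OF elim(5)] radius_nonneg by (intro mult_mono) auto
    finally have main: "norm (lam $ j * X z $ j * (1 + ?N)) \<le> radius z * (1 - (3 / 2) * \<gamma> * ?S)" .
    have "norm (X (F z) $ j) \<le> norm (lam $ j * X z $ j * (1 + ?N)) + norm (X (F z) $ j - lam $ j * X z $ j * (1 + ?N))"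
      by (rule norm_triangle_sub)
    also have "\<dots> \<le> radius z * (1 - (3 / 2) * \<gamma> * ?S) + (\<gamma> / 2) * ?S * radius z"
      using main elim(1) err by linarith
    finally show ?case by (simp add: algebra_simps)
  qed
next
  case False
  obtain C where C: "\<forall>\<^sub>F z in nhds 0. norm (X (F z) $ j - lam $ j * X z $ j) \<le> C * norm (X z) ^ 2"
    using step_out[OF False] by blast
  let ?n = "real CARD('n)"
  have "((\<lambda>z. norm (lam $ j) + \<bar>C\<bar> * ?n\<^sup>2 * radius z + \<gamma> * size z ^ k0) \<longlongrightarrow>
      norm (lam $ j) + \<bar>C\<bar> * ?n\<^sup>2 * 0 + \<gamma> * 0 ^ k0) deep"
    by (intro tendsto_intros radius_tendsto size_tendsto)
  then have "\<forall>\<^sub>F z in deep. norm (lam $ j) + \<bar>C\<bar> * ?n\<^sup>2 * radius z + \<gamma> * size z ^ k0 < 1"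
    by (rule order_tendstoD(2)) (use lam_out[OF False] k0_pos in \<open>simp add: power_0_left\<close>)
  moreover have "\<forall>\<^sub>F z in deep. \<forall>i. norm (X z $ i) ^ M < size z"
    by (intro eventually_all_finite deep_basic(8))
  ultimately show ?thesis using eventually_nhds_0_deep[OF C]
  proof eventually_elim
    case (elim z)
    have coord: "norm (X z $ i) \<le> radius z" for i using X_coord_less_radius elim(2) by (simp add: less_imp_le)
    have "norm (X z) \<le> (\<Sum>i\<in>UNIV. norm (X z $ i))" unfolding norm_vec_def by (rule L2_set_le_sum) simp
    also have "\<dots> \<le> of_nat CARD('n) * radius z" by (intro sum_bounded_above coord)
    finally have "norm (X z) ^ 2 \<le> (?n * radius z) ^ 2" by (intro power_mono) auto
    then have "C * norm (X z) ^ 2 \<le> \<bar>C\<bar> * (?n * radius z) ^ 2" by (intro mult_mono) auto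
    then have err: "norm (X (F z) $ j - lam $ j * X z $ j) \<le> radius z * (\<bar>C\<bar> * ?n\<^sup>2 * radius z)"
      using elim(3) by (simp add: power2_eq_square mult_ac)
    have "norm (lam $ j * X z $ j) \<le> norm (lam $ j) * radius z"
      using coord by (simp add: norm_mult mult_left_mono)
    then have "norm (X (F z) $ j) \<le> radius z * (norm (lam $ j) + \<bar>C\<bar> * ?n\<^sup>2 * radius z)"
      using err norm_triangle_sub[of "X (F z) $ j" "lam $ j * X z $ j"] by (simp add: algebra_simps)
    also have "\<dots> \<le> radius z * (1 - \<gamma> * size z ^ k0)"
      using elim(1) radius_nonneg by (intro mult_left_mono) auto
    finally show ?case .
  qed
qed

lemma coordinate_invariance: "\<forall>\<^sub>F z in deep. \<forall>j. norm (X (F z) $ j) ^ M < size (F z)"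
proof -
  have "\<forall>\<^sub>F z in deep. norm (U z * (growth_P z - 1) - (- 1 / of_nat k0)) < 1"
    using tendstoD[OF U_growth_P zero_less_one] by (simp add: dist_norm)
  moreover have "((\<lambda>z. size z ^ k0) \<longlongrightarrow> 0 ^ k0) deep" "((\<lambda>z. \<gamma> * size z ^ k0) \<longlongrightarrow> \<gamma> * 0 ^ k0) deep"
    by (intro tendsto_intros size_tendsto)+
  from order_tendstoD(2)[OF this(1), of "1 / 4"] order_tendstoD(2)[OF this(2), of 1]
  have "\<forall>\<^sub>F z in deep. size z ^ k0 < 1 / 4" "\<forall>\<^sub>F z in deep. \<gamma> * size z ^ k0 < 1"
    using k0_pos by (simp_all add: power_0_left)
  moreover have "\<forall>\<^sub>F z in deep. \<forall>j. norm (X (F z) $ j) \<le> radius z * (1 - \<gamma> * size z ^ k0)"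
    by (intro eventually_all_finite coordinate_contraction)
  ultimately show ?thesis using growth_P(1) deep_basic(1)
  proof eventually_elim
    case (elim z)
    let ?S = "size z ^ k0"
    have S: "?S > 0" "?S = 1 / norm (U z)" using size_pos[OF elim(6)] size_power[OF elim(6)] by auto
    then have Un: "norm (U z) > 0" using v1_nz elim(6) by (simp add: U_def)
    have "norm (U z * (growth_P z - 1)) \<le> norm (U z * (growth_P z - 1) - (- 1 / of_nat k0)) + norm (- 1 / of_nat k0 :: complex)"
      by (metis add.commute norm_triangle_sub)
    moreover have "norm (- 1 / of_nat k0 :: complex) \<le> 1" using k0_pos by (simp add: norm_divide)
    ultimately have "norm (U z) * norm (growth_P z - 1) \<le> 2" using elim(1) by (simp add: norm_mult)
    then have "norm (growth_P z - 1) \<le> 2 * ?S" using Un by (simp add: S(2) field_simps)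
    moreover have "1 - norm (growth_P z - 1) \<le> norm (growth_P z)"
      using norm_triangle_ineq2[of 1 "1 - growth_P z"] by (simp add: norm_minus_commute)
    ultimately have g: "1 - 2 * ?S \<le> norm (growth_P z)" by linarith
    have size': "size (F z) = size z * norm (growth_P z)"
      unfolding size_def elim(5) by (simp add: norm_mult)
    show ?case
    proof
      fix j
      have "norm (X (F z) $ j) ^ M \<le> (radius z * (1 - \<gamma> * ?S)) ^ M"
        using elim(4) by (intro power_mono) auto
      also have "\<dots> = size z * (1 - \<gamma> * ?S) ^ M" by (simp add: power_mult_distrib radius_power)
      also have "\<dots> < size z * (1 - 2 * ?S)"
        using size_pos[OF elim(6)] contraction_power_less[OF gamma_pos M_gamma S(1) elim(2)] elim(3)
        by (intro mult_strict_left_mono) auto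
      also have "\<dots> \<le> size (F z)" unfolding size' using g size_nonneg by (intro mult_left_mono)
      finally show "norm (X (F z) $ j) ^ M < size (F z)" .
    qed
  qed
qed

end

section \<open>The invariant region and the basin\<close>

lemma cone_norm_increment:
  fixes W W' :: complex
  assumes cone: "\<bar>Im W\<bar> \<le> \<theta> * Re W" "\<theta> \<le> 1 / 2" "Re W > 0"
    and inc: "norm (W' - W - 1) \<le> 1 / 8"
  shows "norm W + 1 / 2 \<le> norm W'"
proof -
  have "(norm W + 2 / 3) ^ 2 \<le> norm (W + 1) ^ 2"
  proof -
    have "norm (W + 1) ^ 2 = norm W ^ 2 + 2 * Re W + 1"
      unfolding cmod_power2 by (simp add: power2_eq_square algebra_simps)
    moreover have "(norm W + 2 / 3) ^ 2 = norm W ^ 2 + 4 / 3 * norm W + 4 / 9"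
      by (simp add: power2_eq_square algebra_simps)
    moreover have "norm W \<le> 3 / 2 * Re W" by (rule cone_norm_le[OF cone])
    ultimately show ?thesis by linarith
  qed
  then have "norm W + 2 / 3 \<le> norm (W + 1)" by (rule power2_le_imp_le) simp
  also have "\<dots> \<le> norm W' + norm (W' - W - 1)"
    using norm_triangle_ineq4[of W' "W' - W - 1"] by (simp add: algebra_simps)
  finally show ?thesis using inc by simp
qed

text \<open>
  Used with the modulus of \<open>\<zeta>\<close> for \<open>a\<close> and of \<open>U\<close> for \<open>\<mu>\<close>: an increment \<open>2 / \<mu>\<close>
  of \<open>a\<close> raises \<open>a ^ n\<close> by less than the least increment \<open>1 / 2\<close> of \<open>\<mu>\<close> once \<open>a\<close> is large.
\<close>

lemma power_increment_less:
  fixes a \<mu> b :: real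
  assumes a: "a ^ n < \<mu>" "real (8 * n) \<le> a" "1 \<le> a" and \<mu>: "1 \<le> \<mu>"
    and b: "0 \<le> b" "b \<le> a + 2 / \<mu>"
  shows "b ^ n < \<mu> + 1 / 2"
proof -
  define t where "t = 2 / (\<mu> * a)"
  have t: "t > 0" "\<mu> * a * t = 2" using a \<mu> by (simp_all add: t_def)
  have "a * 1 \<le> a * \<mu>" using a \<mu> by (intro mult_left_mono) auto
  then have "2 * real n \<le> \<mu> * a" using a(2) by (simp add: mult.commute)
  then have "2 * real n * t \<le> \<mu> * a * t" using t(1) by (intro mult_right_mono) auto
  then have nt: "real n * t \<le> 1" using t(2) by linarith
  have at: "a * t = 2 / \<mu>" using a \<mu> by (simp add: t_def)
  have "b \<le> a * (1 + t)" using b(2) at by (simp add: distrib_left)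
  then have "b ^ n \<le> (a * (1 + t)) ^ n" using b(1) by (intro power_mono)
  also have "\<dots> = a ^ n * (1 + t) ^ n" by (rule power_mult_distrib)
  finally have 1: "b ^ n \<le> a ^ n * (1 + t) ^ n" .
  have "(1 + t) ^ n \<le> exp t ^ n" using t(1) by (intro power_mono exp_ge_add_one_self) auto
  also have "exp t ^ n = exp (real n * t)" by (simp only: exp_of_nat_mult)
  also have "exp (real n * t) \<le> 1 + real n * t + (real n * t)\<^sup>2"
    using nt t(1) by (intro exp_bound) auto
  also have "(real n * t)\<^sup>2 \<le> real n * t"
    unfolding power2_eq_square using nt t(1) by (intro mult_left_le) auto
  finally have "(1 + t) ^ n \<le> 1 + 2 * (real n * t)" by (simp add: mult_ac)
  then have "a ^ n * (1 + t) ^ n \<le> a ^ n * (1 + 2 * (real n * t))"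
    using a(3) by (intro mult_left_mono) auto
  with 1 have "b ^ n \<le> a ^ n * (1 + 2 * (real n * t))" by (rule order_trans)
  also have "\<dots> < \<mu> * (1 + 2 * (real n * t))"
    using a(1) t(1) by (intro mult_strict_right_mono add_pos_nonneg) auto
  also have "\<dots> = \<mu> + 4 * real n / a" using a \<mu> by (simp add: t_def field_simps)
  also have "\<dots> \<le> \<mu> + 1 / 2" using a(2,3) by (simp add: field_simps)
  finally show ?thesis .
qed

lemma Re_divide_cone_nonneg:
  fixes w W :: complex
  assumes w: "norm (w - 1) < 1 / 2" and cone: "\<bar>Im W\<bar> \<le> \<theta> * Re W" "\<theta> \<le> 1 / 2" "Re W > 0"
  shows "Re (w / W) \<ge> 0"
proof -
  have "Re w \<ge> 1 / 2" "\<bar>Im w\<bar> \<le> 1 / 2"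
    using w abs_Re_le_cmod[of "w - 1"] abs_Im_le_cmod[of "w - 1"] by auto
  moreover have "\<theta> * Re W \<le> 1 / 2 * Re W" using cone by (intro mult_right_mono) auto
  then have "\<bar>Im W\<bar> \<le> 1 / 2 * Re W" using cone by linarith
  ultimately have "1 / 2 * Re W \<le> Re w * Re W" "\<bar>Im w\<bar> * \<bar>Im W\<bar> \<le> 1 / 2 * (1 / 2 * Re W)"
    using cone(3) by (intro mult_right_mono mult_mono; simp)+
  moreover have "- (\<bar>Im w\<bar> * \<bar>Im W\<bar>) \<le> Im w * Im W"
    using abs_ge_minus_self[of "Im w * Im W"] by (simp add: abs_mult)
  ultimately have "Re w * Re W + Im w * Im W \<ge> 0" using cone(3) by linarith
  then show ?thesis unfolding Re_divide by (intro divide_nonneg_nonneg) auto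
qed

context irregular_dynamics
begin

text \<open>
  In each step \<open>U\<close> moves by nearly 1 into the cone, \<open>\<zeta>\<close> by nearly \<open>1 / U\<close>, which has positive
  real part, and the bound of \<open>\<zeta>\<close> by \<open>U\<close> persists by the growth of \<open>U\<close>.
\<close>

lemma D_invariant:
  "\<exists>K0 \<ge> 1. \<forall>K \<ge> K0. \<forall>z\<in>D K. F z \<in> D K \<and> Re (U z) + 1 / 2 \<le> Re (U (F z))"
proof -
  have "\<forall>\<^sub>F z in deep. norm (U (F z) - U z - 1) < \<theta> / 4"
    using tendstoD[OF U_increment, of "\<theta> / 4"] theta by (simp add: dist_norm)
  moreover have "\<forall>\<^sub>F z in deep. norm (U z * (\<zeta> (F z) - \<zeta> z) - 1) < 1 / 2"
    using tendstoD[OF zeta_increment, of "1 / 2"] by (simp add: dist_norm)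
  moreover have "\<forall>\<^sub>F z in deep. norm (F z) < rad"
    using eventually_nhds_0_deep[OF tendstoD[OF F_cont rad_pos]] by simp
  moreover have "\<forall>\<^sub>F z in deep. u1 (F z) \<noteq> 0"
    using growth_P(1) growth_P_nz deep_basic(1) by eventually_elim simp
  moreover note eta_step_nz coordinate_invariance
  ultimately have "\<forall>\<^sub>F z in deep. norm (U (F z) - U z - 1) < \<theta> / 4 \<and>
      norm (U z * (\<zeta> (F z) - \<zeta> z) - 1) < 1 / 2 \<and> norm (F z) < rad \<and> u1 (F z) \<noteq> 0 \<and> \<eta> (F z) \<noteq> 0 \<and>
      (\<forall>j. norm (X (F z) $ j) ^ M < size (F z))"
    by eventually_elim blast
  then obtain K1 where K1: "\<And>z. z \<in> D K1 \<Longrightarrow> norm (U (F z) - U z - 1) < \<theta> / 4 \<and>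
      norm (U z * (\<zeta> (F z) - \<zeta> z) - 1) < 1 / 2 \<and> norm (F z) < rad \<and> u1 (F z) \<noteq> 0 \<and> \<eta> (F z) \<noteq> 0 \<and>
      (\<forall>j. norm (X (F z) $ j) ^ M < size (F z))"
    unfolding eventually_deep by blast
  \<comment> \<open>The last entry is the bound on \<open>\<zeta>\<close> that \<open>power_increment_less\<close> needs for the exponent \<open>4 * k0\<close>.\<close>
  define K0 where "K0 = max (max 1 K1) (real (8 * (4 * k0)))"
  have "F z \<in> D K \<and> Re (U z) + 1 / 2 \<le> Re (U (F z))" if "K \<ge> K0" and z: "z \<in> D K" for K z
  proof -
    have K: "K \<ge> 1" "K \<ge> K1" "K \<ge> real (8 * (4 * k0))" using \<open>K \<ge> K0\<close> by (auto simp: K0_def)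
    then have "z \<in> D K1" using z D_antimono by blast
    note h = K1[OF this]
    have W: "K < Re (U z)" "\<bar>Im (U z)\<bar> < \<theta> * Re (U z)" "K < Re (\<zeta> z)" "norm (\<zeta> z) ^ (4 * k0) < norm (U z)"
      using z by (auto simp: D_def)
    have Un: "norm (U z) \<ge> 1" "U z \<noteq> 0" using W(1) K(1) complex_Re_le_cmod[of "U z"] by auto
    have cone: "\<bar>Im (U z)\<bar> \<le> \<theta> * Re (U z)" "\<theta> \<le> 1 / 2" "Re (U z) > 0" using W K theta by auto
    have e8: "norm (U (F z) - U z - 1) \<le> 1 / 8" using h theta by linarith
    have Re_inc: "\<bar>Re (U (F z)) - Re (U z) - 1\<bar> < \<theta> / 4"
      using h abs_Re_le_cmod[of "U (F z) - U z - 1"] by simp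
    have Im_inc: "\<bar>Im (U (F z)) - Im (U z)\<bar> < \<theta> / 4"
      using h abs_Im_le_cmod[of "U (F z) - U z - 1"] by simp
    have Re: "Re (U z) + 1 / 2 \<le> Re (U (F z))" using Re_inc theta by linarith
    have Im: "\<bar>Im (U (F z))\<bar> < \<theta> * Re (U (F z))"
    proof -
      have "\<theta> * (Re (U z) + 1 / 2) \<le> \<theta> * Re (U (F z))" using Re theta by (intro mult_left_mono) auto
      then have "\<theta> * Re (U z) + \<theta> / 2 \<le> \<theta> * Re (U (F z))" by (simp add: algebra_simps)
      then show ?thesis using Im_inc W(2) theta(1) by linarith
    qed
    define w where "w = U z * (\<zeta> (F z) - \<zeta> z)"
    have w1: "norm (w - 1) < 1 / 2" using h unfolding w_def by blast
    have \<zeta>': "\<zeta> (F z) = \<zeta> z + w / U z" using Un by (simp add: w_def)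
    have "Re (w / U z) \<ge> 0" by (rule Re_divide_cone_nonneg[OF w1 cone])
    then have Re\<zeta>: "Re (\<zeta> (F z)) > K" using W(3) unfolding \<zeta>' by simp
    have "norm w \<le> 2" using w1 norm_triangle_ineq2[of w 1] by simp
    then have "norm (w / U z) \<le> 2 / norm (U z)" by (simp add: norm_divide divide_right_mono)
    then have "norm (\<zeta> (F z)) \<le> norm (\<zeta> z) + 2 / norm (U z)"
      unfolding \<zeta>' using norm_triangle_ineq[of "\<zeta> z" "w / U z"] by linarith
    moreover have "norm (\<zeta> z) > K" using W(3) complex_Re_le_cmod[of "\<zeta> z"] by linarith
    ultimately have "norm (\<zeta> (F z)) ^ (4 * k0) < norm (U z) + 1 / 2"
      using W(4) K Un(1) k0_pos by (intro power_increment_less[of "norm (\<zeta> z)"]) auto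
    also have "\<dots> \<le> norm (U (F z))" by (rule cone_norm_increment[OF cone e8])
    finally have "norm (\<zeta> (F z)) ^ (4 * k0) < norm (U (F z))" .
    then show ?thesis using h Re Im Re\<zeta> W(1) by (simp add: D_def)
  qed
  then show ?thesis by (intro exI[of _ K0]) (auto simp: K0_def)
qed

text \<open>
  Along an orbit \<open>Re U\<close> grows at least linearly, so \<open>size\<close>, and with it the
  coordinates, tends to 0.
\<close>

lemma orbit_tendsto:
  assumes inv: "\<And>z. z \<in> D K \<Longrightarrow> F z \<in> D K \<and> Re (U z) + 1 / 2 \<le> Re (U (F z))"
    and "K \<ge> 0" and z: "z \<in> D K"
  shows "(\<lambda>n. (F ^^ n) z) \<longlonglongrightarrow> 0"
proof -
  have orbit: "(F ^^ n) z \<in> D K \<and> real n / 2 \<le> Re (U ((F ^^ n) z))" for n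
  proof (induction n)
    case 0
    then show ?case using z \<open>K \<ge> 0\<close> by (simp add: D_def)
  next
    case (Suc n)
    then show ?case using inv[of "(F ^^ n) z"] by (simp add: field_simps)
  qed
  obtain C where C: "\<And>w q. (\<forall>j. norm (X w $ j) ^ M < size w) \<Longrightarrow> norm (X w) ^ (M * q) \<le> C ^ q * size w ^ q"
    using norm_X_power_le by blast
  let ?p = "M * k0"
  have p: "?p > 0" using M_pos k0_pos by simp
  let ?a = "\<lambda>n. low * norm ((F ^^ n) z)"
  have a0: "?a n \<ge> 0" for n using low_pos by simp
  have bound: "?a n ^ ?p \<le> \<bar>C ^ k0\<bar> * (2 / real n)" if "n > 0" for n
  proof -
    let ?w = "(F ^^ n) z"
    have w: "norm ?w < rad" "\<forall>j. norm (X ?w $ j) ^ M < size ?w" "u1 ?w \<noteq> 0"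
      using orbit[of n] by (auto simp: D_def)
    have "real n / 2 \<le> norm (U ?w)" using orbit[of n] complex_Re_le_cmod[of "U ?w"] by linarith
    then have "size ?w ^ k0 \<le> 2 / real n"
    proof -
      have "norm (U ?w) > 0" using \<open>real n / 2 \<le> norm (U ?w)\<close> that by linarith
      then show ?thesis
        using \<open>real n / 2 \<le> norm (U ?w)\<close> that unfolding size_power[OF w(3)]
        by (simp add: divide_simps)
    qed
    then have "\<bar>C ^ k0\<bar> * size ?w ^ k0 \<le> \<bar>C ^ k0\<bar> * (2 / real n)" by (intro mult_left_mono) auto
    moreover have "C ^ k0 * size ?w ^ k0 \<le> \<bar>C ^ k0\<bar> * size ?w ^ k0"
      using size_nonneg by (intro mult_right_mono) auto
    moreover have "?a n ^ ?p \<le> norm (X ?w) ^ ?p"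
      using X_lower[OF w(1)] a0 by (intro power_mono) auto
    ultimately show ?thesis using C[OF w(2), of k0] by linarith
  qed
  have "(\<lambda>n. \<bar>C ^ k0\<bar> * (2 * (1 / real n))) \<longlonglongrightarrow> \<bar>C ^ k0\<bar> * (2 * 0)"
    by (intro tendsto_intros lim_1_over_n)
  then have lim: "(\<lambda>n. \<bar>C ^ k0\<bar> * (2 / real n)) \<longlonglongrightarrow> 0" by simp
  have "(\<lambda>n. ?a n ^ ?p) \<longlonglongrightarrow> 0"
  proof (rule Lim_null_comparison[OF _ lim])
    show "\<forall>\<^sub>F n in sequentially. norm (?a n ^ ?p) \<le> \<bar>C ^ k0\<bar> * (2 / real n)"
      using eventually_gt_at_top[of 0] by eventually_elim (use bound a0 in simp)
  qed
  then have "(\<lambda>n. root ?p (?a n ^ ?p)) \<longlonglongrightarrow> root ?p 0" by (intro tendsto_intros)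
  then have "?a \<longlonglongrightarrow> 0" using p a0 by (simp add: real_root_power_cancel)
  then have "(\<lambda>n. inverse low * ?a n) \<longlonglongrightarrow> inverse low * 0" by (intro tendsto_intros)
  then have "(\<lambda>n. norm ((F ^^ n) z)) \<longlonglongrightarrow> 0" using low_pos by simp
  then show ?thesis by (rule tendsto_norm_zero_cancel)
qed

lemma open_D: "open (D K)"
proof -
  have Xc: "continuous_on (ball 0 rad) (\<lambda>z. X z $ j)" for j
    by (intro continuous_on_component X_cont)
  have mp: "continuous_on (ball 0 rad) (\<lambda>z. mpow (X z) L)" for L
    unfolding mpow_def by (intro continuous_intros Xc)
  let ?S0 = "{z \<in> ball 0 rad. 0 < norm (u1 z)}"
  have u1c: "continuous_on (ball 0 rad) u1" and u2c: "continuous_on (ball 0 rad) u2"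
    unfolding u1_def[abs_def] u2_def[abs_def] by (rule mp)+
  have S0: "open ?S0" by (intro open_less_on continuous_intros u1c) simp
  have sub0: "?S0 \<subseteq> ball 0 rad" by auto
  note u1c0 = continuous_on_subset[OF u1c sub0] and u2c0 = continuous_on_subset[OF u2c sub0]
  have Uc: "continuous_on ?S0 U" and \<eta>c: "continuous_on ?S0 \<eta>"
    unfolding U_def[abs_def] \<eta>_def[abs_def] y_def[abs_def]
    by (intro continuous_intros u1c0 u2c0; simp)+
  let ?S1 = "{z \<in> ?S0. 0 < norm (\<eta> z)}"
  have S1: "open ?S1" by (intro open_less_on S0 continuous_intros \<eta>c)
  have sub1: "?S1 \<subseteq> ?S0" by auto
  note U1 = continuous_on_subset[OF Uc sub1] and \<eta>1 = continuous_on_subset[OF \<eta>c sub1]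
    and u11 = continuous_on_subset[OF u1c0 sub1]
  have \<zeta>1: "continuous_on ?S1 \<zeta>"
    unfolding \<zeta>_def[abs_def] by (intro continuous_intros \<eta>1) simp
  have X1: "continuous_on ?S1 (\<lambda>z. X z $ j)" for j
    by (rule continuous_on_subset[OF Xc]) auto
  have size1: "continuous_on ?S1 size"
    unfolding size_def[abs_def] using v1_nz by (intro continuous_intros u11) simp
  have "D K = {z \<in> ?S1. K < Re (U z)} \<inter> {z \<in> ?S1. \<bar>Im (U z)\<bar> < \<theta> * Re (U z)} \<inter>
      {z \<in> ?S1. K < Re (\<zeta> z)} \<inter> {z \<in> ?S1. norm (\<zeta> z) ^ (4 * k0) < norm (U z)} \<inter>
      (\<Inter>j\<in>UNIV. {z \<in> ?S1. norm (X z $ j) ^ M < size z})"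
    unfolding D_def by auto
  also have "open \<dots>"
    by (intro open_Int open_INT open_less_on S1 continuous_intros U1 \<zeta>1 X1 size1 ballI finite_class.finite_UNIV)
  finally show ?thesis .
qed

lemma generator_nonzero: "\<exists>i. P i > 0"
  using indep by (metis gr0I mult_0)

lemma zero_not_in_D: "0 \<notin> D K"
proof -
  obtain i where "P i > 0" using generator_nonzero by blast
  then have "mpow (0 :: complex ^ 'n) P = 0"
    unfolding mpow_def by (intro prod_zero bexI[of _ i]) auto
  then show ?thesis by (simp add: D_def u1_def X_0)
qed

text \<open>
  The normalization speaks of \<open>u1\<close> only. As the order \<open>m\<close> of \<open>y * (q y - p y)\<close> at \<open>y0\<close>
  is at least 2, its factor \<open>q - p\<close> vanishes at \<open>y0\<close> even if \<open>y0 = 0\<close>; so \<open>u2\<close>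
  shrinks at the same rate as \<open>u1\<close>.
\<close>

lemma normalized_Q: "of_nat k0 * (v1 ^ k0 * (\<Sum>j\<in>R. of_nat (Q j) * B j y0)) = - 1"
proof -
  let ?f = "\<lambda>y. \<Sum>j\<in>R. (of_nat (Q j) - of_nat (P j)) * B j y"
  have "?f y0 = 0"
  proof (cases "y0 = 0")
    case False
    from eventually_nhds_x_imp_x[OF irregular] show ?thesis using False m_ge_2 by (simp add: power_0_left)
  next
    case True
    have cont: "isCont ?f y0" by (intro continuous_intros B_cont)
    have "((\<lambda>y. h y * y ^ (m - 1)) \<longlongrightarrow> h y0 * y0 ^ (m - 1)) (at y0)"
      using h_cont by (intro tendsto_intros) (simp add: isCont_def)
    then have "((\<lambda>y. h y * y ^ (m - 1)) \<longlongrightarrow> 0) (at y0)" using True m_ge_2 by (simp add: power_0_left)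
    moreover have "\<forall>\<^sub>F y in at y0. h y * y ^ (m - 1) = ?f y"
      unfolding eventually_at_filter using irregular
    proof eventually_elim
      case (elim y)
      have "y ^ m = y * y ^ (m - 1)" using m_ge_2 by (cases m) auto
      then show ?case using elim True by auto
    qed
    ultimately have "(?f \<longlongrightarrow> 0) (at y0)" by (rule Lim_transform_eventually)
    moreover have "(?f \<longlongrightarrow> ?f y0) (at y0)" using cont by (simp add: isCont_def)
    ultimately show ?thesis using tendsto_unique[of "at y0"] by fastforce
  qed
  then have "(\<Sum>j\<in>R. of_nat (Q j) * B j y0) = (\<Sum>j\<in>R. of_nat (P j) * B j y0)"
    by (simp add: left_diff_distrib sum_subtractf)
  then show ?thesis using normalized by simp
qed

text \<open>
  Taking logarithms, this is a linear system for the exponents; two coordinates with a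
  nonzero minor of the matrix of \<open>P\<close> and \<open>Q\<close> suffice to solve it.
\<close>

lemma exists_prescribed_monomials:
  fixes p q :: complex
  assumes "p \<noteq> 0" "q \<noteq> 0"
  shows "\<exists>coef :: complex ^ 'n. mpow coef P = p \<and> mpow coef Q = q"
proof -
  obtain i j where ij: "P i * Q j \<noteq> P j * Q i" using indep by blast
  then have "i \<noteq> j" by (auto simp: mult.commute)
  define \<Delta> where "\<Delta> = (of_nat (P i) * of_nat (Q j) - of_nat (P j) * of_nat (Q i) :: complex)"
  have \<Delta>: "\<Delta> \<noteq> 0" using ij unfolding \<Delta>_def by (metis eq_iff_diff_eq_0 of_nat_eq_iff of_nat_mult)
  define \<alpha> where "\<alpha> = (Ln p * of_nat (Q j) - Ln q * of_nat (P j)) / \<Delta>"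
  define \<beta> where "\<beta> = (Ln q * of_nat (P i) - Ln p * of_nat (Q i)) / \<Delta>"
  have s1: "of_nat (P i) * \<alpha> + of_nat (P j) * \<beta> = Ln p"
  proof -
    have "of_nat (P i) * \<alpha> + of_nat (P j) * \<beta> = Ln p * \<Delta> / \<Delta>"
      unfolding \<alpha>_def \<beta>_def by (simp add: \<Delta>_def algebra_simps flip: add_divide_distrib)
    then show ?thesis using \<Delta> by simp
  qed
  have s2: "of_nat (Q i) * \<alpha> + of_nat (Q j) * \<beta> = Ln q"
  proof -
    have "of_nat (Q i) * \<alpha> + of_nat (Q j) * \<beta> = Ln q * \<Delta> / \<Delta>"
      unfolding \<alpha>_def \<beta>_def by (simp add: \<Delta>_def algebra_simps flip: add_divide_distrib)
    then show ?thesis using \<Delta> by simp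
  qed
  define coef :: "complex ^ 'n" where "coef = (\<chi> h. exp (if h = i then \<alpha> else if h = j then \<beta> else 0))"
  have "mpow coef L = exp (of_nat (L i) * \<alpha> + of_nat (L j) * \<beta>)" for L
  proof -
    have "mpow coef L = exp (\<Sum>h\<in>UNIV. of_nat (L h) * (if h = i then \<alpha> else if h = j then \<beta> else 0))"
      by (simp add: mpow_def coef_def exp_sum exp_of_nat_mult)
    also have "(\<Sum>h\<in>UNIV. of_nat (L h) * (if h = i then \<alpha> else if h = j then \<beta> else 0))
        = (\<Sum>h\<in>UNIV. (if h = i then of_nat (L i) * \<alpha> else 0) + (if h = j then of_nat (L j) * \<beta> else 0))"
      using \<open>i \<noteq> j\<close> by (intro sum.cong) auto
    also have "\<dots> = of_nat (L i) * \<alpha> + of_nat (L j) * \<beta>" by (simp add: sum.distrib)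
    finally show ?thesis .
  qed
  then have "mpow coef P = p \<and> mpow coef Q = q" using s1 s2 assms by simp
  then show ?thesis by blast
qed

text \<open>
  Fix \<open>\<zeta> = T\<close>, hence \<open>\<eta>\<close>, and let \<open>u1 = \<rho> * v1\<close> with \<open>\<rho>\<close> tending to 0 from the right. The
  coordinates \<open>\<rho> powr c j * coef $ j\<close> realize these values because the exponents
  \<open>c j\<close>, proportional to the contraction rates along the direction, have weighted sums 1 for both \<open>P\<close> and \<open>Q\<close>;
  they satisfy \<open>M * c j \<ge> 2\<close>, so the last condition of \<open>D\<close> holds for small \<open>\<rho>\<close>.
\<close>

lemma D_accumulates:
  assumes "e > 0" shows "\<exists>z\<in>D K. norm z < e"
proof -
  define b where "b = (\<lambda>j. v1 ^ k0 * B j y0)"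
  define c where "c = (\<lambda>j. - real k0 * Re (b j))"
  have c: "c j > 0" "real M * c j \<ge> 2" if "j \<in> R" for j
  proof -
    have "0 \<le> \<theta> * \<bar>Im (b j)\<bar>" using theta by simp
    then have "Re (b j) \<le> - 4 * \<gamma>" using rate[OF that] unfolding b_def by linarith
    then have "1 * (4 * \<gamma>) \<le> real k0 * (- Re (b j))"
      using k0_pos gamma_pos by (intro mult_mono) auto
    then have 1: "4 * \<gamma> \<le> c j" by (simp add: c_def)
    then show "c j > 0" using gamma_pos by linarith
    have "real M * (4 * \<gamma>) \<le> real M * c j" using 1 by (intro mult_left_mono) auto
    then show "real M * c j \<ge> 2" using M_gamma by linarith
  qed
  have csum: "(\<Sum>j\<in>R. real (L j) * c j) = 1"
    if "of_nat k0 * (v1 ^ k0 * (\<Sum>j\<in>R. of_nat (L j) * B j y0)) = - 1" for L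
  proof -
    have "of_nat k0 * (v1 ^ k0 * (\<Sum>j\<in>R. of_nat (L j) * B j y0)) = (\<Sum>j\<in>R. of_real (real k0 * real (L j)) * b j)"
      by (simp add: b_def sum_distrib_left mult_ac)
    then have "(\<Sum>j\<in>R. of_real (real k0 * real (L j)) * b j) = - 1" using that by simp
    then have "Re (\<Sum>j\<in>R. of_real (real k0 * real (L j)) * b j) = - 1" by simp
    then have "(\<Sum>j\<in>R. real k0 * real (L j) * Re (b j)) = - 1" by (simp add: Re_sum)
    then show ?thesis by (simp add: c_def sum_negf mult_ac)
  qed
  \<comment> \<open>Of two candidates at most one yields \<open>\<eta> = - y0\<close>, that is \<open>u2 = 0\<close>.\<close>
  obtain T where T: "T > 0" "T > K" "y0 = 0 \<or> of_real T \<noteq> fatou_const / (- y0) ^ (m - 1)"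
  proof (cases "of_real (\<bar>K\<bar> + 1) = fatou_const / (- y0) ^ (m - 1)")
    case True
    have "of_real (\<bar>K\<bar> + 2) \<noteq> fatou_const / (- y0) ^ (m - 1)"
      unfolding True[symmetric] of_real_eq_iff by simp
    then show thesis by - (rule that[of "\<bar>K\<bar> + 2"], simp_all del: of_real_add)
  next
    case False
    then show thesis using that[of "\<bar>K\<bar> + 1"] by auto
  qed
  have "m - 1 \<noteq> 0" using m_ge_2 by simp
  then obtain \<eta>' where \<eta>': "fatou_const / of_real T = \<eta>' ^ (m - 1)" by (rule exists_complex_root)
  have \<eta>'_nz: "\<eta>' \<noteq> 0"
    using \<eta>' T(1) fatou_const_nz \<open>m - 1 \<noteq> 0\<close> by (auto simp: power_0_left)
  have \<zeta>': "fatou_const / \<eta>' ^ (m - 1) = of_real T"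
    using T(1) fatou_const_nz unfolding \<eta>'[symmetric] by simp
  have y': "y0 + \<eta>' \<noteq> 0"
  proof
    assume "y0 + \<eta>' = 0"
    then have "\<eta>' = - y0" by (simp add: eq_neg_iff_add_eq_0 add.commute)
    then show False using T(3) \<zeta>' \<eta>'_nz by auto
  qed
  obtain coef :: "complex ^ 'n" where coef: "mpow coef P = v1" "mpow coef Q = v1 * (y0 + \<eta>')"
    using exists_prescribed_monomials[of v1 "v1 * (y0 + \<eta>')"] v1_nz y' by auto
  define x where "x = (\<lambda>\<rho>. \<chi> j. if j \<in> R then of_real (\<rho> powr c j) * coef $ j else 0 :: complex ^ 'n)"
  have x_mpow: "mpow (x \<rho>) L = of_real \<rho> * mpow coef L"
    if "\<rho> > 0" "\<And>j. j \<notin> R \<Longrightarrow> L j = 0"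
      "of_nat k0 * (v1 ^ k0 * (\<Sum>j\<in>R. of_nat (L j) * B j y0)) = - 1" for \<rho> L
  proof -
    have "(x \<rho> $ j) ^ L j = of_real (\<rho> powr (if j \<in> R then real (L j) * c j else 0)) * (coef $ j) ^ L j" for j
      using that(1,2) by (auto simp: x_def power_mult_distrib powr_realpow[symmetric] powr_powr mult.commute
          simp flip: of_real_power)
    then have "mpow (x \<rho>) L = of_real (\<Prod>j\<in>UNIV. \<rho> powr (if j \<in> R then real (L j) * c j else 0)) * mpow coef L"
      by (simp add: mpow_def prod.distrib)
    also have "(\<Prod>j\<in>UNIV. \<rho> powr (if j \<in> R then real (L j) * c j else 0))
        = \<rho> powr (\<Sum>j\<in>UNIV. if j \<in> R then real (L j) * c j else 0)"
      using that(1) by (simp add: powr_sum)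
    also have "(\<Sum>j\<in>UNIV. if j \<in> R then real (L j) * c j else 0) = (\<Sum>j\<in>R. real (L j) * c j)"
      by (simp add: sum.If_cases)
    also have "\<dots> = 1" by (rule csum[OF that(3)])
    finally show ?thesis using that(1) by simp
  qed
  have small_multiple: "\<forall>\<^sub>F \<rho> in at_right 0. \<rho> * E < 1" for E :: real
  proof -
    have "((\<lambda>\<rho>. \<rho> * E) \<longlongrightarrow> 0 * E) (at_right 0)" by (intro tendsto_intros)
    then show ?thesis by (intro order_tendstoD(2)) auto
  qed
  have pos: "\<forall>\<^sub>F \<rho> in at_right (0 :: real). \<rho> > 0" by (rule eventually_at_right_less)
  have "(x \<longlongrightarrow> 0) (at_right 0)"
  proof (rule vec_tendstoI)
    fix j
    show "((\<lambda>\<rho>. x \<rho> $ j) \<longlongrightarrow> 0 $ j) (at_right 0)"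
    proof (cases "j \<in> R")
      case True
      have "((\<lambda>\<rho>. \<rho> powr c j) \<longlongrightarrow> 0) (at_right 0)"
        using pos c(1)[OF True] by (intro tendsto_zero_powrI tendsto_intros) (auto elim: eventually_mono)
      then have "((\<lambda>\<rho>. of_real (\<rho> powr c j) * coef $ j) \<longlongrightarrow> of_real 0 * coef $ j) (at_right 0)"
        by (intro tendsto_intros)
      then show ?thesis using True by (simp add: x_def)
    qed (simp add: x_def)
  qed
  moreover have "min e rad > 0" using assms rad_pos by simp
  then obtain \<epsilon> where \<epsilon>: "\<epsilon> > 0" "ball 0 \<epsilon> \<subseteq> X ` ball 0 (min e rad)"
    using X_open[of "min e rad"] unfolding mem_interior by blast
  ultimately have "\<forall>\<^sub>F \<rho> in at_right 0. dist (x \<rho>) 0 < \<epsilon>" by (intro tendstoD)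
  moreover have "\<forall>\<^sub>F \<rho> in at_right 0. \<forall>j. \<rho> * norm (coef $ j) ^ M < 1"
    by (intro eventually_all_finite small_multiple)
  ultimately have "\<forall>\<^sub>F \<rho> in at_right 0. \<rho> > 0 \<and> \<rho> * 1 < 1 \<and> \<rho> * \<bar>K\<bar> < 1 \<and> \<rho> * T ^ (4 * k0) < 1 \<and>
      (\<forall>j. \<rho> * norm (coef $ j) ^ M < 1) \<and> dist (x \<rho>) 0 < \<epsilon>"
    using pos small_multiple[of 1] small_multiple[of "\<bar>K\<bar>"] small_multiple[of "T ^ (4 * k0)"]
    by eventually_elim blast
  from eventually_happens'[OF trivial_limit_at_right_real this]
  obtain \<rho> where \<rho>: "\<rho> > 0" "\<rho> < 1" "\<rho> * \<bar>K\<bar> < 1" "\<rho> * T ^ (4 * k0) < 1"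
      "\<And>j. \<rho> * norm (coef $ j) ^ M < 1" "dist (x \<rho>) 0 < \<epsilon>"
    by (elim exE conjE) (rule that; simp)
  have "x \<rho> \<in> ball 0 \<epsilon>" using \<rho>(6) by (simp add: dist_commute)
  then obtain z where z: "norm z < e" "norm z < rad" "X z = x \<rho>" using \<epsilon>(2) by fastforce
  have u1z: "u1 z = of_real \<rho> * v1"
    unfolding u1_def z(3) using x_mpow[OF \<rho>(1) _ normalized] supp coef(1) by simp
  have u2z: "u2 z = of_real \<rho> * (v1 * (y0 + \<eta>'))"
    unfolding u2_def z(3) using x_mpow[OF \<rho>(1) _ normalized_Q] supp coef(2) by simp
  have "\<eta> z = \<eta>'" unfolding \<eta>_def y_def u1z u2z using \<rho>(1) v1_nz by simp
  moreover from this have "\<zeta> z = of_real T" using \<zeta>' by (simp add: \<zeta>_def)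
  moreover have Uz: "U z = of_real (1 / \<rho> ^ k0)"
    unfolding U_def u1z using \<rho>(1) v1_nz by (simp add: power_mult_distrib)
  then have "Re (U z) = 1 / \<rho> ^ k0" "Im (U z) = 0" "norm (U z) = 1 / \<rho> ^ k0"
    using \<rho>(1) by (simp_all only: Re_complex_of_real Im_complex_of_real norm_of_real) simp
  moreover have sz: "size z = \<rho>" unfolding size_def u1z using \<rho>(1) v1_nz by (simp add: norm_mult)
  moreover have inv\<rho>: "1 / \<rho> \<le> 1 / \<rho> ^ k0"
    using \<rho> k0_pos power_decreasing[of 1 k0 \<rho>] by (intro divide_left_mono) auto
  have "\<bar>K\<bar> < 1 / \<rho>" "T ^ (4 * k0) < 1 / \<rho>" using \<rho> by (simp_all add: field_simps)
  then have "K < 1 / \<rho> ^ k0" "T ^ (4 * k0) < 1 / \<rho> ^ k0" using inv\<rho> by linarith+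
  moreover have "norm (X z $ j) ^ M < \<rho>" for j
  proof (cases "j \<in> R")
    case True
    have "norm (X z $ j) ^ M = \<rho> powr (real M * c j) * norm (coef $ j) ^ M"
      using True \<rho>(1) by (simp add: z(3) x_def norm_mult power_mult_distrib powr_realpow[symmetric] powr_powr mult.commute)
    also have "\<dots> \<le> \<rho> powr 2 * norm (coef $ j) ^ M"
      using c(2)[OF True] \<rho>(1,2) by (intro mult_right_mono powr_mono') auto
    also have "\<dots> = \<rho> * (\<rho> * norm (coef $ j) ^ M)" using \<rho>(1) by (simp add: power2_eq_square)
    also have "\<dots> < \<rho> * 1" using \<rho>(1,5) by (intro mult_strict_left_mono) auto
    finally show ?thesis by simp
  next
    case False
    then show ?thesis using \<rho>(1) M_pos by (simp add: z(3) x_def power_0_left)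
  qed
  ultimately have "z \<in> D K"
    using z(2) \<rho>(1) v1_nz T(1,2) \<eta>'_nz theta by (simp add: D_def u1z)
  then show ?thesis using z(1) by blast
qed

theorem basin_exists:
  assumes "ball 0 rad \<subseteq> W" shows "\<exists>V. basin_of_attraction W F V"
proof -
  obtain K where K: "K \<ge> 1" "\<And>z. z \<in> D K \<Longrightarrow> F z \<in> D K \<and> Re (U z) + 1 / 2 \<le> Re (U (F z))"
    using D_invariant by blast
  have "0 \<in> frontier (D K)"
  proof -
    have "0 \<in> closure (D K)"
      unfolding closure_approachable using D_accumulates by (metis dist_0_norm dist_commute)
    then show ?thesis using zero_not_in_D open_D by (simp add: frontier_def interior_open)
  qed
  moreover have "D K \<noteq> {}" using D_accumulates[of 1 K] by auto
  moreover have "D K \<subseteq> W" using assms by (auto simp: D_def)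
  moreover have "F ` D K \<subseteq> D K" using K(2) by blast
  moreover have "\<forall>z\<in>D K. (\<lambda>n. (F ^^ n) z) \<longlonglongrightarrow> 0"
    using orbit_tendsto[OF K(2)] K(1) by simp
  ultimately show ?thesis unfolding basin_of_attraction_def using open_D by blast
qed

end

section \<open>Local coordinates\<close>

lemma has_derivative_lower_bound:
  fixes f :: "'a::real_normed_vector \<Rightarrow> 'b::real_normed_vector"
  assumes "(f has_derivative f') (at 0)" "f 0 = 0" "bounded_linear g'" and g': "\<And>x. g' (f' x) = x"
  shows "\<exists>c>0. \<forall>\<^sub>F z in nhds 0. c * norm z \<le> norm (f z)"
proof -
  obtain K where K: "K > 0" "\<And>x. norm (g' x) \<le> norm x * K"
    using bounded_linear.pos_bounded[OF assms(3)] by blast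
  define e where "e = 1 / (2 * K)"
  have "e > 0" using K(1) by (simp add: e_def)
  then obtain d where d: "d > 0" "\<And>z. norm (z - 0) < d \<Longrightarrow> norm (f z - f 0 - f' (z - 0)) \<le> e * norm (z - 0)"
    using assms(1) unfolding has_derivative_at_alt by blast
  have "e * norm z \<le> norm (f z)" if "norm z < d" for z
  proof -
    have "norm z \<le> norm (f' z) * K" using K(2)[of "f' z"] g' by simp
    then have 1: "2 * e * norm z \<le> norm (f' z)" using K(1) by (simp add: e_def field_simps)
    have "norm (f' z) \<le> norm (f z) + norm (f z - f' z)"
      using norm_triangle_ineq4[of "f z" "f z - f' z"] by simp
    moreover have "norm (f z - f' z) \<le> e * norm z" using d(2)[of z] that assms(2) by simp
    ultimately show ?thesis using 1 by linarith
  qed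
  then have "\<forall>\<^sub>F z in nhds 0. e * norm z \<le> norm (f z)"
    unfolding eventually_nhds_metric using d(1) by auto
  then show ?thesis using \<open>e > 0\<close> by blast
qed

lemma biholomorphism_derivative:
  fixes \<phi> :: "complex ^ 'n::finite \<Rightarrow> complex ^ 'n"
  assumes "biholomorphism_at_origin V \<phi>"
  obtains A A' :: "complex ^ 'n ^ 'n"
  where "(\<phi> has_derivative (\<lambda>h. A *v h)) (at 0)" "\<And>x. A' *v (A *v x) = x" "\<And>x. A *v (A' *v x) = x"
    "bounded_linear (\<lambda>h. A' *v h)"
proof -
  let ?\<psi> = "inv_into V \<phi>"
  have V: "open V" "0 \<in> V" "\<phi> 0 = 0" "inj_on \<phi> V" "open (\<phi> ` V)"
    using assms by (auto simp: biholomorphism_at_origin_def holomorphic_map_on_def)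
  obtain A :: "complex ^ 'n ^ 'n" where A: "(\<phi> has_derivative (\<lambda>h. A *v h)) (at 0)"
    using assms unfolding biholomorphism_at_origin_def holomorphic_map_on_def by blast
  have "\<phi> 0 \<in> \<phi> ` V" using V(2) by blast
  then obtain A' :: "complex ^ 'n ^ 'n" where A': "(?\<psi> has_derivative (\<lambda>h. A' *v h)) (at (\<phi> 0))"
    using assms unfolding biholomorphism_at_origin_def holomorphic_map_on_def by blast
  have "((?\<psi> \<circ> \<phi>) has_derivative ((\<lambda>h. A' *v h) \<circ> (\<lambda>h. A *v h))) (at 0)"
    by (rule diff_chain_at[OF A A'])
  then have "((\<lambda>z. z) has_derivative ((\<lambda>h. A' *v h) \<circ> (\<lambda>h. A *v h))) (at 0)"
    by (rule has_derivative_transform_within_open[OF _ V(1,2)]) (simp add: V(4))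
  then have "(\<lambda>h. A' *v h) \<circ> (\<lambda>h. A *v h) = (\<lambda>h. h)"
    by (rule has_derivative_unique) (rule has_derivative_ident)
  then have left: "A' *v (A *v x) = x" for x by (metis comp_apply)
  then have "A' ** A = mat 1" by (simp add: matrix_eq matrix_vector_mul_assoc[symmetric])
  then have "A ** A' = mat 1" by (simp add: matrix_left_right_inverse)
  then have "A *v (A' *v x) = x" for x by (simp add: matrix_vector_mul_assoc)
  with A left show thesis by (rule that) (rule has_derivative_bounded_linear[OF A'])
qed

lemma holomorphic_map_on_continuous:
  "holomorphic_map_on F V \<Longrightarrow> continuous_on V F"
  unfolding holomorphic_map_on_def
  by (metis continuous_at_imp_continuous_on has_derivative_continuous)

lemma biholomorphism_tendsto_0:
  assumes "biholomorphism_at_origin V F" shows "(F \<longlongrightarrow> 0) (nhds 0)"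
proof -
  have "continuous_on V F" "open V" "0 \<in> V" "F 0 = 0"
    using assms holomorphic_map_on_continuous
    by (auto simp: biholomorphism_at_origin_def holomorphic_map_on_def)
  then have "isCont F 0" by (simp add: continuous_on_eq_continuous_at)
  then show ?thesis using \<open>F 0 = 0\<close> tendsto_at_iff_tendsto_nhds[of F 0] by (simp add: isCont_def)
qed

lemma line_holomorphic_component:
  fixes G :: "complex ^ 'n::finite \<Rightarrow> complex ^ 'n"
  assumes "holomorphic_map_on G V" "ball 0 r \<subseteq> V"
  shows "line_holomorphic r (\<lambda>z. G z $ s)"
  unfolding line_holomorphic_def holomorphic_on_def field_differentiable_def
proof (intro allI ballI)
  fix a b :: "complex ^ 'n" and t assume "t \<in> {t. norm (a + t *s b) < r}"
  then have "a + t *s b \<in> V" using assms(2) by auto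
  then obtain A :: "complex ^ 'n ^ 'n" where A: "(G has_derivative (\<lambda>h. A *v h)) (at (a + t *s b))"
    using assms(1) unfolding holomorphic_map_on_def by blast
  have bl: "bounded_linear (\<lambda>t. t *s b)"
    by (rule bounded_linear_intro[of _ "norm b"])
      (simp_all add: vec_eq_iff algebra_simps norm_vector_smult scaleR_conv_of_real[where 'a = complex])
  have "((\<lambda>t. a + t *s b) has_derivative (\<lambda>h. h *s b)) (at t)"
    using has_derivative_add[OF has_derivative_const[of a] bounded_linear_imp_has_derivative[OF bl]] by simp
  from diff_chain_at[OF this A]
  have "((\<lambda>t. G (a + t *s b)) has_derivative (\<lambda>h. A *v (h *s b))) (at t)"
    by (simp add: o_def)
  then have "((\<lambda>t. G (a + t *s b) $ s) has_derivative (\<lambda>h. (A *v (h *s b)) $ s)) (at t)"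
    by (rule bounded_linear.has_derivative[OF bounded_linear_vec_nth])
  moreover have "(\<lambda>h. (A *v (h *s b)) $ s) = (*) ((A *v b) $ s)"
    by (simp add: fun_eq_iff vector_smult_lzero matrix_vector_mult_def sum_distrib_left sum_distrib_right mult_ac)
  ultimately have "((\<lambda>t. G (a + t *s b) $ s) has_field_derivative (A *v b) $ s) (at t)"
    by (simp add: has_field_derivative_def)
  then show "\<exists>f'. ((\<lambda>t. G (a + t *s b) $ s) has_field_derivative f') (at t within {t. norm (a + t *s b) < r})"
    using has_field_derivative_at_within by blast
qed

lemma tangent_to_identity_derivative:
  fixes w :: "complex ^ 'n::finite \<Rightarrow> complex ^ 'n"
  assumes w: "\<And>s. vanishes_to 2 (\<lambda>z. w z $ s - z $ s)"
  shows "w 0 = 0" "(w has_derivative (\<lambda>h. h)) (at 0)"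
proof -
  have "\<forall>s. \<exists>C. \<forall>\<^sub>F z in nhds 0. norm (w z $ s - z $ s) \<le> C * norm z ^ 2"
    using w unfolding vanishes_to_iff by (rule allI)
  from choice[OF this] obtain C
    where C: "\<forall>s. \<forall>\<^sub>F z in nhds 0. norm (w z $ s - z $ s) \<le> C s * norm z ^ 2" ..
  define E where "E = (\<Sum>s\<in>UNIV. C s)"
  have "\<forall>\<^sub>F z in nhds 0. \<forall>s. norm (w z $ s - z $ s) \<le> C s * norm z ^ 2"
    by (intro eventually_all_finite C[rule_format])
  then have E: "\<forall>\<^sub>F z in nhds 0. norm (w z - z) \<le> E * norm z ^ 2"
  proof eventually_elim
    case (elim z)
    have "norm (w z - z) \<le> (\<Sum>s\<in>UNIV. norm ((w z - z) $ s))" unfolding norm_vec_def by (rule L2_set_le_sum) simp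
    also have "\<dots> \<le> (\<Sum>s\<in>UNIV. C s * norm z ^ 2)" using elim by (intro sum_mono) simp
    finally show ?case by (simp add: E_def sum_distrib_right)
  qed
  show w0: "w 0 = 0" using eventually_nhds_x_imp_x[OF E] by simp
  show "(w has_derivative (\<lambda>h. h)) (at 0)"
    unfolding has_derivative_at
  proof (intro conjI bounded_linear_ident)
    have lim: "((\<lambda>h :: complex ^ 'n. \<bar>E\<bar> * norm h) \<longlongrightarrow> 0) (at 0)"
      by (intro tendsto_mult_right_zero tendsto_norm_zero tendsto_ident_at)
    have "\<forall>\<^sub>F h in at 0. norm (w h - h) \<le> E * norm h ^ 2"
      using E unfolding eventually_at_filter by (rule eventually_mono) simp
    then have "\<forall>\<^sub>F h in at 0. norm (norm (w (0 + h) - w 0 - h) / norm h) \<le> \<bar>E\<bar> * norm h"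
    proof eventually_elim
      case (elim h)
      have "E * norm h ^ 2 \<le> \<bar>E\<bar> * norm h ^ 2" by (intro mult_right_mono) auto
      with elim have "norm (w h - h) \<le> \<bar>E\<bar> * norm h * norm h" by (simp add: power2_eq_square)
      then show ?case using w0 by (cases "h = 0") (simp_all add: divide_le_eq)
    qed
    then show "(\<lambda>h. norm (w (0 + h) - w 0 - h) / norm h) \<midarrow>0\<rightarrow> 0" using lim by (rule Lim_null_comparison)
  qed
qed

text \<open>
  Along a nondegenerate direction \<open>p y0\<close> is nonzero, so $\mu_1=0$ and irregularity means
  $\mu_2\ge2$.
\<close>

lemma irregular_at_factorization:
  assumes irr: "irregular_at H y0"
    and H1: "\<And>u. H (vector [1, u]) $ 1 = p u" and H2: "\<And>u. H (vector [1, u]) $ 2 = u * q u"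
    and hol: "p holomorphic_on UNIV" "q holomorphic_on UNIV" and "p y0 \<noteq> 0"
  obtains m h where "m \<ge> 2" "isCont h y0" "h y0 \<noteq> 0"
    "\<forall>\<^sub>F y in nhds y0. y * (q y - p y) = h y * (y - y0) ^ m"
proof -
  let ?g = "\<lambda>u. u * q u - u * p u"
  have nz: "\<exists>u. ?g u \<noteq> 0" and ord: "zorder ?g y0 > zorder p y0 + 1"
    using irr unfolding irregular_at_def Let_def H1 H2 by auto
  have "p analytic_on {y0}" using hol(1) analytic_on_open analytic_on_subset by blast
  then have "zorder p y0 = 0" using \<open>p y0 \<noteq> 0\<close> by (rule zorder_eq_0I)
  then have m: "nat (zorder ?g y0) \<ge> 2" using ord by simp
  have g_hol: "?g holomorphic_on UNIV" by (intro holomorphic_intros hol)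
  obtain r where r: "r > 0" "zor_poly ?g y0 holomorphic_on cball y0 r"
    "\<And>w. w \<in> cball y0 r \<Longrightarrow> ?g w = zor_poly ?g y0 w * (w - y0) ^ nat (zorder ?g y0) \<and> zor_poly ?g y0 w \<noteq> 0"
    using zorder_exist_zero[OF g_hol open_UNIV connected_UNIV UNIV_I, of y0] nz by blast
  have "isCont (zor_poly ?g y0) y0"
    using holomorphic_on_imp_continuous_on[OF r(2)] r(1)
    by (intro continuous_on_interior[of "cball y0 r"]) auto
  moreover have "zor_poly ?g y0 y0 \<noteq> 0" using r by auto
  moreover have "\<forall>\<^sub>F y in nhds y0. y * (q y - p y) = zor_poly ?g y0 y * (y - y0) ^ nat (zorder ?g y0)"
    unfolding eventually_nhds_metric using r(1,3)
    by (intro exI[of _ r]) (auto simp: dist_commute right_diff_distrib)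
  ultimately show thesis using that m by blast
qed

section \<open>Resonant germs\<close>

text \<open>
  The homogeneous part of degree \<open>k0\<close>, in the resonant monomials \<open>s\<close> and \<open>t\<close>, of the factor by which
  the normal form multiplies the \<open>j\<close>-th coordinate, relative to \<open>lam $ j\<close>. The shadow and
  both conditions on its direction are expressed through it.
\<close>

definition multiplier :: "complex ^ 'n \<Rightarrow> nat \<Rightarrow> (nat \<Rightarrow> nat \<Rightarrow> 'n \<Rightarrow> complex) \<Rightarrow> 'n::finite \<Rightarrow> complex \<Rightarrow> complex \<Rightarrow> complex" where
  "multiplier lam k0 a j s t = (\<Sum>(k1, k2)\<in>{(k1, k2). k1 + k2 = k0}. a k1 k2 j / lam $ j * s ^ k1 * t ^ k2)"

lemma multiplier_homogeneous:
  assumes "s \<noteq> 0" shows "multiplier lam k0 a j s t = s ^ k0 * multiplier lam k0 a j 1 (t / s)"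
  unfolding multiplier_def sum_distrib_left
proof (intro sum.cong refl, clarify)
  fix k1 k2 :: nat assume "k0 = k1 + k2"
  then show "a k1 k2 j / lam $ j * s ^ k1 * t ^ k2 = s ^ (k1 + k2) * (a k1 k2 j / lam $ j * 1 ^ k1 * (t / s) ^ k2)"
    using assms by (simp add: power_add power_divide)
qed

lemma multiplier_holomorphic: "multiplier lam k0 a j 1 holomorphic_on UNIV"
  unfolding multiplier_def[abs_def] case_prod_unfold by (intro holomorphic_intros)

text \<open>
  Exchanging the generators exchanges the two variables; this reduces directions with first
  component 0 to those with nonzero first component.
\<close>

lemma multiplier_swap: "multiplier lam k0 (\<lambda>k1 k2. a k2 k1) j s t = multiplier lam k0 a j t s"
  unfolding multiplier_def
  by (rule sum.reindex_bij_witness[of _ prod.swap prod.swap]) (auto simp: mult_ac)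

text \<open>
  \<open>lam $ j = lam $ j * mpow lam P\<close> is one of the resonances.
\<close>

lemma two_resonant_generator_resonances:
  assumes "two_resonant lam R P Q" "R \<noteq> {}" "\<And>j. j \<in> R \<Longrightarrow> norm (lam $ j) = 1"
  shows "mpow lam P = 1" "mpow lam Q = 1"
proof -
  obtain j where j: "j \<in> R" using assms(2) by blast
  then have nz: "lam $ j \<noteq> 0" using assms(3)[OF j] by auto
  have res: "lam $ j = mpow lam (resonant_index j P Q (k1, k2))" if "k1 + k2 \<ge> 1" for k1 k2
  proof -
    have "\<forall>j\<in>R. \<forall>L. resonance lam j L \<longleftrightarrow>
        (\<exists>k1 k2. k1 + k2 \<ge> 1 \<and> L = (\<lambda>h. unit_index j h + comb P Q k1 k2 h))"
      using assms(1) unfolding two_resonant_def by (elim conjE)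
    then have "resonance lam j (resonant_index j P Q (k1, k2))"
      using j that unfolding resonant_index_def prod.case by blast
    then show ?thesis by (simp add: resonance_def)
  qed
  show "mpow lam P = 1" using res[of 1 0] nz by (simp add: mpow_resonant_index mpow_comb)
  show "mpow lam Q = 1" using res[of 0 1] nz by (simp add: mpow_resonant_index mpow_comb)
qed

lemma two_resonant_independent:
  assumes "two_resonant lam R P Q" shows "\<exists>i j. P i * Q j \<noteq> P j * Q i"
proof (rule ccontr)
  assume *: "\<not> (\<exists>i j. P i * Q j \<noteq> P j * Q i)"
  have indep: "\<forall>x y :: rat. (\<forall>h. x * of_nat (P h) + y * of_nat (Q h) = 0) \<longrightarrow> x = 0 \<and> y = 0"
    using assms unfolding two_resonant_def by blast
  have "P \<noteq> (\<lambda>h. 0)" using indep[rule_format, of 1 0] by auto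
  then obtain i where i: "P i \<noteq> 0" by blast
  have "(of_nat (Q i) :: rat) * of_nat (P h) + (- of_nat (P i)) * of_nat (Q h) = 0" for h
  proof -
    have "P i * Q h = P h * Q i" using * by blast
    then have "(of_nat (P i * Q h) :: rat) = of_nat (P h * Q i)" by simp
    then show ?thesis by (simp add: mult.commute)
  qed
  then have "- of_nat (P i) = (0 :: rat)" using indep by blast
  then show False using i by simp
qed

text \<open>
  Up to the factor \<open>Re W\<close>, the number \<open>Re b + \<theta> * \<bar>Im b\<bar>\<close> is the largest real part of \<open>b * cnj W\<close> for
  \<open>W\<close> in the cone of aperture \<open>\<theta>\<close>. As there are only finitely many multipliers, one aperture and one rate
  serve for all.
\<close>

lemma contraction_constants:
  fixes b :: "'n::finite \<Rightarrow> complex"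
  assumes "\<And>j. j \<in> R \<Longrightarrow> Re (b j) < 0"
  obtains \<theta> \<gamma> :: real and M :: nat
  where "0 < \<theta>" "\<theta> \<le> 1 / 2" "\<gamma> > 0" "M \<ge> 1" "real M * \<gamma> \<ge> 4"
    "\<And>j. j \<in> R \<Longrightarrow> Re (b j) + \<theta> * \<bar>Im (b j)\<bar> \<le> - 4 * \<gamma>"
proof -
  define \<gamma> where "\<gamma> = Min (insert 1 ((\<lambda>j. - Re (b j) / 8) ` R))"
  have \<gamma>: "\<gamma> > 0" using assms unfolding \<gamma>_def by (subst Min_gr_iff) auto
  have \<gamma>_le: "Re (b j) \<le> - 8 * \<gamma>" if "j \<in> R" for j
  proof -
    have "\<gamma> \<le> - Re (b j) / 8" unfolding \<gamma>_def using that by (intro Min_le) auto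
    then show ?thesis by simp
  qed
  define S where "S = (\<Sum>j\<in>UNIV. \<bar>Im (b j)\<bar>) + 1"
  have S: "S > 0" unfolding S_def by (intro add_nonneg_pos sum_nonneg) auto
  have S_ge: "\<bar>Im (b j)\<bar> \<le> S" for j
    unfolding S_def using member_le_sum[of j UNIV "\<lambda>j. \<bar>Im (b j)\<bar>"] by simp
  define \<theta> where "\<theta> = min (1 / 2) (4 * \<gamma> / S)"
  have \<theta>: "0 < \<theta>" "\<theta> \<le> 1 / 2" "\<theta> \<le> 4 * \<gamma> / S" using \<gamma> S by (auto simp: \<theta>_def)
  have "Re (b j) + \<theta> * \<bar>Im (b j)\<bar> \<le> - 4 * \<gamma>" if "j \<in> R" for j
  proof -
    have "\<theta> * \<bar>Im (b j)\<bar> \<le> (4 * \<gamma> / S) * S" using \<theta> \<gamma> S S_ge by (intro mult_mono) auto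
    then show ?thesis using \<gamma>_le[OF that] S by simp
  qed
  moreover obtain M where "real M > 4 / \<gamma>" using reals_Archimedean2 by blast
  then have "real M * \<gamma> \<ge> 4" using \<gamma> by (simp add: field_simps)
  moreover from this have "M \<ge> 1" by (cases M) auto
  ultimately show thesis using \<theta> \<gamma> that by blast
qed

lemma higher_weighted_terms_bound:
  fixes c :: "nat \<Rightarrow> nat \<Rightarrow> complex"
  assumes "finite I" and diag: "{(k1, k2). k1 + k2 = k0} \<subseteq> I"
    and low: "\<And>k1 k2. (k1, k2) \<in> I \<Longrightarrow> k1 + k2 < k0 \<Longrightarrow> c k1 k2 = 0"
    and st: "norm s < 1 / 2" "norm t < 1 / 2"
  shows "norm ((\<Sum>(k1, k2)\<in>I. c k1 k2 * s ^ k1 * t ^ k2) - (\<Sum>(k1, k2)\<in>{(k1, k2). k1 + k2 = k0}. c k1 k2 * s ^ k1 * t ^ k2))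
    \<le> (\<Sum>(k1, k2)\<in>I. norm (c k1 k2)) * (norm s + norm t) ^ (k0 + 1)"
proof -
  let ?D = "{(k1, k2). k1 + k2 = k0}" and ?f = "\<lambda>(k1, k2). c k1 k2 * s ^ k1 * t ^ k2"
  have "(\<Sum>K\<in>I. ?f K) - (\<Sum>K\<in>?D. ?f K) = (\<Sum>K\<in>I - ?D. ?f K)"
    using sum_diff[OF assms(1) diag, of ?f] by simp
  also have "norm \<dots> \<le> (\<Sum>K\<in>I - ?D. (case K of (k1, k2) \<Rightarrow> norm (c k1 k2)) * (norm s + norm t) ^ (k0 + 1))"
  proof (intro sum_norm_le)
    fix K assume K: "K \<in> I - ?D"
    obtain k1 k2 where k: "K = (k1, k2)" by (cases K)
    show "norm (?f K) \<le> (case K of (k1, k2) \<Rightarrow> norm (c k1 k2)) * (norm s + norm t) ^ (k0 + 1)"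
    proof (cases "k1 + k2 < k0")
      case True
      then show ?thesis using low K k by simp
    next
      case False
      then have ge: "k0 + 1 \<le> k1 + k2" using K k by auto
      have "norm s ^ k1 * norm t ^ k2 \<le> (norm s + norm t) ^ k1 * (norm s + norm t) ^ k2"
        by (intro mult_mono power_mono) auto
      also have "\<dots> = (norm s + norm t) ^ (k1 + k2)" by (simp add: power_add)
      also have "\<dots> \<le> (norm s + norm t) ^ (k0 + 1)" using st ge by (intro power_decreasing) auto
      finally have "norm (c k1 k2) * (norm s ^ k1 * norm t ^ k2) \<le> norm (c k1 k2) * (norm s + norm t) ^ (k0 + 1)"
        by (intro mult_left_mono) auto
      then show ?thesis by (simp add: k norm_mult norm_power mult.assoc)
    qed
  qed
  also have "\<dots> = (\<Sum>K\<in>I - ?D. (case K of (k1, k2) \<Rightarrow> norm (c k1 k2))) * (norm s + norm t) ^ (k0 + 1)"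
    by (simp add: sum_distrib_right)
  also have "\<dots> \<le> (\<Sum>K\<in>I. (case K of (k1, k2) \<Rightarrow> norm (c k1 k2))) * (norm s + norm t) ^ (k0 + 1)"
    using assms(1) by (intro mult_right_mono sum_mono2) auto
  finally show ?thesis .
qed

text \<open>
  The coordinates \<open>X\<close> are those of a normalization of sufficiently high order, composed with
  the given conjugacy \<open>\<phi>\<close>. Their derivative at the origin is invertible, so they control the norm
  and, by Sussmann's open mapping theorem, attain all small values.
\<close>

lemma basin_in_affine_direction:
  fixes F :: "complex ^ 'n::finite \<Rightarrow> complex ^ 'n"
  assumes F: "biholomorphism_at_origin W F" and R: "R \<noteq> {}" and res: "two_resonant lam R P Q"
    and lam_R: "\<And>j. j \<in> R \<Longrightarrow> norm (lam $ j) = 1" and lam_out: "\<And>j. j \<notin> R \<Longrightarrow> norm (lam $ j) < 1"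
    and norm_F: "normalization F lam R P Q l a"
    and deg: "\<And>k1 k2. k1 + k2 \<le> k0 \<Longrightarrow> mdeg (comb P Q k1 k2) + 1 < l"
    and low: "\<And>k1 k2 s. k1 + k2 \<ge> 1 \<Longrightarrow> k1 + k2 < k0 \<Longrightarrow> s \<in> R \<Longrightarrow> a k1 k2 s = 0"
    and k0: "k0 \<ge> 1" and v1: "v1 \<noteq> 0"
    and normalized: "of_nat k0 * (\<Sum>j\<in>R. of_nat (P j) * multiplier lam k0 a j v1 v2) = - 1"
    and attracting: "\<And>j. j \<in> R \<Longrightarrow> Re (multiplier lam k0 a j v1 v2) < 0"
    and m: "m \<ge> 2" and h: "isCont h (v2 / v1)" "h (v2 / v1) \<noteq> 0"
    and irregular: "\<forall>\<^sub>F y in nhds (v2 / v1). y * (\<Sum>j\<in>R. (of_nat (Q j) - of_nat (P j)) * multiplier lam k0 a j 1 y)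
      = h y * (y - v2 / v1) ^ m"
  shows "\<exists>V. basin_of_attraction W F V"
proof -
  have hom: "v1 ^ k0 * multiplier lam k0 a j 1 (v2 / v1) = multiplier lam k0 a j v1 v2" for j
    using multiplier_homogeneous[OF v1] by metis
  obtain \<theta> \<gamma> :: real and M :: nat where cst: "0 < \<theta>" "\<theta> \<le> 1 / 2" "\<gamma> > 0" "M \<ge> 1" "real M * \<gamma> \<ge> 4"
    and rate: "\<And>j. j \<in> R \<Longrightarrow> Re (multiplier lam k0 a j v1 v2) + \<theta> * \<bar>Im (multiplier lam k0 a j v1 v2)\<bar> \<le> - 4 * \<gamma>"
    using contraction_constants[of R "\<lambda>j. multiplier lam k0 a j v1 v2"] attracting by blast
  obtain \<phi> G V\<phi> VG where l: "l \<ge> 2" and \<phi>: "biholomorphism_at_origin V\<phi> \<phi>" and G: "biholomorphism_at_origin VG G"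
    and conj: "\<forall>\<^sub>F z in nhds 0. \<phi> (F z) = G (\<phi> z)" and nf: "normal_form lam R P Q l a G"
    using norm_F unfolding normalization_def by blast
  obtain r where r: "r > 0" "ball 0 r \<subseteq> VG"
    using G unfolding biholomorphism_at_origin_def holomorphic_map_on_def by (metis open_contains_ball)
  have G_hol: "line_holomorphic r (\<lambda>z. G z $ s)" for s
    using G r(2) unfolding biholomorphism_at_origin_def by (intro line_holomorphic_component) auto
  define d where "d = M * (k0 + 4)"
  obtain a' w where w: "dulac_coordinates lam R P Q r G (l + d) a' w"
    and a': "\<And>k1 k2. mdeg (comb P Q k1 k2) + 1 < l \<Longrightarrow> a' k1 k2 = a k1 k2"
    using dulac_coordinates_exist[OF res r(1) l G_hol nf, of d] by blast
  note wd = w[unfolded dulac_coordinates_def[OF res]]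
  note w2 = wd[THEN conjunct1, rule_format]
    and w_cont = wd[THEN conjunct2, THEN conjunct2, THEN conjunct2, THEN conjunct1, rule_format]
    and w_out = wd[THEN conjunct2, THEN conjunct2, THEN conjunct2, THEN conjunct2, THEN conjunct1, rule_format]
    and w_R = wd[THEN conjunct2, THEN conjunct2, THEN conjunct2, THEN conjunct2, THEN conjunct2, rule_format]
  define X where "X = (\<lambda>z. w (\<phi> z))"
  have w_at_0: "w 0 = 0" "(w has_derivative (\<lambda>h. h)) (at 0)"
    using tangent_to_identity_derivative[of w] w2 by blast+
  have \<phi>0: "\<phi> 0 = 0" "open V\<phi>" "0 \<in> V\<phi>" "continuous_on V\<phi> \<phi>"
    using \<phi> holomorphic_map_on_continuous by (auto simp: biholomorphism_at_origin_def holomorphic_map_on_def)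
  have X0: "X 0 = 0" by (simp add: X_def \<phi>0 w_at_0)
  obtain A A' :: "complex ^ 'n ^ 'n" where A: "(\<phi> has_derivative (\<lambda>h. A *v h)) (at 0)"
    "\<And>x. A' *v (A *v x) = x" "\<And>x. A *v (A' *v x) = x" and blA': "bounded_linear (\<lambda>h. A' *v h)"
    by (rule biholomorphism_derivative[OF \<phi>]) (rule that; assumption)
  have X_deriv: "(X has_derivative (\<lambda>h. A *v h)) (at 0)"
  proof -
    have "((w \<circ> \<phi>) has_derivative ((\<lambda>h. h) \<circ> (\<lambda>h. A *v h))) (at 0)"
      by (rule diff_chain_at[OF A(1)]) (simp add: \<phi>0 w_at_0)
    then show ?thesis by (simp add: X_def o_def)
  qed
  obtain low_X where low_X: "low_X > 0" "\<forall>\<^sub>F z in nhds 0. low_X * norm z \<le> norm (X z)"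
    using has_derivative_lower_bound[OF X_deriv X0 blA' A(2)] by blast
  obtain low_w where low_w: "low_w > 0" "\<forall>\<^sub>F z in nhds 0. low_w * norm z \<le> norm (w z)"
    using has_derivative_lower_bound[OF w_at_0(2,1) bounded_linear_ident] by blast
  have W: "open W" "0 \<in> W" using F by (auto simp: biholomorphism_at_origin_def holomorphic_map_on_def)
  have "\<forall>\<^sub>F z in nhds 0. z \<in> W \<and> z \<in> V\<phi> \<and> low_X * norm z \<le> norm (X z)"
    using low_X(2) eventually_nhds_in_open[OF W] eventually_nhds_in_open[OF \<phi>0(2,3)] by eventually_elim blast
  then obtain rad where rad: "rad > 0" "\<And>z. norm z < rad \<Longrightarrow> z \<in> W \<and> z \<in> V\<phi> \<and> low_X * norm z \<le> norm (X z)"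
    unfolding eventually_nhds_metric by auto
  have X_cont: "continuous_on (ball 0 rad) X"
  proof -
    have "continuous_on UNIV (\<lambda>z. \<chi> s. w z $ s)" by (intro continuous_on_vec_lambda w_cont)
    then have "continuous_on UNIV w" by simp
    moreover have "continuous_on (ball 0 rad) \<phi>" using \<phi>0(4) rad(2) by (elim continuous_on_subset) auto
    ultimately show ?thesis unfolding X_def by (rule continuous_on_compose2) simp
  qed
  have X_open: "0 \<in> interior (X ` ball 0 \<epsilon>)" if "\<epsilon> > 0" for \<epsilon>
  proof -
    have "X 0 \<in> interior (X ` ball 0 (min \<epsilon> rad))"
    proof (rule sussmann_open_mapping[OF open_ball X_cont _ X_deriv blA'])
      show "(\<lambda>h. A *v h) \<circ> (\<lambda>h. A' *v h) = id" using A(3) by (simp add: fun_eq_iff)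
    qed (use rad(1) that in auto)
    also have "\<dots> \<subseteq> interior (X ` ball 0 \<epsilon>)" by (intro interior_mono image_mono) auto
    finally show ?thesis by (simp add: X0)
  qed
  have \<phi>_lim: "(\<phi> \<longlongrightarrow> 0) (nhds 0)" by (rule biholomorphism_tendsto_0[OF \<phi>])
  have lam_nz: "lam $ j \<noteq> 0" if "j \<in> R" for j using lam_R[OF that] by auto
  let ?I = "{(k1, k2). k1 + k2 \<ge> 1 \<and> mdeg (comb P Q k1 k2) + 1 < l + d}"
  have finI: "finite ?I" by (rule finite_low_degree[OF res])
  define N where "N = (\<lambda>j s t. \<Sum>(k1, k2)\<in>?I. a' k1 k2 j / lam $ j * s ^ k1 * t ^ k2)"
  have N_exp: "\<exists>C \<delta>. \<delta> > 0 \<and> (\<forall>s t. norm s < \<delta> \<and> norm t < \<delta> \<and> s \<noteq> 0 \<longrightarrow>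
      norm (N j s t - s ^ k0 * multiplier lam k0 a j 1 (t / s)) \<le> C * (norm s + norm t) ^ (k0 + 1))" if j: "j \<in> R" for j
  proof (rule exI[of _ "\<Sum>(k1, k2)\<in>?I. norm (a' k1 k2 j / lam $ j)"], rule exI[of _ "1 / 2"], intro conjI allI impI)
    fix s t :: complex assume "norm s < 1 / 2 \<and> norm t < 1 / 2 \<and> s \<noteq> 0"
    then have st: "norm s < 1 / 2" "norm t < 1 / 2" "s \<noteq> 0" by auto
    have "multiplier lam k0 a j s t = (\<Sum>(k1, k2)\<in>{(k1, k2). k1 + k2 = k0}. a' k1 k2 j / lam $ j * s ^ k1 * t ^ k2)"
      unfolding multiplier_def by (intro sum.cong refl) (auto simp: a'[OF deg])
    moreover have "{(k1, k2). k1 + k2 = k0} \<subseteq> ?I" using deg k0 by (auto intro: trans_less_add1)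
    moreover have "a' k1 k2 j / lam $ j = 0" if "(k1, k2) \<in> ?I" "k1 + k2 < k0" for k1 k2
      using that low[OF _ _ j] a'[OF deg] by simp
    ultimately show "norm (N j s t - s ^ k0 * multiplier lam k0 a j 1 (t / s))
        \<le> (\<Sum>(k1, k2)\<in>?I. norm (a' k1 k2 j / lam $ j)) * (norm s + norm t) ^ (k0 + 1)"
      unfolding N_def multiplier_homogeneous[OF st(3), symmetric]
      using higher_weighted_terms_bound[OF finI _ _ st(1,2), of k0 "\<lambda>k1 k2. a' k1 k2 j / lam $ j"] by simp
  qed simp
  \<comment> \<open>Orders of vanishing in the normalized variable become bounds in terms of \<open>X\<close>.\<close>
  have transfer: "\<exists>C. \<forall>\<^sub>F z in nhds 0. norm (f (\<phi> z)) \<le> C * norm (X z) ^ k"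
    if van: "vanishes_to k f" for f :: "complex ^ 'n \<Rightarrow> complex" and k
  proof -
    obtain C where C: "\<forall>\<^sub>F z in nhds 0. norm (f z) \<le> C * norm z ^ k"
      using van[unfolded vanishes_to_iff] ..
    have "\<forall>\<^sub>F z in nhds 0. norm (f (\<phi> z)) \<le> (\<bar>C\<bar> / low_w ^ k) * norm (X z) ^ k"
      using eventually_compose_filterlim[OF C \<phi>_lim] eventually_compose_filterlim[OF low_w(2) \<phi>_lim]
    proof eventually_elim
      case (elim z)
      have "C * norm (\<phi> z) ^ k \<le> \<bar>C\<bar> * norm (\<phi> z) ^ k" by (intro mult_right_mono) auto
      also have "norm (\<phi> z) \<le> norm (X z) / low_w"
        using elim(2) low_w(1) by (simp add: X_def field_simps)
      then have "\<bar>C\<bar> * norm (\<phi> z) ^ k \<le> \<bar>C\<bar> * (norm (X z) / low_w) ^ k"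
        by (intro mult_left_mono power_mono) auto
      finally show ?case using elim(1) by (simp add: power_divide)
    qed
    then show ?thesis by blast
  qed
  have step_R: "\<exists>C. \<forall>\<^sub>F z in nhds 0. norm (X (F z) $ j - lam $ j * X z $ j * (1 + N j (mpow (X z) P) (mpow (X z) Q)))
      \<le> C * norm (X z) ^ (M * (k0 + 4))" if j: "j \<in> R" for j
  proof -
    have "vanishes_to d (\<lambda>z. w (G z) $ j - resonant_polynomial lam P Q (l + d) a' j (w z))"
      by (rule vanishes_to_mono[OF w_R[OF j]]) simp
    from transfer[OF this] obtain C where C: "\<forall>\<^sub>F z in nhds 0.
        norm (w (G (\<phi> z)) $ j - resonant_polynomial lam P Q (l + d) a' j (w (\<phi> z))) \<le> C * norm (X z) ^ d" by blast
    have poly: "resonant_polynomial lam P Q (l + d) a' j x = lam $ j * x $ j * (1 + N j (mpow x P) (mpow x Q))" for x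
    proof -
      have "lam $ j * x $ j * N j (mpow x P) (mpow x Q)
          = (\<Sum>(k1, k2)\<in>?I. a' k1 k2 j * mpow x (comb P Q k1 k2) * x $ j)"
        unfolding N_def sum_distrib_left using lam_nz[OF j]
        by (intro sum.cong refl) (auto simp: mpow_comb)
      then show ?thesis unfolding resonant_polynomial_def[OF res] by (simp add: distrib_left)
    qed
    have "\<forall>\<^sub>F z in nhds 0. norm (X (F z) $ j - lam $ j * X z $ j * (1 + N j (mpow (X z) P) (mpow (X z) Q)))
      \<le> C * norm (X z) ^ (M * (k0 + 4))"
      using C conj by eventually_elim (simp only: poly X_def d_def[symmetric])
    then show ?thesis by blast
  qed
  have step_out: "\<exists>C. \<forall>\<^sub>F z in nhds 0. norm (X (F z) $ j - lam $ j * X z $ j) \<le> C * norm (X z) ^ 2"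
    if j: "j \<notin> R" for j
  proof -
    have "(\<lambda>z. norm (G z $ j - lam $ j * z $ j)) \<in> O[nhds 0](\<lambda>z. norm z ^ 2)"
      by (rule nf[unfolded normal_form_def, THEN conjunct2, rule_format, OF j])
    then obtain C where "\<forall>\<^sub>F z in nhds 0. norm (norm (G z $ j - lam $ j * z $ j)) \<le> C * norm (norm z ^ 2)"
      by (rule landau_o.bigE)
    then have "vanishes_to 2 (\<lambda>z. G z $ j - lam $ j * z $ j)"
      unfolding vanishes_to_iff by (intro exI[of _ C]) simp
    from transfer[OF this] obtain C where C: "\<forall>\<^sub>F z in nhds 0.
        norm (G (\<phi> z) $ j - lam $ j * \<phi> z $ j) \<le> C * norm (X z) ^ 2" by blast
    have "\<forall>\<^sub>F z in nhds 0. norm (X (F z) $ j - lam $ j * X z $ j) \<le> C * norm (X z) ^ 2"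
      using C conj by eventually_elim (simp add: X_def w_out[OF j])
    then show ?thesis by blast
  qed
  have supp: "P j = 0 \<and> Q j = 0" if "j \<notin> R" for j
    by (rule res[unfolded two_resonant_def, THEN conjunct1, rule_format, OF that])
  have norm': "of_nat k0 * (v1 ^ k0 * (\<Sum>j\<in>R. of_nat (P j) * multiplier lam k0 a j 1 (v2 / v1))) = - 1"
  proof -
    have "v1 ^ k0 * (\<Sum>j\<in>R. of_nat (P j) * multiplier lam k0 a j 1 (v2 / v1))
        = (\<Sum>j\<in>R. of_nat (P j) * multiplier lam k0 a j v1 v2)"
      unfolding sum_distrib_left hom[symmetric] by (simp add: mult_ac)
    then show ?thesis using normalized by simp
  qed
  have mult_cont: "isCont (multiplier lam k0 a j 1) y" for j y
    using holomorphic_on_imp_continuous_on[OF multiplier_holomorphic[of lam k0 a j]] by (simp add: continuous_on_eq_continuous_at)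
  have lam_PQ: "mpow lam P = 1" "mpow lam Q = 1"
    by (rule two_resonant_generator_resonances[OF res R]; rule lam_R; assumption)+
  interpret irregular_dynamics F X rad low_X R P Q lam k0 m M v1 "v2 / v1" "\<lambda>j. multiplier lam k0 a j 1" N h \<theta> \<gamma>
    by unfold_locales
      (fact rad(1) low_X(1) X_cont X0 X_open biholomorphism_tendsto_0[OF F] supp two_resonant_independent[OF res]
        lam_PQ lam_R lam_out k0 m cst v1 mult_cont norm' h
        irregular N_exp step_R step_out | (use rad(2) in blast) | (rule mult_cont) | (unfold hom, rule rate, assumption))+
  show ?thesis by (rule basin_exists) (use rad(2) in auto)
qed

lemma two_resonant_swap: "two_resonant lam R P Q \<Longrightarrow> two_resonant lam R Q P"
proof -
  assume res: "two_resonant lam R P Q"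
  have comb: "comb Q P k1 k2 = comb P Q k2 k1" for k1 k2 by (simp add: comb_def add.commute)
  have eq: "(\<exists>k1 k2. k1 + k2 \<ge> 1 \<and> L = (\<lambda>h. unit_index j h + comb Q P k1 k2 h)) \<longleftrightarrow>
    (\<exists>k1 k2. k1 + k2 \<ge> 1 \<and> L = (\<lambda>h. unit_index j h + comb P Q k1 k2 h))" for L j
    unfolding comb by (metis add.commute)
  have indep: "x = 0 \<and> y = 0" if "\<forall>h. x * of_nat (Q h) + y * of_nat (P h) = 0" for x y :: rat
  proof -
    have "\<forall>h. y * of_nat (P h) + x * of_nat (Q h) = 0" using that by (simp add: add.commute)
    then have "y = 0 \<and> x = 0"
      using res[unfolded two_resonant_def, THEN conjunct2, THEN conjunct1, rule_format, of y x] by blast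
    then show ?thesis by simp
  qed
  show ?thesis
    unfolding two_resonant_def eq
  proof (intro conjI)
    show "\<forall>h. h \<notin> R \<longrightarrow> Q h = 0 \<and> P h = 0"
      using res[unfolded two_resonant_def, THEN conjunct1] by simp
    show "\<forall>x y :: rat. (\<forall>h. x * of_nat (Q h) + y * of_nat (P h) = 0) \<longrightarrow> x = 0 \<and> y = 0"
      by (intro allI impI) (rule indep)
  qed (rule res[unfolded two_resonant_def, THEN conjunct2, THEN conjunct2])
qed

lemma normalization_swap:
  assumes "normalization F lam R P Q l a"
  shows "normalization F lam R Q P l (\<lambda>k1 k2. a k2 k1)"
proof -
  have comb: "comb Q P k1 k2 = comb P Q k2 k1" for k1 k2 by (simp add: comb_def add.commute)
  have "(\<Sum>(k1, k2)\<in>{(k1, k2). k1 + k2 \<ge> 1 \<and> mdeg (comb Q P k1 k2) + 1 < l}. a k2 k1 s * mpow z (comb Q P k1 k2) * z $ s)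
      = (\<Sum>(k1, k2)\<in>{(k1, k2). k1 + k2 \<ge> 1 \<and> mdeg (comb P Q k1 k2) + 1 < l}. a k1 k2 s * mpow z (comb P Q k1 k2) * z $ s)"
    for z s by (rule sum.reindex_bij_witness[of _ prod.swap prod.swap]) (auto simp: comb)
  then have "normal_form lam R Q P l (\<lambda>k1 k2. a k2 k1) G = normal_form lam R P Q l a G" for G
    unfolding normal_form_def by simp
  then show ?thesis using assms unfolding normalization_def by simp
qed

lemma shadow_term_multiplier:
  "shadow_term lam R P Q k0 a u $ 1 = u $ 1 * (\<Sum>j\<in>R. of_nat (P j) * multiplier lam k0 a j (u $ 1) (u $ 2))"
  "shadow_term lam R P Q k0 a u $ 2 = u $ 2 * (\<Sum>j\<in>R. of_nat (Q j) * multiplier lam k0 a j (u $ 1) (u $ 2))"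
proof -
  have swap: "(\<Sum>(k1, k2)\<in>{(k1, k2). k1 + k2 = k0}. (\<Sum>j\<in>R. of_nat (L j) * (a k1 k2 j / lam $ j)) * s ^ k1 * t ^ k2)
      = (\<Sum>j\<in>R. of_nat (L j) * multiplier lam k0 a j s t)" for L s t
    unfolding multiplier_def case_prod_unfold sum_distrib_left sum_distrib_right
    by (subst sum.swap) (simp add: mult_ac)
  show "shadow_term lam R P Q k0 a u $ 1 = u $ 1 * (\<Sum>j\<in>R. of_nat (P j) * multiplier lam k0 a j (u $ 1) (u $ 2))"
    "shadow_term lam R P Q k0 a u $ 2 = u $ 2 * (\<Sum>j\<in>R. of_nat (Q j) * multiplier lam k0 a j (u $ 1) (u $ 2))"
    unfolding shadow_term_def vector_2 swap by (rule refl)+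
qed

lemma weighted_order_lower:
  assumes "weighted_order F lam R P Q = enat k0" "normalization F lam R P Q l a"
    and "k1 + k2 \<ge> 1" "mdeg (comb P Q k1 k2) + 1 < l" "s \<in> R" "k1 + k2 < k0"
  shows "a k1 k2 s = 0"
proof (rule ccontr)
  assume "a k1 k2 s \<noteq> 0"
  then have "weighted_order F lam R P Q \<le> enat (k1 + k2)"
    unfolding weighted_order_def using assms(2-5) by (intro Inf_lower) blast
  then show False using assms(1,6) by simp
qed

lemma weighted_order_pos:
  assumes "weighted_order F lam R P Q = enat k0" shows "k0 \<ge> 1"
proof -
  have "enat 1 \<le> weighted_order F lam R P Q"
    unfolding weighted_order_def by (intro Inf_greatest) auto
  then show ?thesis using assms by simp
qed

theorem theorem1:
  fixes F :: "complex ^ 'n::finite \<Rightarrow> complex ^ 'n"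
    and U :: "(complex ^ 'n) set"
    and lam :: "complex ^ 'n"
    and R :: "'n set"
    and P Q :: "'n \<Rightarrow> nat"
  assumes "biholomorphism_at_origin U F"
    and "diagonalizable_differential F lam"
    and "R \<noteq> {}"
    and "two_resonant lam R P Q"
    and "\<And>j. j \<in> R \<Longrightarrow> norm (lam $ j) = 1"
    and "\<And>j. j \<notin> R \<Longrightarrow> norm (lam $ j) < 1"
    and "\<exists>k0 a f v. parabolic_shadow F lam R P Q k0 a f \<and>
           irregular_nondegenerate_wrt k0 f v \<and>
           parabolically_attracting_wrt lam R k0 a f v"
  shows "\<exists>V. basin_of_attraction U F V"
proof -
  obtain k0 a f v where shadow: "parabolic_shadow F lam R P Q k0 a f"
    and irr: "irregular_nondegenerate_wrt k0 f v" and att: "parabolically_attracting_wrt lam R k0 a f v"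
    using assms(7) by blast
  obtain l where order: "weighted_order F lam R P Q = enat k0" and norm_F: "normalization F lam R P Q l a"
    and deg: "\<And>k1 k2. k1 + k2 \<le> k0 \<Longrightarrow> mdeg (comb P Q k1 k2) + 1 < l"
    and f: "f = (\<lambda>u. u + shadow_term lam R P Q k0 a u)"
    using shadow unfolding parabolic_shadow_def by blast
  have k0: "k0 \<ge> 1" by (rule weighted_order_pos[OF order])
  have low: "a k1 k2 s = 0" if "k1 + k2 \<ge> 1" "k1 + k2 < k0" "s \<in> R" for k1 k2 s
    using weighted_order_lower[OF order norm_F that(1) deg that(3,2)] that(2) by simp
  have lead: "leading_part f = shadow_term lam R P Q k0 a" by (simp add: f leading_part_def fun_eq_iff)
  let ?A = "multiplier lam k0 a"
  define p where "p = (\<lambda>s t. \<Sum>j\<in>R. of_nat (P j) * ?A j s t)"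
  define q where "q = (\<lambda>s t. \<Sum>j\<in>R. of_nat (Q j) * ?A j s t)"
  have H: "shadow_term lam R P Q k0 a u $ 1 = u $ 1 * p (u $ 1) (u $ 2)"
    "shadow_term lam R P Q k0 a u $ 2 = u $ 2 * q (u $ 1) (u $ 2)" for u
    unfolding p_def q_def by (rule shadow_term_multiplier)+
  note swap = multiplier_swap[of lam k0 a]
  have hom: "p s t = s ^ k0 * p 1 (t / s)" "q t s = s ^ k0 * q (t / s) 1" if "s \<noteq> 0" for s t
  proof -
    show "p s t = s ^ k0 * p 1 (t / s)"
      unfolding p_def sum_distrib_left by (intro sum.cong refl) (simp add: multiplier_homogeneous[OF that])
    have "?A j t s = s ^ k0 * ?A j (t / s) 1" for j
      using multiplier_homogeneous[OF that, of lam k0 "\<lambda>k1 k2. a k2 k1" j t] unfolding swap .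
    then show "q t s = s ^ k0 * q (t / s) 1"
      unfolding q_def sum_distrib_left by (intro sum.cong refl) simp
  qed
  have "v \<noteq> 0" and eig: "leading_part f v = (- 1 / of_nat k0) *s v" and irr': "irregular_direction f v"
    using irr unfolding irregular_nondegenerate_wrt_def nondegenerate_direction_def normalized_direction_def by auto
  have eig1: "v $ 1 * p (v $ 1) (v $ 2) = - 1 / of_nat k0 * v $ 1"
    and eig2: "v $ 2 * q (v $ 1) (v $ 2) = - 1 / of_nat k0 * v $ 2"
    using arg_cong[OF eig, of "\<lambda>x. x $ 1"] arg_cong[OF eig, of "\<lambda>x. x $ 2"] unfolding lead H by simp_all
  have attracting: "Re (?A j (v $ 1) (v $ 2)) < 0" if "j \<in> R" for j
    using att that unfolding parabolically_attracting_wrt_def multiplier_def by blast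
  have hol: "(\<lambda>y. \<Sum>j\<in>R. of_nat (L j) * ?A j 1 y) holomorphic_on UNIV"
    "(\<lambda>y. \<Sum>j\<in>R. of_nat (L j) * ?A j y 1) holomorphic_on UNIV" for L
  proof -
    have "multiplier lam k0 (\<lambda>k1 k2. a k2 k1) j 1 = (\<lambda>y. ?A j y 1)" for j by (rule ext) (rule swap)
    then have "(\<lambda>y. ?A j y 1) holomorphic_on UNIV" for j
      using multiplier_holomorphic[of lam k0 "\<lambda>k1 k2. a k2 k1" j] by simp
    then show "(\<lambda>y. \<Sum>j\<in>R. of_nat (L j) * ?A j y 1) holomorphic_on UNIV" by (intro holomorphic_intros)
    show "(\<lambda>y. \<Sum>j\<in>R. of_nat (L j) * ?A j 1 y) holomorphic_on UNIV"
      by (intro holomorphic_intros multiplier_holomorphic)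
  qed
  show ?thesis
  proof (cases "v $ 1 = 0")
    case False
    have pv: "p (v $ 1) (v $ 2) = - 1 / of_nat k0"
      by (rule mult_left_cancel[OF False, THEN iffD1]) (simp only: eig1 mult.commute)
    have p_nz: "p 1 (v $ 2 / v $ 1) \<noteq> 0"
    proof
      assume "p 1 (v $ 2 / v $ 1) = 0"
      then show False using pv hom(1)[OF False, of "v $ 2"] k0 by simp
    qed
    have irr_at: "irregular_at (shadow_term lam R P Q k0 a) (v $ 2 / v $ 1)"
      using irr' False unfolding irregular_direction_def lead by simp
    obtain m h where m: "m \<ge> 2" "isCont h (v $ 2 / v $ 1)" "h (v $ 2 / v $ 1) \<noteq> 0"
      "\<forall>\<^sub>F y in nhds (v $ 2 / v $ 1). y * (q 1 y - p 1 y) = h y * (y - v $ 2 / v $ 1) ^ m"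
    proof (rule irregular_at_factorization[OF irr_at, of "p 1" "q 1"])
      show "p 1 holomorphic_on UNIV" "q 1 holomorphic_on UNIV" unfolding p_def q_def by (rule hol)+
    qed (simp_all add: H p_nz that)
    show ?thesis
    proof (rule basin_in_affine_direction[OF assms(1,3,4,5,6) norm_F deg low k0 False _ attracting m(1-3)])
      show "of_nat k0 * (\<Sum>j\<in>R. of_nat (P j) * ?A j (v $ 1) (v $ 2)) = - 1"
        using pv k0 unfolding p_def by simp
      show "\<forall>\<^sub>F y in nhds (v $ 2 / v $ 1). y * (\<Sum>j\<in>R. (of_nat (Q j) - of_nat (P j)) * ?A j 1 y)
          = h y * (y - v $ 2 / v $ 1) ^ m"
        using m(4) unfolding p_def q_def by (simp add: left_diff_distrib sum_subtractf)
    qed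
  next
    case True
    then have v2: "v $ 2 \<noteq> 0" using \<open>v \<noteq> 0\<close> by (simp add: vec_eq_iff forall_2)
    have qv: "q (v $ 1) (v $ 2) = - 1 / of_nat k0"
      by (rule mult_left_cancel[OF v2, THEN iffD1]) (simp only: eig2 mult.commute)
    have q_nz: "q 0 1 \<noteq> 0"
    proof
      assume "q 0 1 = 0"
      then show False using qv hom(2)[OF v2, of "v $ 1"] True k0 by simp
    qed
    have irr_at: "irregular_at (swap2 \<circ> shadow_term lam R P Q k0 a \<circ> swap2) 0"
      using irr' True unfolding irregular_direction_def lead by simp
    obtain m h where m: "m \<ge> 2" "isCont h 0" "h 0 \<noteq> 0"
      "\<forall>\<^sub>F y in nhds 0. y * (p y 1 - q y 1) = h y * (y - 0) ^ m"
    proof (rule irregular_at_factorization[OF irr_at, of "\<lambda>y. q y 1" "\<lambda>y. p y 1"])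
      show "(\<lambda>y. q y 1) holomorphic_on UNIV" "(\<lambda>y. p y 1) holomorphic_on UNIV"
        unfolding p_def q_def by (rule hol)+
    qed (simp_all add: H swap2_def q_nz that)
    let ?a = "\<lambda>k1 k2. a k2 k1"
    have comb: "comb Q P k1 k2 = comb P Q k2 k1" for k1 k2 by (simp add: comb_def add.commute)
    show ?thesis
    proof (rule basin_in_affine_direction[OF assms(1,3) two_resonant_swap[OF assms(4)] assms(5,6)
          normalization_swap[OF norm_F] _ _ k0 v2, where ?v2.0 = "v $ 1" and m = m and h = h])
      show "mdeg (comb Q P k1 k2) + 1 < l" if "k1 + k2 \<le> k0" for k1 k2
        unfolding comb using that by (intro deg) simp
      show "?a k1 k2 s = 0" if "k1 + k2 \<ge> 1" "k1 + k2 < k0" "s \<in> R" for k1 k2 s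
        using that by (intro low) auto
      show "of_nat k0 * (\<Sum>j\<in>R. of_nat (Q j) * multiplier lam k0 ?a j (v $ 2) (v $ 1)) = - 1"
        using qv k0 unfolding q_def swap by simp
      show "Re (multiplier lam k0 ?a j (v $ 2) (v $ 1)) < 0" if "j \<in> R" for j
        unfolding swap by (rule attracting[OF that])
      show "\<forall>\<^sub>F y in nhds (v $ 1 / v $ 2). y * (\<Sum>j\<in>R. (of_nat (P j) - of_nat (Q j)) * multiplier lam k0 ?a j 1 y)
          = h y * (y - v $ 1 / v $ 2) ^ m"
        using m(4) True unfolding p_def q_def swap by (simp add: left_diff_distrib sum_subtractf)
    qed (use m True in auto)
  qed
qed

end
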